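(* Let $0<\rho_1<\rho_2<\infty$, $\Omega=\{x\in\mathbb{R}^2:\rho_1<|x|<\rho_2\}$, and fix $m_2\in\mathbb{R}$. Let $\mu\in(1,\infty)$ and let $g:[0,\infty)\to[0,\infty)$ be of class $C^2([0,\infty))$ such that: (1) there are constants $a,A>0$ and $b,B\in\mathbb{R}$ with $at-b\le g(t)\le At+B$ for all $t\ge 0$; (2) $g(0)=g'(0)=0$; (3) there are constants $\nu_1,\nu_2>0$ and an exponent $\overline{\mu}\in[1,\mu]$ with $$\nu_1(1+t)^{-\mu}\le g''(t)\le \nu_2(1+t)^{-\overline{\mu}}\quad\text{for all } t\ge 0;$$ (4) $\mu-\overline{\mu}<2$. For $\zeta<m_2$ let $u_\zeta(x)=\hat u_\zeta(|x|)$ denote the unique solution of $$\int_\Omega g(|\nabla w|)\,dx+g'_\infty\int_{\{|x|=\rho_1\}}|w-\zeta|\,d\mathcal{H}^1\to\min,\qquad w\in W^{1,1}(\Omega),\quad w=m_2\text{ on }\{|x|=\rho_2\}.$$ Suppose that there exists $m<m_2$ such that the boundary data are not attained by $u_m$ for $|x|=\rho_1$, i.e. $\hat u_m(\rho_1)\ne m$. Then for any $\zeta\le m$ we have $u_\zeta\equiv u_m$.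
   Context: Under the linear growth condition and convexity of $g$ the limit $g'_\infty:=\lim_{t\to\infty}g'(t)=\lim_{t\to\infty}g(t)/t$ exists in $(0,\infty)$. $\mathcal{H}^1$ is one-dimensional Hausdorff measure, and boundary values and boundary integrals of $w\in W^{1,1}(\Omega)$ are understood in the sense of traces. For each $\zeta<m_2$ the minimizing problem in the claim has a unique solution $u_\zeta$; it is radially symmetric and of class $W^{1,1}(\Omega)\cap C^0(\overline{\Omega})\cap C^1(\Omega)\cap W^{2,2}_{\mathrm{loc}}(\Omega)$, so that $\hat u_\zeta(\rho_1)$ is well defined. It is also the unique minimizer in $\mathrm{BV}(\Omega)$ of the relaxed functional $$w\mapsto\int_\Omega g(|\nabla^a w|)\,dx+g'_\infty|\nabla^s w|(\Omega)+g'_\infty\int_{\partial\Omega}|u_0-w|\,d\mathcal{H}^1,$$ where $u_0=\zeta$ on $\{|x|=\rho_1\}$, $u_0=m_2$ on $\{|x|=\rho_2\}$, and $\nabla^a w,\nabla^s w$ are the absolutely continuous and singular parts of the measure $\nabla w$ with respect to Lebesgue measure. *)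

theory Defs
  imports "HOL-Analysis.Analysis"
begin

section \<open>One-dimensional Hausdorff measure\<close>

text \<open>In dimension one the usual normalising factor $\omega_s / 2^s$ of the Hausdorff measure
  equals 1. The boundedness requirement is needed because \<^const>\<open>diameter\<close> is
  unspecified on unbounded sets.\<close>

definition hausdorff1_pre :: "real \<Rightarrow> 'a::metric_space set \<Rightarrow> ennreal" where
  "hausdorff1_pre \<delta> E =
     (INF C \<in> {C :: nat \<Rightarrow> 'a set. E \<subseteq> (\<Union>i. C i) \<and> (\<forall>i. bounded (C i) \<and> diameter (C i) \<le> \<delta>)}.
        \<Sum>i. ennreal (diameter (C i)))"

definition hausdorff1_outer :: "'a::metric_space set \<Rightarrow> ennreal" where
  "hausdorff1_outer E = (SUP \<delta> \<in> {0<..}. hausdorff1_pre \<delta> E)"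

text \<open>The restriction to the Borel sets. As \<^const>\<open>hausdorff1_outer\<close> is a metric outer
  measure, Caratheodory's criterion makes it countably additive on the Borel sets, so
  \<^const>\<open>measure_of\<close> does not fall back to the zero measure.\<close>

definition hausdorff1 :: "'a::metric_space measure" where
  "hausdorff1 = measure_of UNIV (sets borel) hausdorff1_outer"


section \<open>The Sobolev space $W^{1,1}$ and traces\<close>

text \<open>\<open>\<phi>\<close> is a $C^1$ function with compact support in \<open>\<Omega>\<close> and gradient \<open>D\<phi>\<close>.\<close>

definition C1_test :: "'a::euclidean_space set \<Rightarrow> ('a \<Rightarrow> real) \<Rightarrow> ('a \<Rightarrow> 'a) \<Rightarrow> bool" where
  "C1_test \<Omega> \<phi> D\<phi> \<longleftrightarrow>
     (\<forall>x. GDERIV \<phi> x :> D\<phi> x) \<and> continuous_on UNIV D\<phi> \<and>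
     (\<exists>K. compact K \<and> K \<subseteq> \<Omega> \<and> (\<forall>x. x \<notin> K \<longrightarrow> \<phi> x = 0))"

text \<open>\<open>w\<close> belongs to $W^{1,1}(\Omega)$ and \<open>G\<close> represents its weak gradient.
  Functions are representatives of classes modulo Lebesgue null sets; \<open>G\<close> is unique in
  this sense.\<close>

definition W11_gradient :: "'a::euclidean_space set \<Rightarrow> ('a \<Rightarrow> real) \<Rightarrow> ('a \<Rightarrow> 'a) \<Rightarrow> bool" where
  "W11_gradient \<Omega> w G \<longleftrightarrow>
     w absolutely_integrable_on \<Omega> \<and> G absolutely_integrable_on \<Omega> \<and>
     (\<forall>\<phi> D\<phi>. C1_test \<Omega> \<phi> D\<phi> \<longrightarrow>
        (LINT x:\<Omega>|lebesgue. w x *\<^sub>R D\<phi> x) = - (LINT x:\<Omega>|lebesgue. \<phi> x *\<^sub>R G x))"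

text \<open>\<open>T\<close> represents the trace of $w \in W^{1,1}(\Omega)$ on the boundary. On a bounded
  Lipschitz domain the trace operator is the continuous extension to $W^{1,1}(\Omega)$, with values
  in $L^1(\partial\Omega; \mathcal{H}^1)$, of the restriction $v \mapsto v|_{\partial\Omega}$ defined for
  $v \in W^{1,1}(\Omega) \cap C^0(\overline{\Omega})$; the following is the graph of this extension.\<close>

definition has_trace :: "(real^2) set \<Rightarrow> (real^2 \<Rightarrow> real) \<Rightarrow> (real^2 \<Rightarrow> real) \<Rightarrow> bool" where
  "has_trace \<Omega> w T \<longleftrightarrow>
     set_integrable hausdorff1 (frontier \<Omega>) T \<and>
     (\<exists>G v Dv. W11_gradient \<Omega> w G \<and>
        (\<forall>k::nat. continuous_on (closure \<Omega>) (v k) \<and> W11_gradient \<Omega> (v k) (Dv k)) \<and>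
        (\<lambda>k. LINT x:\<Omega>|lebesgue. \<bar>v k x - w x\<bar>) \<longlonglongrightarrow> 0 \<and>
        (\<lambda>k. LINT x:\<Omega>|lebesgue. norm (Dv k x - G x)) \<longlonglongrightarrow> 0 \<and>
        (\<lambda>k. LINT x:frontier \<Omega>|hausdorff1. \<bar>v k x - T x\<bar>) \<longlonglongrightarrow> 0)"


section \<open>The variational problem on the annulus\<close>

definition annulus :: "real \<Rightarrow> real \<Rightarrow> (real^2) set" where
  "annulus \<rho>1 \<rho>2 = {x. \<rho>1 < norm x \<and> norm x < \<rho>2}"

text \<open>$g'_\infty$, for \<open>g'\<close> the derivative of \<open>g\<close>; for convex \<open>g\<close> of linear growth the limit
  exists and is also the limit of \<open>g t / t\<close>.\<close>

definition slope_at_infinity :: "(real \<Rightarrow> real) \<Rightarrow> real" where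
  "slope_at_infinity g' = Lim at_top g'"

text \<open>\<open>w\<close> is a competitor; \<open>G\<close> and \<open>T\<close> are its weak gradient and its trace.\<close>

definition competitor ::
  "real \<Rightarrow> real \<Rightarrow> real \<Rightarrow> (real^2 \<Rightarrow> real) \<Rightarrow> (real^2 \<Rightarrow> real^2) \<Rightarrow> (real^2 \<Rightarrow> real) \<Rightarrow> bool" where
  "competitor \<rho>1 \<rho>2 m2 w G T \<longleftrightarrow>
     W11_gradient (annulus \<rho>1 \<rho>2) w G \<and> has_trace (annulus \<rho>1 \<rho>2) w T \<and>
     (AE x in hausdorff1. norm x = \<rho>2 \<longrightarrow> T x = m2)"

definition energy ::
  "(real \<Rightarrow> real) \<Rightarrow> real \<Rightarrow> real \<Rightarrow> real \<Rightarrow> real \<Rightarrow> (real^2 \<Rightarrow> real^2) \<Rightarrow> (real^2 \<Rightarrow> real) \<Rightarrow> real" where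
  "energy g ginf \<rho>1 \<rho>2 \<zeta> G T =
     (LINT x:annulus \<rho>1 \<rho>2|lebesgue. g (norm (G x))) +
     ginf * (LINT x:{x. norm x = \<rho>1}|hausdorff1. \<bar>T x - \<zeta>\<bar>)"

definition is_minimizer ::
  "(real \<Rightarrow> real) \<Rightarrow> real \<Rightarrow> real \<Rightarrow> real \<Rightarrow> real \<Rightarrow> real \<Rightarrow> (real^2 \<Rightarrow> real) \<Rightarrow> bool" where
  "is_minimizer g ginf \<rho>1 \<rho>2 m2 \<zeta> u \<longleftrightarrow>
     (\<exists>G T. competitor \<rho>1 \<rho>2 m2 u G T \<and>
        (\<forall>w Gw Tw. competitor \<rho>1 \<rho>2 m2 w Gw Tw \<longrightarrow>
           energy g ginf \<rho>1 \<rho>2 \<zeta> G T \<le> energy g ginf \<rho>1 \<rho>2 \<zeta> Gw Tw))"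

text \<open>Uniqueness is equality in $W^{1,1}$, i.e. almost everywhere.\<close>

definition is_unique_minimizer ::
  "(real \<Rightarrow> real) \<Rightarrow> real \<Rightarrow> real \<Rightarrow> real \<Rightarrow> real \<Rightarrow> real \<Rightarrow> (real^2 \<Rightarrow> real) \<Rightarrow> bool" where
  "is_unique_minimizer g ginf \<rho>1 \<rho>2 m2 \<zeta> u \<longleftrightarrow>
     is_minimizer g ginf \<rho>1 \<rho>2 m2 \<zeta> u \<and>
     (\<forall>v. is_minimizer g ginf \<rho>1 \<rho>2 m2 \<zeta> v \<longrightarrow>
        (AE x in lebesgue. x \<in> annulus \<rho>1 \<rho>2 \<longrightarrow> v x = u x))"

end

theory Submission
  imports Defs
begin

text \<open>Only the boundary term of the functional depends on \<open>\<zeta>\<close>. Write \<open>F w\<close> for the integral of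
\<open>g(|\<nabla>w|)\<close>, \<open>\<gamma>\<close> for \<open>g'\<^sub>\<infinity>\<close> and \<open>c\<close> for the value of \<open>u\<close> on the inner circle. Comparing \<open>u\<close> with
\<open>(1 - \<epsilon>) u + \<epsilon> w\<close>, using convexity of \<open>F\<close>, dividing by \<open>\<epsilon>\<close> and letting \<open>\<epsilon>\<close> tend to 0 gives for every
competitor \<open>w\<close>
\<open>0 \<le> F w - F u + \<gamma> * (integral of sgn (c - m) * (w - c) over the inner circle)\<close>,
because the modulus is differentiable at \<open>c - m\<close>, which is not 0 (\<open>minimizer_first_variation\<close>).
The constant \<open>w = m2\<close> has \<open>F w = 0\<close>; if \<open>c < m < m2\<close>, it would make the right-hand side negative.
So \<open>c > m\<close>. For \<open>\<zeta> \<le> m\<close> the boundary term of \<open>u\<close> is the integral of \<open>c - \<zeta>\<close>, and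
\<open>\<bar>w - \<zeta>\<bar> \<ge> (c - \<zeta>) + (w - c)\<close>, so the same inequality, now with sign 1, says that \<open>u\<close> minimizes the
functional for \<open>\<zeta>\<close>. By strict convexity of \<open>\<xi> \<mapsto> g(|\<xi>|)\<close> a second minimizer has the same
gradient (\<open>minimizer_unique\<close>); the difference has gradient 0 and trace 0 on the outer circle, and
therefore vanishes.

This argument evaluates the boundary term of \<open>u\<close> by its boundary values, and it uses that a function with
gradient 0 and outer trace 0 vanishes. Both statements concern traces, which are defined through
\<open>L\<^sup>1\<close> limits with respect to the Hausdorff measure.

\<^item> The Hausdorff measure is a measure on the Borel sets, by the criterion for metric outer measures. It is
  invariant under isometries, and finite and positive on circles. By Fubini's theorem any two rotation
  invariant measures on a circle have proportional integrals (\<open>invariant_means_agree\<close>), which relates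
  integrals over a circle to integrals over thin shells (\<open>circle_mean\<close>, \<open>shell_average\<close>).

\<^item> If \<open>Q\<close> is constant along rays and \<open>\<kappa>\<close> is a \<open>C\<^sup>1\<close> function with compact support in
  the open interval from \<open>\<rho>1\<^sup>2\<close> to \<open>\<rho>2\<^sup>2\<close>, then the field \<open>\<kappa>(|x|\<^sup>2) Q(x) x / |x|\<^sup>2\<close> has divergence
  \<open>2 \<kappa>'(|x|\<^sup>2) Q(x)\<close>, since \<open>x / |x|\<^sup>2\<close> is divergence free in the plane. Testing the weak gradient
  with it bounds the integral of \<open>v(x) Q(x) k(|x|\<^sup>2)\<close> by the \<open>L\<^sup>1\<close> norm of the gradient whenever \<open>k\<close> has mean
  zero (\<open>radial_weak_bound\<close>). This replaces polar coordinates.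

\<^item> With \<open>Q = 1\<close> and \<open>k\<close> the difference of a bump near a boundary circle and a fixed bump, the
  bound controls circle integrals of continuous functions by the \<open>W\<^sup>1\<^sup>,\<^sup>1\<close> norm
  (\<open>circle_integral_bound\<close>). So every trace of \<open>u\<close> has the same integral over each boundary
  circle as \<open>u\<close> itself. Since \<open>u\<close> is constant on circles, Jensen's inequality shows that replacing a
  trace of \<open>u\<close> by the boundary values of \<open>u\<close> does not increase the energy (\<open>continuous_radial_minimizer\<close>).

\<^item> With general \<open>Q\<close>, the bound shows that a function with gradient 0 and outer trace 0 is
  orthogonal to all products \<open>Q(x) k(|x|\<^sup>2)\<close>. These products generate the polynomials, and a
  function orthogonal to all polynomials is 0 almost everywhere
  (\<open>zero_gradient_zero_trace_imp_AE_zero\<close>).\<close>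

section \<open>The Hausdorff measure on the Borel sets\<close>

lemma hausdorff1_pre_le:
  assumes "E \<subseteq> (\<Union>i. C i)" "\<And>i. bounded (C i)" "\<And>i. diameter (C i) \<le> \<delta>"
  shows "hausdorff1_pre \<delta> E \<le> (\<Sum>i. ennreal (diameter (C i)))"
  unfolding hausdorff1_pre_def by (rule INF_lower) (use assms in auto)

lemma hausdorff1_pre_antimono:
  assumes "\<delta>' \<le> \<delta>"
  shows "hausdorff1_pre \<delta> E \<le> hausdorff1_pre \<delta>' E"
  unfolding hausdorff1_pre_def
  by (rule INF_superset_mono) (use assms order_trans in blast)+

lemma hausdorff1_pre_mono:
  assumes "E \<subseteq> F"
  shows "hausdorff1_pre \<delta> E \<le> hausdorff1_pre \<delta> F"
  unfolding hausdorff1_pre_def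
  by (rule INF_superset_mono) (use assms order_trans in blast)+

lemma hausdorff1_pre_empty: "0 \<le> \<delta> \<Longrightarrow> hausdorff1_pre \<delta> {} = 0"
  using hausdorff1_pre_le[of "{}" "\<lambda>_. {}" \<delta>] by simp

text \<open>Covers of the single sets, chosen optimal up to \<open>e / 2\<^sup>n\<^sup>+\<^sup>1\<close>, are enumerated as one cover of the union.\<close>

lemma hausdorff1_pre_countable:
  "hausdorff1_pre \<delta> (\<Union>n. A n) \<le> (\<Sum>n. hausdorff1_pre \<delta> (A n))"
proof (rule ennreal_le_epsilon)
  fix e :: real assume "0 < e" and fin: "(\<Sum>n. hausdorff1_pre \<delta> (A n)) < top"
  have "\<exists>C. A n \<subseteq> (\<Union>i. C i) \<and> (\<forall>i. bounded (C i) \<and> diameter (C i) \<le> \<delta>) \<and>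
      (\<Sum>i. ennreal (diameter (C i))) < hausdorff1_pre \<delta> (A n) + ennreal (e * (1/2) ^ Suc n)" for n
  proof -
    have "hausdorff1_pre \<delta> (A n) < hausdorff1_pre \<delta> (A n) + ennreal (e * (1/2) ^ Suc n)"
      using \<open>0 < e\<close> ennreal_suminf_lessD[OF fin, of n] by (simp add: ennreal_add_left_cancel_less)
    then show ?thesis
      by (subst (asm) hausdorff1_pre_def) (auto simp: INF_less_iff)
  qed
  then obtain B where B: "\<And>n. A n \<subseteq> (\<Union>i. B n i)" "\<And>n i. bounded (B n i)"
      "\<And>n i. diameter (B n i) \<le> \<delta>"
      "\<And>n. (\<Sum>i. ennreal (diameter (B n i))) < hausdorff1_pre \<delta> (A n) + ennreal (e * (1/2) ^ Suc n)"
    by metis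
  define C where "C = case_prod B o prod_decode"
  have "hausdorff1_pre \<delta> (\<Union>n. A n) \<le> (\<Sum>i. ennreal (diameter (C i)))"
  proof (rule hausdorff1_pre_le)
    show "\<Union> (range A) \<subseteq> \<Union> (range C)"
      using B(1) by (auto simp add: C_def subset_eq) (metis prod.case prod_encode_inverse)
  qed (auto simp: C_def B split: prod.split)
  also have "\<dots> = (\<Sum>n. \<Sum>i. ennreal (diameter (B n i)))"
    unfolding C_def comp_def
    using suminf_ennreal_2dimen[where g="\<lambda>n. \<Sum>i. ennreal (diameter (B n i))"
        and f="\<lambda>(n, i). ennreal (diameter (B n i))"]
    by (simp add: case_prod_unfold)
  also have "\<dots> \<le> (\<Sum>n. hausdorff1_pre \<delta> (A n) + e * (1/2) ^ Suc n)"
    using B(4) by (intro suminf_le allI) (auto intro: less_imp_le)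
  also have "\<dots> = (\<Sum>n. hausdorff1_pre \<delta> (A n)) + (\<Sum>n. ennreal e * ennreal ((1/2) ^ Suc n))"
    using \<open>0 < e\<close> by (subst suminf_add[symmetric])
                     (auto simp del: ennreal_suminf_cmult simp add: ennreal_mult[symmetric])
  also have "\<dots> = (\<Sum>n. hausdorff1_pre \<delta> (A n)) + e"
    unfolding ennreal_suminf_cmult
    by (subst suminf_ennreal_eq[OF zero_le_power power_half_series]) auto
  finally show "hausdorff1_pre \<delta> (\<Union>n. A n) \<le> (\<Sum>n. hausdorff1_pre \<delta> (A n)) + ennreal e" .
qed

text \<open>The countable form of the supremum is increasing, so that it commutes with sums.\<close>

lemma hausdorff1_outer_eq_SUP:
  "hausdorff1_outer E = (SUP n. hausdorff1_pre (1 / real (Suc n)) E)"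
  unfolding hausdorff1_outer_def
proof (rule antisym)
  show "(SUP \<delta>\<in>{0<..}. hausdorff1_pre \<delta> E) \<le> (SUP n. hausdorff1_pre (1 / real (Suc n)) E)"
  proof (rule SUP_least)
    fix \<delta> :: real assume "\<delta> \<in> {0<..}"
    then obtain n where "1 / real (Suc n) < \<delta>"
      using nat_approx_posE[of \<delta>] by auto
    then show "hausdorff1_pre \<delta> E \<le> (SUP n. hausdorff1_pre (1 / real (Suc n)) E)"
      by (intro SUP_upper2[of n] hausdorff1_pre_antimono) auto
  qed
qed (rule SUP_mono, auto)

lemma hausdorff1_pre_incseq: "incseq (\<lambda>n. hausdorff1_pre (1 / real (Suc n)) E)"
  by (intro monoI hausdorff1_pre_antimono) (auto simp: field_simps)

lemma hausdorff1_outer_countable: "hausdorff1_outer (\<Union>n. A n) \<le> (\<Sum>n. hausdorff1_outer (A n))"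
  unfolding hausdorff1_outer_def[of "\<Union>n. A n"]
proof (rule SUP_least)
  fix \<delta> :: real assume "\<delta> \<in> {0<..}"
  then have "(\<Sum>n. hausdorff1_pre \<delta> (A n)) \<le> (\<Sum>n. hausdorff1_outer (A n))"
    by (auto simp: hausdorff1_outer_def intro!: suminf_le SUP_upper)
  then show "hausdorff1_pre \<delta> (\<Union>n. A n) \<le> (\<Sum>n. hausdorff1_outer (A n))"
    using hausdorff1_pre_countable order_trans by blast
qed

lemma hausdorff1_outer_measure_space: "outer_measure_space UNIV hausdorff1_outer"
  unfolding outer_measure_space_def
proof (intro conjI)
  show "positive UNIV hausdorff1_outer"
    by (simp add: positive_def hausdorff1_outer_eq_SUP hausdorff1_pre_empty)
  show "increasing UNIV hausdorff1_outer"
    unfolding increasing_def hausdorff1_outer_def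
    by (auto intro!: SUP_mono hausdorff1_pre_mono)
  show "countably_subadditive UNIV hausdorff1_outer"
    by (auto simp: countably_subadditive_def intro: hausdorff1_outer_countable)
qed

lemma hausdorff1_outer_mono: "E \<subseteq> F \<Longrightarrow> hausdorff1_outer E \<le> hausdorff1_outer F"
  using hausdorff1_outer_measure_space by (auto simp: outer_measure_space_def increasing_def)

lemma hausdorff1_outer_empty: "hausdorff1_outer {} = 0"
  using hausdorff1_outer_measure_space by (auto simp: outer_measure_space_def positive_def)

lemma hausdorff1_outer_Un: "hausdorff1_outer (A \<union> B) \<le> hausdorff1_outer A + hausdorff1_outer B"
proof -
  have "ring_of_sets UNIV (UNIV :: 'a set set)"
    using ring_of_sets_Pow[of "UNIV :: 'a set"] by simp
  from ring_of_sets.countably_subadditive_subadditive[OF this, of hausdorff1_outer]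
  have "subadditive UNIV (hausdorff1_outer :: 'a set \<Rightarrow> ennreal)"
    using hausdorff1_outer_measure_space by (auto simp: outer_measure_space_def)
  then have "\<And>A B :: 'a set. A \<inter> B = {} \<Longrightarrow> hausdorff1_outer (A \<union> B) \<le> hausdorff1_outer A + hausdorff1_outer B"
    by (auto simp: subadditive_def)
  from this[of A "B - A"] have "hausdorff1_outer (A \<union> B) \<le> hausdorff1_outer A + hausdorff1_outer (B - A)"
    by auto
  also have "\<dots> \<le> hausdorff1_outer A + hausdorff1_outer B"
    by (intro add_left_mono hausdorff1_outer_mono) auto
  finally show ?thesis .
qed

text \<open>A covering set of diameter smaller than \<open>d\<close> meets at most one of the two sets, so a fine cover of
the union splits into a cover of \<open>A\<close> and a disjoint cover of \<open>B\<close>.\<close>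

lemma hausdorff1_outer_separated:
  assumes "0 < d" and sep: "\<And>x y. x \<in> A \<Longrightarrow> y \<in> B \<Longrightarrow> d \<le> dist x y"
  shows "hausdorff1_outer A + hausdorff1_outer B \<le> hausdorff1_outer (A \<union> B)"
proof -
  have pre: "hausdorff1_pre \<delta> A + hausdorff1_pre \<delta> B \<le> hausdorff1_pre \<delta> (A \<union> B)"
    if \<delta>: "0 < \<delta>" "\<delta> < d" for \<delta>
    unfolding hausdorff1_pre_def[of \<delta> "A \<union> B"]
  proof (rule INF_greatest, clarsimp)
    fix C :: "nat \<Rightarrow> 'a set" assume cov: "A \<subseteq> \<Union>(range C)" "B \<subseteq> \<Union>(range C)"
      and C: "\<forall>i. bounded (C i) \<and> diameter (C i) \<le> \<delta>"
    \<comment> \<open>the members of the cover that meet \<open>E\<close>, with empty sets in place of the others\<close>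
    define R where "R E i = (if C i \<inter> E = {} then {} else C i)" for E i
    have "hausdorff1_pre \<delta> E \<le> (\<Sum>i. ennreal (diameter (R E i)))" if E: "E \<subseteq> \<Union>(range C)" for E
    proof (rule hausdorff1_pre_le)
      show "E \<subseteq> \<Union>(range (R E))"
      proof
        fix x assume "x \<in> E"
        then obtain i where "x \<in> C i" using E by auto
        then have "x \<in> R E i" using \<open>x \<in> E\<close> by (auto simp: R_def)
        then show "x \<in> \<Union>(range (R E))" by auto
      qed
    qed (use C \<delta> in \<open>auto simp: R_def\<close>)
    then have "hausdorff1_pre \<delta> A + hausdorff1_pre \<delta> B
        \<le> (\<Sum>i. ennreal (diameter (R A i))) + (\<Sum>i. ennreal (diameter (R B i)))"
      using cov by (intro add_mono) auto
    also have "\<dots> = (\<Sum>i. ennreal (diameter (R A i)) + ennreal (diameter (R B i)))"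
      by (rule suminf_add) auto
    also have "\<dots> \<le> (\<Sum>i. ennreal (diameter (C i)))"
    proof (intro suminf_le summableI)
      fix i
      have "C i \<inter> A = {} \<or> C i \<inter> B = {}"
      proof (rule ccontr)
        assume "\<not> ?thesis"
        then obtain x y where xy: "x \<in> C i" "x \<in> A" "y \<in> C i" "y \<in> B" by auto
        then have "dist x y \<le> \<delta>"
          using C diameter_bounded_bound[of "C i" x y] order_trans by blast
        with sep[of x y] xy \<delta> show False by auto
      qed
      then show "ennreal (diameter (R A i)) + ennreal (diameter (R B i)) \<le> ennreal (diameter (C i))"
        by (auto simp: R_def)
    qed
    finally show "hausdorff1_pre \<delta> A + hausdorff1_pre \<delta> B \<le> (\<Sum>i. ennreal (diameter (C i)))" .
  qed
  have "hausdorff1_outer A + hausdorff1_outer B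
      = (SUP n. hausdorff1_pre (1 / real (Suc n)) A + hausdorff1_pre (1 / real (Suc n)) B)"
    unfolding hausdorff1_outer_eq_SUP
    by (rule ennreal_SUP_add[symmetric]) (rule hausdorff1_pre_incseq)+
  also have "\<dots> \<le> hausdorff1_outer (A \<union> B)"
  proof (rule SUP_least)
    fix n
    define \<delta> where "\<delta> = min (1 / real (Suc n)) (d / 2)"
    have \<delta>: "0 < \<delta>" "\<delta> < d" "\<delta> \<le> 1 / real (Suc n)"
      using \<open>0 < d\<close> by (auto simp: \<delta>_def min_def)
    have "hausdorff1_pre (1 / real (Suc n)) A + hausdorff1_pre (1 / real (Suc n)) B
        \<le> hausdorff1_pre \<delta> A + hausdorff1_pre \<delta> B"
      by (intro add_mono hausdorff1_pre_antimono \<delta>)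
    also have "\<dots> \<le> hausdorff1_pre \<delta> (A \<union> B)" by (rule pre) (use \<delta> in auto)
    also have "\<dots> \<le> hausdorff1_outer (A \<union> B)"
      unfolding hausdorff1_outer_def by (rule SUP_upper) (use \<delta> in auto)
    finally show "hausdorff1_pre (1 / real (Suc n)) A + hausdorff1_pre (1 / real (Suc n)) B
        \<le> hausdorff1_outer (A \<union> B)" .
  qed
  finally show ?thesis .
qed

text \<open>Continuity from below along the layers at positive distance from \<open>F\<close>, the core of Caratheodory's
criterion. The differences \<open>R n\<close> of consecutive layers with even index are separated from
each other, and so are those with odd index. By additivity on separated sets the measures of the \<open>R n\<close>
form a series with sum at most twice the measure of \<open>A\<close>, and subadditivity bounds what \<open>L n\<close>
misses by a tail of that series.\<close>

lemma hausdorff1_outer_layers: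
  assumes "closed F" "F \<noteq> {}" and fin: "hausdorff1_outer A < top" and AF: "A \<inter> F = {}"
  defines "L \<equiv> \<lambda>n. {x \<in> A. 1 / real (Suc n) \<le> infdist x F}"
  shows "hausdorff1_outer A \<le> (SUP n. hausdorff1_outer (L n))"
proof -
  define R where "R n = L (Suc n) - L n" for n
  have L_mono: "L m \<subseteq> L n" if "m \<le> n" for m n
  proof -
    have "1 / real (Suc n) \<le> 1 / real (Suc m)" using that by (simp add: field_simps)
    then show ?thesis by (auto simp: L_def)
  qed
  have RL: "R n \<subseteq> L (Suc n)" for n by (auto simp: R_def)
  have bound: "(\<Sum>i<n. hausdorff1_outer (R (2 * i + p))) \<le> hausdorff1_outer A" for n p
  proof -
    have "(\<Sum>i<n. hausdorff1_outer (R (2 * i + p))) \<le> hausdorff1_outer (\<Union>i<n. R (2 * i + p))"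
    proof (induction n)
      case (Suc n)
      define U where "U = (\<Union>i<n. R (2 * i + p))"
      have U: "1 / real (2 * n + p) \<le> infdist y F \<and> 0 < 2 * n + p" if y: "y \<in> U" for y
      proof -
        obtain i where i: "i < n" "y \<in> R (2 * i + p)" using y by (auto simp: U_def)
        then have "y \<in> L (Suc (2 * i + p))" using RL by blast
        moreover have "L (Suc (2 * i + p)) \<subseteq> L (2 * n + p - 1)"
          using i by (intro L_mono) auto
        ultimately have "y \<in> L (2 * n + p - 1)" by blast
        then show ?thesis using i by (auto simp: L_def)
      qed
      \<comment> \<open>for \<open>2 * n + p = 0\<close> the set \<open>U\<close> is empty and any positive number works\<close>
      define d where "d = (if 2 * n + p = 0 then 1 else 1 / real (2 * n + p) - 1 / real (Suc (2 * n + p)))"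
      have "(\<Sum>i<Suc n. hausdorff1_outer (R (2 * i + p)))
          \<le> hausdorff1_outer U + hausdorff1_outer (R (2 * n + p))"
        using Suc by (simp add: U_def add_right_mono)
      also have "\<dots> \<le> hausdorff1_outer (U \<union> R (2 * n + p))"
      proof (rule hausdorff1_outer_separated)
        show "0 < d" by (auto simp: d_def field_simps)
        fix y x assume y: "y \<in> U" and x: "x \<in> R (2 * n + p)"
        have "infdist x F < 1 / real (Suc (2 * n + p))"
          using x by (auto simp: R_def L_def)
        moreover have "infdist y F \<le> infdist x F + dist y x" by (rule infdist_triangle)
        ultimately show "d \<le> dist y x" using U[OF y] by (auto simp: d_def)
      qed
      also have "U \<union> R (2 * n + p) = (\<Union>i<Suc n. R (2 * i + p))"
        by (auto simp: U_def less_Suc_eq)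
      finally show ?case .
    qed (simp add: hausdorff1_outer_empty)
    also have "\<dots> \<le> hausdorff1_outer A"
      by (rule hausdorff1_outer_mono) (auto simp: R_def L_def)
    finally show ?thesis .
  qed
  have sum_le: "(\<Sum>i<n. hausdorff1_outer (R i)) \<le> hausdorff1_outer A + hausdorff1_outer A" for n
  proof -
    have "(\<Sum>i<n. hausdorff1_outer (R i)) \<le> (\<Sum>i<2 * n. hausdorff1_outer (R i))"
      by (rule sum_mono2) auto
    also have "\<dots> = (\<Sum>i<n. hausdorff1_outer (R (2 * i + 0))) + (\<Sum>i<n. hausdorff1_outer (R (2 * i + 1)))"
      by (induction n) (simp_all add: algebra_simps)
    also have "\<dots> \<le> hausdorff1_outer A + hausdorff1_outer A"
      by (intro add_mono bound)
    finally show ?thesis .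
  qed
  define r where "r i = enn2real (hausdorff1_outer (R i))" for i
  have R_fin: "hausdorff1_outer (R i) < top" for i
  proof -
    have "hausdorff1_outer (R i) \<le> hausdorff1_outer A"
      by (rule hausdorff1_outer_mono) (auto simp: R_def L_def)
    then show ?thesis using fin by (rule le_less_trans)
  qed
  then have r: "hausdorff1_outer (R i) = ennreal (r i)" for i by (simp add: r_def)
  have r_nonneg: "0 \<le> r i" for i by (simp add: r_def)
  have "summable r"
  proof (rule summableI_nonneg_bounded)
    fix n
    have "ennreal (\<Sum>i<n. r i) \<le> hausdorff1_outer A + hausdorff1_outer A"
      using sum_le[of n] by (simp add: r) (simp add: r_def)
    also have "\<dots> = ennreal (2 * enn2real (hausdorff1_outer A))"
      using fin by (cases "hausdorff1_outer A") (auto simp: ennreal_plus[symmetric] simp del: ennreal_plus)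
    finally show "(\<Sum>i<n. r i) \<le> 2 * enn2real (hausdorff1_outer A)"
      by (subst (asm) ennreal_le_iff) auto
  qed (simp add: r_def)
  show ?thesis
  proof (rule ennreal_le_epsilon)
    fix e :: real assume "0 < e"
    then obtain n where n: "norm (\<Sum>i. r (i + n)) < e"
      using suminf_exist_split[OF \<open>0 < e\<close> \<open>summable r\<close>] by auto
    have "A \<subseteq> L n \<union> (\<Union>i. R (i + n))"
    proof
      fix x assume "x \<in> A"
      then have "0 < infdist x F"
        using assms by (intro infdist_pos_not_in_closed) auto
      then obtain k where k: "1 / real (Suc k) < infdist x F" using nat_approx_posE by blast
      then have "x \<in> L k" using \<open>x \<in> A\<close> by (auto simp: L_def)
      then have ex: "\<exists>k. x \<in> L k" by blast
      define k0 where "k0 = (LEAST k. x \<in> L k)"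
      have k0: "x \<in> L k0" unfolding k0_def using ex by (rule LeastI_ex)
      show "x \<in> L n \<union> (\<Union>i. R (i + n))"
      proof (cases "k0 \<le> n")
        case True
        then show ?thesis using k0 L_mono by auto
      next
        case False
        then obtain j where j: "k0 = Suc (j + n)"
          by (metis add.commute less_imp_Suc_add not_le_imp_less)
        have "x \<notin> L (j + n)" using not_less_Least[of "j + n" "\<lambda>k. x \<in> L k"] j by (auto simp: k0_def)
        then have "x \<in> R (j + n)" using k0 j by (auto simp: R_def)
        then show ?thesis by auto
      qed
    qed
    then have "hausdorff1_outer A \<le> hausdorff1_outer (L n) + hausdorff1_outer (\<Union>i. R (i + n))"
      using hausdorff1_outer_mono hausdorff1_outer_Un order_trans by blast
    also have "\<dots> \<le> hausdorff1_outer (L n) + (\<Sum>i. hausdorff1_outer (R (i + n)))"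
      by (intro add_left_mono hausdorff1_outer_countable)
    also have "(\<Sum>i. hausdorff1_outer (R (i + n))) = ennreal (\<Sum>i. r (i + n))"
      unfolding r using \<open>summable r\<close> by (intro suminf_ennreal2) (auto simp: r_nonneg)
    also have "\<dots> \<le> ennreal e" using n by (intro ennreal_leI) auto
    also have "hausdorff1_outer (L n) \<le> (SUP n. hausdorff1_outer (L n))" by (rule SUP_upper) auto
    finally show "hausdorff1_outer A \<le> (SUP n. hausdorff1_outer (L n)) + ennreal e"
      by (simp add: add_mono)
  qed
qed

lemma closed_in_hausdorff1_lambda_system:
  assumes "closed F"
  shows "F \<in> lambda_system UNIV UNIV (hausdorff1_outer :: 'a::metric_space set \<Rightarrow> ennreal)"
proof -
  have "hausdorff1_outer (F \<inter> X) + hausdorff1_outer (- F \<inter> X) \<le> hausdorff1_outer X" for X :: "'a set"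
  proof (cases "hausdorff1_outer X < top \<and> F \<noteq> {}")
    case True
    define L where "L n = {x \<in> - F \<inter> X. 1 / real (Suc n) \<le> infdist x F}" for n
    have "hausdorff1_outer (- F \<inter> X) < top"
      using True hausdorff1_outer_mono[of "- F \<inter> X" X] le_less_trans by auto
    then have "hausdorff1_outer (- F \<inter> X) \<le> (SUP n. hausdorff1_outer (L n))"
      unfolding L_def using assms True by (intro hausdorff1_outer_layers) auto
    then have "hausdorff1_outer (F \<inter> X) + hausdorff1_outer (- F \<inter> X)
        \<le> hausdorff1_outer (F \<inter> X) + (SUP n. hausdorff1_outer (L n))"
      by (rule add_left_mono)
    also have "\<dots> = (SUP n. hausdorff1_outer (F \<inter> X) + hausdorff1_outer (L n))"
      by (rule ennreal_SUP_add_right) auto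
    also have "\<dots> \<le> hausdorff1_outer X"
    proof (rule SUP_least)
      fix n
      have "hausdorff1_outer (F \<inter> X) + hausdorff1_outer (L n) \<le> hausdorff1_outer ((F \<inter> X) \<union> L n)"
      proof (rule hausdorff1_outer_separated)
        show "0 < 1 / real (Suc n)" by simp
        fix x y assume "x \<in> F \<inter> X" "y \<in> L n"
        then show "1 / real (Suc n) \<le> dist x y"
          using infdist_le[of x F y] by (auto simp: L_def dist_commute)
      qed
      also have "\<dots> \<le> hausdorff1_outer X"
        by (rule hausdorff1_outer_mono) (auto simp: L_def)
      finally show "hausdorff1_outer (F \<inter> X) + hausdorff1_outer (L n) \<le> hausdorff1_outer X" .
    qed
    finally show ?thesis .
  next
    case False
    then show ?thesis by (auto simp: hausdorff1_outer_empty less_top[symmetric])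
  qed
  moreover have "hausdorff1_outer X \<le> hausdorff1_outer (F \<inter> X) + hausdorff1_outer (- F \<inter> X)" for X :: "'a set"
    using hausdorff1_outer_Un[of "F \<inter> X" "- F \<inter> X"] by (simp add: Int_Un_distrib2[symmetric])
  ultimately show ?thesis
    by (auto simp: lambda_system_def Compl_eq_Diff_UNIV[symmetric] intro!: antisym)
qed

lemma measure_space_hausdorff1_borel: "measure_space UNIV (sets borel) hausdorff1_outer"
proof -
  have "sigma_algebra UNIV (UNIV :: 'a set set)"
    using sigma_algebra_Pow[of "UNIV :: 'a set"] by simp
  from sigma_algebra.caratheodory_lemma[OF this hausdorff1_outer_measure_space]
  have ls: "measure_space (UNIV :: 'a set) (lambda_system UNIV UNIV hausdorff1_outer) hausdorff1_outer" .
  then have "sigma_algebra (UNIV :: 'a set) (lambda_system UNIV UNIV hausdorff1_outer)"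
    by (simp add: measure_space_def)
  from sigma_algebra.sigma_sets_subset[OF this, of "Collect closed"]
  have "sets borel \<subseteq> lambda_system UNIV (UNIV :: 'a set set) hausdorff1_outer"
    using closed_in_hausdorff1_lambda_system by (auto simp: borel_eq_closed)
  moreover have "sigma_algebra UNIV (sets (borel :: 'a measure))"
    using sets.sigma_algebra_axioms[of "borel :: 'a measure"] by simp
  ultimately show ?thesis using measure_down[OF ls] by blast
qed

lemma sets_hausdorff1 [simp, measurable_cong]: "sets hausdorff1 = sets borel"
  unfolding hausdorff1_def using sets.sigma_sets_eq[of borel] by (simp add: sets_measure_of)

lemma space_hausdorff1 [simp]: "space hausdorff1 = UNIV"
  unfolding hausdorff1_def by (simp add: space_measure_of)

lemma emeasure_hausdorff1: "A \<in> sets borel \<Longrightarrow> emeasure hausdorff1 A = hausdorff1_outer A"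
  using measure_space_hausdorff1_borel
  by (intro emeasure_measure_of[OF hausdorff1_def]) (auto simp: measure_space_def)

text \<open>Images of covering sets cover the image and have no larger diameters. Besides invariance under
isometries, this gives both estimates of the length of a circle: from above as the image of an interval,
from below through its projection to an interval.\<close>

lemma hausdorff1_outer_contraction_image_le:
  fixes f :: "'a::metric_space \<Rightarrow> 'b::metric_space"
  assumes iso: "\<And>x y. dist (f x) (f y) \<le> dist x y"
  shows "hausdorff1_outer (f ` E) \<le> hausdorff1_outer E"
proof -
  have "hausdorff1_pre \<delta> (f ` E) \<le> hausdorff1_pre \<delta> E" if "0 < \<delta>" for \<delta>
    unfolding hausdorff1_pre_def[of _ E]
  proof (rule INF_greatest, clarsimp)
    fix C :: "nat \<Rightarrow> 'a set" assume C: "E \<subseteq> \<Union>(range C)" "\<forall>i. bounded (C i) \<and> diameter (C i) \<le> \<delta>"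
    have b: "bounded (f ` C i)" and d: "diameter (f ` C i) \<le> diameter (C i)" for i
    proof -
      have dd: "dist (f x) (f y) \<le> diameter (C i)" if "x \<in> C i" "y \<in> C i" for x y
        using iso[of x y] C(2) diameter_bounded_bound[of "C i" x y] that by force
      show "bounded (f ` C i)"
        unfolding bounded_two_points using dd by (auto intro!: exI[of _ "diameter (C i)"])
      show "diameter (f ` C i) \<le> diameter (C i)"
        unfolding diameter_def[of "f ` C i"]
        using dd diameter_ge_0[of "C i"] C(2) by (auto intro!: cSUP_least)
    qed
    have "hausdorff1_pre \<delta> (f ` E) \<le> (\<Sum>i. ennreal (diameter (f ` C i)))"
    proof (rule hausdorff1_pre_le)
      show "f ` E \<subseteq> (\<Union>i. f ` C i)" using C by blast
    qed (use b d C order_trans in blast)+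
    also have "\<dots> \<le> (\<Sum>i. ennreal (diameter (C i)))"
      by (intro suminf_le ennreal_leI d summableI)
    finally show "hausdorff1_pre \<delta> (f ` E) \<le> (\<Sum>i. ennreal (diameter (C i)))" .
  qed
  then show ?thesis unfolding hausdorff1_outer_def by (intro SUP_mono) auto
qed

lemma distr_hausdorff1_isometry:
  fixes f h :: "'a::metric_space \<Rightarrow> 'a"
  assumes f: "\<And>x y. dist (f x) (f y) = dist x y" and h: "\<And>x. f (h x) = x" "\<And>x. h (f x) = x"
  shows "distr hausdorff1 hausdorff1 f = hausdorff1"
proof (rule measure_eqI)
  have h': "dist (h x) (h y) = dist x y" for x y using f[of "h x" "h y"] by (simp add: h)
  have "continuous_on UNIV f"
    unfolding continuous_on_iff using f by auto
  then have f_meas: "f \<in> borel_measurable borel" by (rule borel_measurable_continuous_onI)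
  have fm: "f \<in> measurable hausdorff1 hausdorff1" using f_meas by simp
  fix A assume "A \<in> sets (distr hausdorff1 (hausdorff1 :: 'a measure) f)"
  then have A: "A \<in> sets borel" by simp
  have vi: "f -` A = h ` A" using h by (auto intro!: image_eqI[of _ h])
  have b: "f -` A \<in> sets borel" using measurable_sets[OF f_meas A] by simp
  have "emeasure (distr hausdorff1 hausdorff1 f) A = hausdorff1_outer (h ` A)"
    using A b fm by (subst emeasure_distr) (auto simp: emeasure_hausdorff1 vi[symmetric])
  also have "\<dots> = hausdorff1_outer A"
  proof (rule antisym)
    show "hausdorff1_outer (h ` A) \<le> hausdorff1_outer A"
      by (rule hausdorff1_outer_contraction_image_le) (simp add: h')
    have "hausdorff1_outer (f ` h ` A) \<le> hausdorff1_outer (h ` A)"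
      by (rule hausdorff1_outer_contraction_image_le) (simp add: f)
    then show "hausdorff1_outer A \<le> hausdorff1_outer (h ` A)" by (simp add: image_image h)
  qed
  finally show "emeasure (distr hausdorff1 hausdorff1 f) A = emeasure hausdorff1 A"
    using A by (simp add: emeasure_hausdorff1)
qed simp

section \<open>Circles and rotations\<close>

text \<open>Division into \<open>N\<close> intervals of length \<open>L / N \<le> \<delta>\<close>.\<close>

lemma hausdorff1_outer_interval_le:
  fixes L :: real assumes "0 \<le> L"
  shows "hausdorff1_outer {0..L} \<le> ennreal L"
  unfolding hausdorff1_outer_def
proof (rule SUP_least)
  fix \<delta> :: real assume "\<delta> \<in> {0<..}"
  obtain N :: nat where N: "L / \<delta> < real N" using reals_Archimedean2 by blast
  moreover have "0 \<le> L / \<delta>" using \<open>0 \<le> L\<close> \<open>\<delta> \<in> {0<..}\<close> by simp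
  ultimately have "0 < real N" by linarith
  define h where "h = L / real N"
  have h: "0 \<le> h" "h \<le> \<delta>" "real N * h = L"
    using N \<open>0 < real N\<close> \<open>0 \<le> L\<close> \<open>\<delta> \<in> {0<..}\<close> by (auto simp: h_def field_simps)
  define C where "C i = (if i < N then {real i * h..real (Suc i) * h} else {})" for i
  have d: "diameter (C i) \<le> (if i < N then h else 0)" for i
    unfolding C_def using h
    by (auto intro!: diameter_le simp: algebra_simps abs_le_iff)
  have "hausdorff1_pre \<delta> {0..L} \<le> (\<Sum>i. ennreal (diameter (C i)))"
  proof (rule hausdorff1_pre_le)
    show "{0..L} \<subseteq> \<Union>(range C)"
    proof
      fix x assume x: "x \<in> {0..L}"
      show "x \<in> \<Union>(range C)"
      proof (cases "x = L \<or> h = 0")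
        case True
        then have "x \<in> C (N - 1)"
          using \<open>0 < real N\<close> h x by (auto simp: C_def algebra_simps of_nat_diff)
        then show ?thesis by auto
      next
        case False
        define i where "i = nat \<lfloor>x / h\<rfloor>"
        have "0 < h" "x < L" using False h x by auto
        have i: "real i \<le> x / h" "x / h < real i + 1"
          using x \<open>0 < h\<close> by (auto simp: i_def of_nat_nat)
        then have "real i * h \<le> x" "x \<le> real (Suc i) * h"
          using \<open>0 < h\<close> by (auto simp: field_simps)
        moreover have "real i * h < real N * h" using \<open>real i * h \<le> x\<close> \<open>x < L\<close> h by linarith
        then have "i < N" using \<open>0 < h\<close> by simp
        ultimately have "x \<in> C i" by (auto simp: C_def)
        then show ?thesis by auto
      qed
    qed
    show "bounded (C i)" for i by (auto simp: C_def)
    show "diameter (C i) \<le> \<delta>" for i using d[of i] h \<open>\<delta> \<in> {0<..}\<close> by (auto split: if_splits)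
  qed
  also have "\<dots> = (\<Sum>i<N. ennreal (diameter (C i)))"
    by (rule suminf_finite) (auto simp: C_def)
  also have "\<dots> \<le> (\<Sum>i<N. ennreal h)"
  proof (rule sum_mono)
    fix i assume "i \<in> {..<N}"
    then show "ennreal (diameter (C i)) \<le> ennreal h" using d[of i] by (auto intro: ennreal_leI)
  qed
  also have "\<dots> = ennreal L" using h by (simp add: ennreal_of_nat_eq_real_of_nat ennreal_mult[symmetric])
  finally show "hausdorff1_pre \<delta> {0..L} \<le> ennreal L" .
qed

text \<open>A covering set of diameter \<open>d\<close> lies in an interval of length \<open>2 * d\<close>, so countable subadditivity
of the Lebesgue measure bounds twice the sum of the diameters from below by \<open>b - a\<close>.\<close>

lemma hausdorff1_outer_interval_pos:
  fixes a b :: real assumes "a < b"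
  shows "0 < hausdorff1_outer {a..b}"
proof -
  have "ennreal (b - a) \<le> 2 * hausdorff1_pre 1 {a..b}"
  proof -
    have "ennreal ((b - a) / 2) \<le> hausdorff1_pre 1 {a..b}"
      unfolding hausdorff1_pre_def
    proof (rule INF_greatest, clarsimp)
      fix C :: "nat \<Rightarrow> real set"
      assume cov: "{a..b} \<subseteq> \<Union>(range C)" and C: "\<forall>i. bounded (C i) \<and> diameter (C i) \<le> 1"
      define p where "p i = (SOME x. x \<in> C i)" for i
      define J where "J i = {p i - diameter (C i)..p i + diameter (C i)}" for i
      have CJ: "C i \<subseteq> J i" for i
      proof
        fix x assume x: "x \<in> C i"
        then have "p i \<in> C i" unfolding p_def by (rule someI)
        then have "dist x (p i) \<le> diameter (C i)"
          using x C diameter_bounded_bound by blast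
        then show "x \<in> J i" by (auto simp: J_def dist_real_def)
      qed
      have "ennreal (b - a) = emeasure lborel {a..b}" using assms by simp
      also have "\<dots> \<le> emeasure lborel (\<Union>i. J i)"
      proof (rule emeasure_mono)
        show "{a..b} \<subseteq> (\<Union>i. J i)" using cov CJ by blast
      qed (auto simp: J_def)
      also have "\<dots> \<le> (\<Sum>i. emeasure lborel (J i))"
        by (rule emeasure_subadditive_countably) (auto simp: J_def)
      also have "\<dots> = (\<Sum>i. 2 * ennreal (diameter (C i)))"
      proof (rule arg_cong[where f=suminf], rule ext)
        fix i
        have "0 \<le> diameter (C i)" using C diameter_ge_0 by blast
        then show "emeasure lborel (J i) = 2 * ennreal (diameter (C i))"
          by (simp add: J_def ennreal_mult''[symmetric] mult_2[symmetric] flip: ennreal_numeral)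
      qed
      finally have "ennreal (b - a) \<le> 2 * (\<Sum>i. ennreal (diameter (C i)))" by simp
      then have "ennreal (1/2) * ennreal (b - a) \<le> ennreal (1/2) * (2 * (\<Sum>i. ennreal (diameter (C i))))"
        by (rule mult_left_mono) simp
      also have "\<dots> = (ennreal (1/2) * 2) * (\<Sum>i. ennreal (diameter (C i)))"
        by (simp add: mult.assoc)
      also have "ennreal (1/2) * 2 = ennreal (1/2 * 2)"
        using ennreal_mult[of "1/2" 2, symmetric] by (simp only: ennreal_numeral)
      finally have "ennreal (1/2) * ennreal (b - a) \<le> (\<Sum>i. ennreal (diameter (C i)))" by simp
      moreover have "ennreal (1/2 * (b - a)) = ennreal (1/2) * ennreal (b - a)"
        by (rule ennreal_mult) (use assms in auto)
      moreover have "1/2 * (b - a) = (b - a) / 2" by simp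
      ultimately show "ennreal ((b - a) / 2) \<le> (\<Sum>i. ennreal (diameter (C i)))" by metis
    qed
    then have "2 * ennreal ((b - a) / 2) \<le> 2 * hausdorff1_pre 1 {a..b}" by (rule mult_left_mono) simp
    moreover have "ennreal (2 * ((b - a) / 2)) = ennreal 2 * ennreal ((b - a) / 2)"
      by (rule ennreal_mult) (use assms in auto)
    moreover have "2 * ((b - a) / 2) = b - a" by simp
    ultimately show ?thesis by (metis ennreal_numeral)
  qed
  also have "\<dots> \<le> 2 * hausdorff1_outer {a..b}"
    unfolding hausdorff1_outer_def by (intro mult_left_mono SUP_upper) auto
  finally show ?thesis using assms by (auto simp: zero_less_iff_neq_zero)
qed

definition circ :: "real \<Rightarrow> (real^2) set" where "circ \<rho> = {x. norm x = \<rho>}"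

lemma circ_borel [measurable]: "circ \<rho> \<in> sets borel"
  unfolding circ_def by measurable

lemma norm_real2: "norm (x :: real^2) = sqrt ((x$1)\<^sup>2 + (x$2)\<^sup>2)"
  by (simp add: norm_vec_def L2_set_def sum_2)

lemma emeasure_circ_finite:
  assumes "0 < \<rho>"
  shows "emeasure hausdorff1 (circ \<rho>) < top"
proof -
  \<comment> \<open>the circle run through at speed 1/2, which makes the crude coordinatewise bound a contraction\<close>
  define \<gamma> :: "real \<Rightarrow> real^2"
    where "\<gamma> t = vector [\<rho> * cos (t / (2 * \<rho>)), \<rho> * sin (t / (2 * \<rho>))]" for t
  have lip: "dist (\<gamma> s) (\<gamma> t) \<le> dist s t" for s t
  proof -
    have c: "\<bar>cos x - cos y\<bar> \<le> \<bar>x - y\<bar>" "\<bar>sin x - sin y\<bar> \<le> \<bar>x - y\<bar>" for x y :: real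
    proof -
      have s: "\<bar>sin ((x - y) / 2)\<bar> \<le> \<bar>x - y\<bar> / 2" for x y :: real
        using abs_sin_x_le_abs_x[of "(x - y) / 2"] by simp
      have "\<bar>sin ((x + y) / 2) * sin ((y - x) / 2)\<bar> \<le> 1 * (\<bar>y - x\<bar> / 2)"
        unfolding abs_mult by (intro mult_mono s) auto
      then show "\<bar>cos x - cos y\<bar> \<le> \<bar>x - y\<bar>" by (simp add: cos_diff_cos abs_mult)
      have "\<bar>sin ((x - y) / 2) * cos ((x + y) / 2)\<bar> \<le> (\<bar>x - y\<bar> / 2) * 1"
        unfolding abs_mult by (intro mult_mono s) auto
      then show "\<bar>sin x - sin y\<bar> \<le> \<bar>x - y\<bar>" by (simp add: sin_diff_sin abs_mult)
    qed
    have "norm (\<gamma> s - \<gamma> t) \<le> (\<Sum>i\<in>UNIV. \<bar>(\<gamma> s - \<gamma> t) $ i\<bar>)" by (rule norm_le_l1_cart)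
    also have "\<dots> = \<bar>\<rho> * (cos (s / (2 * \<rho>)) - cos (t / (2 * \<rho>)))\<bar> + \<bar>\<rho> * (sin (s / (2 * \<rho>)) - sin (t / (2 * \<rho>)))\<bar>"
      by (simp add: sum_2 \<gamma>_def algebra_simps)
    also have "\<dots> = \<rho> * (\<bar>cos (s / (2 * \<rho>)) - cos (t / (2 * \<rho>))\<bar> + \<bar>sin (s / (2 * \<rho>)) - sin (t / (2 * \<rho>))\<bar>)"
      using assms by (simp add: abs_mult distrib_left)
    also have "\<dots> \<le> \<rho> * (\<bar>s / (2 * \<rho>) - t / (2 * \<rho>)\<bar> + \<bar>s / (2 * \<rho>) - t / (2 * \<rho>)\<bar>)"
      using assms by (intro mult_left_mono add_mono c) auto
    also have "s / (2 * \<rho>) - t / (2 * \<rho>) = (s - t) / (2 * \<rho>)" by (simp add: diff_divide_distrib)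
    also have "\<rho> * (\<bar>(s - t) / (2 * \<rho>)\<bar> + \<bar>(s - t) / (2 * \<rho>)\<bar>) = \<bar>s - t\<bar>"
      using assms by (simp add: abs_divide)
    finally show ?thesis by (simp add: dist_norm)
  qed
  have "circ \<rho> \<subseteq> \<gamma> ` {0..4 * pi * \<rho>}"
  proof
    fix x assume "x \<in> circ \<rho>"
    then have n: "(x$1)\<^sup>2 + (x$2)\<^sup>2 = \<rho>\<^sup>2" using assms by (auto simp: circ_def norm_real2)
    then have "(x$1 / \<rho>)\<^sup>2 + (x$2 / \<rho>)\<^sup>2 = 1"
      using assms by (simp add: power_divide add_divide_distrib[symmetric])
    then obtain t where t: "0 \<le> t" "t < 2 * pi" "x$1 / \<rho> = cos t" "x$2 / \<rho> = sin t"
      using sincos_total_2pi by metis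
    have "x = \<gamma> (2 * \<rho> * t)"
      using t assms by (simp add: \<gamma>_def vec_eq_iff forall_2 field_simps)
    moreover have "2 * \<rho> * t \<in> {0..4 * pi * \<rho>}" using t assms by auto
    ultimately show "x \<in> \<gamma> ` {0..4 * pi * \<rho>}" by blast
  qed
  then have "hausdorff1_outer (circ \<rho>) \<le> hausdorff1_outer (\<gamma> ` {0..4 * pi * \<rho>})"
    by (rule hausdorff1_outer_mono)
  also have "\<dots> \<le> hausdorff1_outer {0..4 * pi * \<rho>}"
    by (rule hausdorff1_outer_contraction_image_le) (rule lip)
  also have "\<dots> \<le> ennreal (4 * pi * \<rho>)"
    using assms by (intro hausdorff1_outer_interval_le) auto
  also have "\<dots> < top" by simp
  finally show ?thesis by (simp add: emeasure_hausdorff1)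
qed

lemma emeasure_circ_pos:
  assumes "0 < \<rho>"
  shows "0 < emeasure hausdorff1 (circ \<rho>)"
proof -
  have "{-\<rho>..\<rho>} \<subseteq> (\<lambda>x. x$1) ` circ \<rho>"
  proof
    fix s assume s: "s \<in> {-\<rho>..\<rho>}"
    then have "s\<^sup>2 \<le> \<rho>\<^sup>2" by (intro abs_le_square_iff[THEN iffD1]) auto
    then have "vector [s, sqrt (\<rho>\<^sup>2 - s\<^sup>2)] \<in> circ \<rho>"
      using assms by (simp add: circ_def norm_real2)
    then show "s \<in> (\<lambda>x. x$1) ` circ \<rho>" by (rule rev_image_eqI) simp
  qed
  then have "hausdorff1_outer {-\<rho>..\<rho>} \<le> hausdorff1_outer ((\<lambda>x. x$1) ` circ \<rho>)"
    by (rule hausdorff1_outer_mono)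
  also have "\<dots> \<le> hausdorff1_outer (circ \<rho>)"
  proof (rule hausdorff1_outer_contraction_image_le)
    show "dist (x$1) (y$1) \<le> dist x y" for x y :: "real^2"
      using component_le_norm_cart[of "x - y" 1] by (simp add: dist_norm)
  qed
  finally show ?thesis
    using hausdorff1_outer_interval_pos[of "-\<rho>" \<rho>] assms by (simp add: emeasure_hausdorff1)
qed

text \<open>Multiplication of complex numbers in coordinates. Multiplication by a unit vector is a rotation;
commutativity of the product is what makes two rotation invariant measures comparable below.\<close>

definition cmul :: "real^2 \<Rightarrow> real^2 \<Rightarrow> real^2"
  where "cmul x y = vector [x$1 * y$1 - x$2 * y$2, x$1 * y$2 + x$2 * y$1]"

lemma cmul_commute: "cmul x y = cmul y x"
  by (simp add: cmul_def algebra_simps)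

lemma norm_cmul: "norm (cmul x y) = norm x * norm y"
  unfolding norm_real2 cmul_def real_sqrt_mult[symmetric]
  by (rule arg_cong[where f=sqrt]) (simp add: power2_eq_square algebra_simps)

lemma cmul_scaleR: "cmul (c *\<^sub>R x) y = c *\<^sub>R cmul x y" "cmul x (c *\<^sub>R y) = c *\<^sub>R cmul x y"
  by (simp_all add: cmul_def vec_eq_iff forall_2 algebra_simps)

lemma cmul_diff: "cmul e x - cmul e y = cmul e (x - y)"
  by (simp add: cmul_def vec_eq_iff forall_2 algebra_simps)

lemma continuous_on_cmul [continuous_intros]:
  assumes "continuous_on S f" "continuous_on S g"
  shows "continuous_on S (\<lambda>x. cmul (f x) (g x))"
proof -
  have "cmul x y = (x$1 * y$1 - x$2 * y$2) *\<^sub>R axis 1 1 + (x$1 * y$2 + x$2 * y$1) *\<^sub>R axis 2 1" for x y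
    by (simp add: cmul_def vec_eq_iff forall_2 axis_def)
  then show ?thesis using assms by (auto intro!: continuous_intros)
qed

lemma cmul_borel [measurable]: "cmul e \<in> borel_measurable borel"
  by (intro borel_measurable_continuous_onI continuous_intros)

lemma cmul_inverse:
  assumes "norm e = 1"
  obtains e' where "norm e' = 1" "\<And>x. cmul e (cmul e' x) = x" "\<And>x. cmul e' (cmul e x) = x"
proof (rule that[of "vector [e$1, - e$2]"])
  have n: "e$1 * e$1 + e$2 * e$2 = 1" using assms by (simp add: norm_real2 power2_eq_square)
  show "norm (vector [e$1, - e$2] :: real^2) = 1" using assms by (simp add: norm_real2)
  have m: "a * (e$1 * e$1) + a * (e$2 * e$2) = a" for a
    using n by (simp add: distrib_left[symmetric])
  show "cmul e (cmul (vector [e$1, - e$2]) x) = x" "cmul (vector [e$1, - e$2]) (cmul e x) = x" for x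
    using m[of "x$1"] m[of "x$2"] by (simp_all add: cmul_def vec_eq_iff forall_2 algebra_simps)
qed

lemma distr_hausdorff1_rotation:
  assumes "norm e = 1"
  shows "distr hausdorff1 hausdorff1 (cmul e) = hausdorff1"
proof -
  obtain e' where "norm e' = 1" "\<And>x. cmul e (cmul e' x) = x" "\<And>x. cmul e' (cmul e x) = x"
    using cmul_inverse[OF assms] by blast
  then show ?thesis
    by (intro distr_hausdorff1_isometry[where h="cmul e'"])
      (auto simp: dist_norm cmul_diff norm_cmul assms)
qed

lemma orthogonal_transformation_cmul:
  assumes "norm e = 1"
  shows "orthogonal_transformation (cmul e)"
  unfolding orthogonal_transformation
proof
  show "linear (cmul e)"
    by (rule linearI) (simp_all add: cmul_def vec_eq_iff forall_2 algebra_simps)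
qed (simp add: norm_cmul assms)

text \<open>On boxes this is the invariance of the Lebesgue measure under orthogonal maps.\<close>

lemma distr_lborel_rotation:
  assumes "norm e = 1"
  shows "distr lborel lborel (cmul e) = lborel"
proof (rule lborel_eqI[symmetric])
  obtain e' where e': "norm e' = 1" "\<And>x. cmul e (cmul e' x) = x" "\<And>x. cmul e' (cmul e x) = x"
    using cmul_inverse[OF assms] by blast
  fix l u :: "real^2" assume lu: "\<And>b. b \<in> Basis \<Longrightarrow> l \<bullet> b \<le> u \<bullet> b"
  have m: "cmul e \<in> measurable lborel lborel"
    by simp
  have vi: "cmul e -` box l u = cmul e' ` box l u"
  proof (intro set_eqI iffI)
    fix x assume "x \<in> cmul e -` box l u"
    then show "x \<in> cmul e' ` box l u" using e'(3)[of x, symmetric] by blast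
  next
    fix x assume "x \<in> cmul e' ` box l u"
    then show "x \<in> cmul e -` box l u" using e'(2) by fastforce
  qed
  have b: "cmul e' ` box l u \<in> sets borel"
    using measurable_sets[OF m, of "box l u"] by (simp add: vi)
  have "emeasure (distr lborel lborel (cmul e)) (box l u) = emeasure lborel (cmul e' ` box l u)"
    using m by (simp add: emeasure_distr vi)
  also have "\<dots> = emeasure lebesgue (cmul e' ` box l u)" using b by simp
  also have "\<dots> = ennreal (measure lebesgue (cmul e' ` box l u))"
    by (rule emeasure_eq_measure2,
        rule measurable_orthogonal_image[OF orthogonal_transformation_cmul[OF e'(1)]]) simp
  also have "\<dots> = ennreal (measure lebesgue (box l u))"
    by (subst measure_orthogonal_image[OF orthogonal_transformation_cmul[OF e'(1)]]) simp_all
  also have "\<dots> = emeasure lebesgue (box l u)"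
    by (rule emeasure_eq_measure2[symmetric]) simp
  also have "\<dots> = emeasure lborel (box l u)" by simp
  also have "\<dots> = (\<Prod>b\<in>Basis. (u - l) \<bullet> b)" by (rule emeasure_lborel_box[OF lu])
  finally show "emeasure (distr lborel lborel (cmul e)) (box l u) = (\<Prod>b\<in>Basis. (u - l) \<bullet> b)" .
qed simp

text \<open>Integrate \<open>f (cmul y x)\<close> over \<open>\<mu>\<close> and \<open>\<nu>\<close> in both orders. For fixed \<open>y\<close> on the unit circle, invariance of \<open>\<mu>\<close>
removes \<open>y\<close>. For fixed \<open>x\<close>, write \<open>x\<close> as \<open>\<rho>\<close> times a unit vector; invariance of \<open>\<nu>\<close> removes that
vector.\<close>

lemma invariant_means_agree:
  fixes \<mu> \<nu> :: "(real^2) measure" and f :: "real^2 \<Rightarrow> real"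
  assumes \<mu>: "finite_measure \<mu>" "sets \<mu> = sets borel" "AE x in \<mu>. norm x = \<rho>"
      "\<And>e. norm e = 1 \<Longrightarrow> distr \<mu> borel (cmul e) = \<mu>"
    and \<nu>: "finite_measure \<nu>" "sets \<nu> = sets borel" "AE y in \<nu>. norm y = 1"
      "\<And>e. norm e = 1 \<Longrightarrow> distr \<nu> borel (cmul e) = \<nu>"
    and f: "f \<in> borel_measurable borel" and bound: "\<And>x. \<bar>f x\<bar> \<le> K"
    and "0 < \<rho>"
  shows "(\<integral>x. f x \<partial>\<mu>) * measure \<nu> UNIV = (\<integral>y. f (\<rho> *\<^sub>R y) \<partial>\<nu>) * measure \<mu> UNIV"
proof -
  interpret \<mu>: finite_measure \<mu> by fact
  interpret \<nu>: finite_measure \<nu> by fact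
  interpret pair_sigma_finite \<mu> \<nu> ..
  interpret P: finite_measure "\<mu> \<Otimes>\<^sub>M \<nu>"
    by (rule finite_measure_pair_measure) fact+
  have sp: "space \<mu> = UNIV" "space \<nu> = UNIV"
    using sets_eq_imp_space_eq[OF \<mu>(2)] sets_eq_imp_space_eq[OF \<nu>(2)] by simp_all
  have c2: "(\<lambda>(x, y). cmul y x) \<in> borel_measurable (\<mu> \<Otimes>\<^sub>M \<nu>)"
  proof -
    have "(\<lambda>p. cmul (snd p) (fst p)) \<in> borel_measurable (borel :: ((real^2) \<times> (real^2)) measure)"
      by (intro borel_measurable_continuous_onI continuous_intros)
    then have "(\<lambda>p. cmul (snd p) (fst p)) \<in> borel_measurable (borel \<Otimes>\<^sub>M borel)"
      by (simp add: borel_prod)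
    then show ?thesis
      by (simp add: case_prod_unfold measurable_cong_sets[OF sets_pair_measure_cong[OF \<mu>(2) \<nu>(2)] refl])
  qed
  have int: "integrable (\<mu> \<Otimes>\<^sub>M \<nu>) (\<lambda>(x, y). f (cmul y x))"
  proof (rule P.integrable_const_bound[where B=K])
    show "AE p in \<mu> \<Otimes>\<^sub>M \<nu>. norm (case p of (x, y) \<Rightarrow> f (cmul y x)) \<le> K"
      using bound by (intro AE_I2) (simp add: case_prod_unfold)
    show "(\<lambda>(x, y). f (cmul y x)) \<in> borel_measurable (\<mu> \<Otimes>\<^sub>M \<nu>)"
      using measurable_compose[OF c2 f] by (simp add: case_prod_unfold)
  qed
  have "(\<integral>y. (\<integral>x. f (cmul y x) \<partial>\<mu>) \<partial>\<nu>) = (\<integral>x. (\<integral>y. f (cmul y x) \<partial>\<nu>) \<partial>\<mu>)"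
    by (rule Fubini_integral[OF int])
  also have "(\<integral>y. (\<integral>x. f (cmul y x) \<partial>\<mu>) \<partial>\<nu>) = (\<integral>y. (\<integral>x. f x \<partial>\<mu>) \<partial>\<nu>)"
  proof (rule integral_cong_AE)
    show "AE y in \<nu>. (\<integral>x. f (cmul y x) \<partial>\<mu>) = (\<integral>x. f x \<partial>\<mu>)"
      using \<nu>(3)
    proof eventually_elim
      case (elim y)
      have "(\<integral>x. f (cmul y x) \<partial>\<mu>) = (\<integral>x. f x \<partial>distr \<mu> borel (cmul y))"
        by (rule integral_distr[symmetric]) (simp_all add: cmul_borel f measurable_cong_sets[OF \<mu>(2) refl])
      then show ?case using \<mu>(4)[OF elim] by simp
    qed
  qed (rule borel_measurable_integrable, rule integrable_snd[OF int], rule borel_measurable_const)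
  also have "(\<integral>x. (\<integral>y. f (cmul y x) \<partial>\<nu>) \<partial>\<mu>) = (\<integral>x. (\<integral>y. f (\<rho> *\<^sub>R y) \<partial>\<nu>) \<partial>\<mu>)"
  proof (rule integral_cong_AE)
    show "AE x in \<mu>. (\<integral>y. f (cmul y x) \<partial>\<nu>) = (\<integral>y. f (\<rho> *\<^sub>R y) \<partial>\<nu>)"
      using \<mu>(3)
    proof eventually_elim
      case (elim x)
      define e where "e = x /\<^sub>R \<rho>"
      have e: "norm e = 1" using elim \<open>0 < \<rho>\<close> by (simp add: e_def)
      have x: "x = \<rho> *\<^sub>R e" using \<open>0 < \<rho>\<close> by (simp add: e_def)
      have "(\<integral>y. f (cmul y x) \<partial>\<nu>) = (\<integral>y. f (\<rho> *\<^sub>R cmul e y) \<partial>\<nu>)"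
        by (simp add: x cmul_scaleR cmul_commute[of _ e])
      also have "\<dots> = (\<integral>y. f (\<rho> *\<^sub>R y) \<partial>distr \<nu> borel (cmul e))"
        by (rule integral_distr[symmetric]) (simp_all add: cmul_borel measurable_compose[OF _ f] measurable_cong_sets[OF \<nu>(2) refl])
      finally show ?case using \<nu>(4)[OF e] by simp
    qed
  qed (rule borel_measurable_integrable, rule integrable_fst[OF int], rule borel_measurable_const)
  finally show ?thesis by (simp add: sp mult.commute)
qed

section \<open>Weak gradients and test functions\<close>

lemma open_annulus: "open (annulus \<rho>1 \<rho>2)"
proof -
  have "annulus \<rho>1 \<rho>2 = norm -` {\<rho>1<..<\<rho>2}" by (auto simp: annulus_def)
  then show ?thesis by (auto intro!: open_vimage continuous_intros)
qed

lemma annulus_lebesgue [measurable]: "annulus \<rho>1 \<rho>2 \<in> sets lebesgue"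
  using open_annulus by (simp add: borel_open sets_completionI_sets)

lemma bounded_annulus: "bounded (annulus \<rho>1 \<rho>2)"
  by (rule bounded_subset[of "cball 0 \<rho>2"]) (auto simp: annulus_def)

lemma annulus_lmeasurable: "annulus \<rho>1 \<rho>2 \<in> lmeasurable"
  using open_annulus bounded_annulus by (rule lmeasurable_open[rotated])

lemma set_integral_inner:
  fixes f :: "'a \<Rightarrow> 'b::euclidean_space"
  assumes "set_integrable M A f"
  shows "(LINT x:A|M. f x) \<bullet> c = (LINT x:A|M. f x \<bullet> c)" "set_integrable M A (\<lambda>x. f x \<bullet> c)"
proof -
  have i: "integrable M (\<lambda>x. indicator A x *\<^sub>R f x)" using assms by (simp add: set_integrable_def)
  show "(LINT x:A|M. f x) \<bullet> c = (LINT x:A|M. f x \<bullet> c)"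
    unfolding set_lebesgue_integral_def using integral_inner_left[OF i, of c] by simp
  show "set_integrable M A (\<lambda>x. f x \<bullet> c)"
    unfolding set_integrable_def using integrable_inner_left[OF i, of c] by simp
qed

lemma absolutely_integrable_bounded_scaleR:
  fixes f :: "'a::euclidean_space \<Rightarrow> real" and h :: "'a \<Rightarrow> 'b::euclidean_space"
  assumes S: "S \<in> sets lebesgue" "open S"
  shows "continuous_on S f \<Longrightarrow> bounded (f ` S) \<Longrightarrow> h absolutely_integrable_on S \<Longrightarrow>
      (\<lambda>x. f x *\<^sub>R h x) absolutely_integrable_on S"
    "continuous_on S h \<Longrightarrow> bounded (h ` S) \<Longrightarrow> f absolutely_integrable_on S \<Longrightarrow>
      (\<lambda>x. f x *\<^sub>R h x) absolutely_integrable_on S"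
proof -
  assume "continuous_on S f" "bounded (f ` S)" "h absolutely_integrable_on S"
  then show "(\<lambda>x. f x *\<^sub>R h x) absolutely_integrable_on S"
    using S by (intro absolutely_integrable_bounded_measurable_product[of "(*\<^sub>R)"])
      (auto simp: bilinear_conv_bounded_bilinear bounded_bilinear_scaleR
        intro: continuous_imp_measurable_on_sets_lebesgue)
next
  assume "continuous_on S h" "bounded (h ` S)" "f absolutely_integrable_on S"
  moreover have "bounded_bilinear (\<lambda>(x :: 'b) r. r *\<^sub>R x)"
    by (rule bounded_bilinear.flip[OF bounded_bilinear_scaleR])
  ultimately show "(\<lambda>x. f x *\<^sub>R h x) absolutely_integrable_on S"
    using S by (intro absolutely_integrable_bounded_measurable_product[of "\<lambda>x r. r *\<^sub>R x"])
      (auto simp: bilinear_conv_bounded_bilinear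
        intro: continuous_imp_measurable_on_sets_lebesgue)
qed

text \<open>The gradient vanishes outside the support as well, because the function is constant near every such
point.\<close>

lemma C1_test_bounded:
  assumes "C1_test \<Omega> \<phi> D\<phi>"
  obtains R B where "\<And>x. norm x > R \<Longrightarrow> \<phi> x = 0" "\<And>x. norm x > R \<Longrightarrow> D\<phi> x = 0"
    "continuous_on UNIV \<phi>" "\<And>x. norm (\<phi> x) \<le> B" "\<And>x. norm (D\<phi> x) \<le> B" "0 < R"
proof -
  from assms obtain K where der: "\<And>x. GDERIV \<phi> x :> D\<phi> x" and D: "continuous_on UNIV D\<phi>"
    and K: "compact K" "K \<subseteq> \<Omega>" "\<And>x. x \<notin> K \<Longrightarrow> \<phi> x = 0"
    by (auto simp: C1_test_def)
  have cont: "continuous_on UNIV \<phi>"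
    using der by (auto simp: gderiv_def intro!: continuous_at_imp_continuous_on has_derivative_continuous)
  obtain R where R: "0 < R" "\<And>x. x \<in> K \<Longrightarrow> norm x \<le> R"
    using compact_imp_bounded[OF K(1)] by (auto simp: bounded_pos)
  have z: "\<phi> x = 0" if "norm x > R" for x using that R K(3)[of x] by force
  have zD: "D\<phi> x = 0" if x: "norm x > R" for x
  proof -
    have "((\<lambda>_. 0) has_derivative (\<lambda>h. h \<bullet> D\<phi> x)) (at x)"
    proof (rule has_derivative_transform_within_open)
      show "(\<phi> has_derivative (\<lambda>h. h \<bullet> D\<phi> x)) (at x)" using der by (simp add: gderiv_def)
      show "open {x. norm x > R}" by (intro open_Collect_less continuous_intros)
    qed (use x z in auto)
    then have "(\<lambda>h. h \<bullet> D\<phi> x) = (\<lambda>h. 0)"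
      using has_derivative_unique has_derivative_const by blast
    then have "D\<phi> x \<bullet> D\<phi> x = 0" by metis
    then show ?thesis by simp
  qed
  have "bounded (\<phi> ` cball 0 R)" "bounded (D\<phi> ` cball 0 R)"
    using cont D by (auto intro!: compact_imp_bounded compact_continuous_image
        intro: continuous_on_subset)
  then obtain B1 B2 where "\<forall>y\<in>\<phi> ` cball 0 R. norm y \<le> B1" "\<forall>y\<in>D\<phi> ` cball 0 R. norm y \<le> B2"
    unfolding bounded_iff by blast
  then have B: "norm (\<phi> x) \<le> B1" "norm (D\<phi> x) \<le> B2" if "x \<in> cball 0 R" for x
    using that by blast+
  have "norm (\<phi> x) \<le> max 0 (max B1 B2)" "norm (D\<phi> x) \<le> max 0 (max B1 B2)" for x
    using z[of x] zD[of x] B[of x] by (cases "norm x \<le> R"; force)+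
  with that[of R "max 0 (max B1 B2)"] z zD cont R show thesis by blast
qed

text \<open>This integrability makes the weak formulation linear in the function and its gradient.\<close>

lemma C1_test_products:
  assumes t: "C1_test \<Omega> \<phi> D\<phi>" and \<Omega>: "open \<Omega>"
  shows "w absolutely_integrable_on \<Omega> \<Longrightarrow> (\<lambda>x. w x *\<^sub>R D\<phi> x) absolutely_integrable_on \<Omega>"
    and "(G :: 'a \<Rightarrow> 'a::euclidean_space) absolutely_integrable_on \<Omega> \<Longrightarrow> (\<lambda>x. \<phi> x *\<^sub>R G x) absolutely_integrable_on \<Omega>"
proof -
  obtain R B where B: "continuous_on UNIV \<phi>" "\<And>x. norm (\<phi> x) \<le> B" "\<And>x. norm (D\<phi> x) \<le> B"
    using C1_test_bounded[OF t] by metis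
  have D: "continuous_on UNIV D\<phi>" using t by (simp add: C1_test_def)
  have S: "\<Omega> \<in> sets lebesgue" using \<Omega> by (simp add: borel_open sets_completionI_sets)
  show "(\<lambda>x. w x *\<^sub>R D\<phi> x) absolutely_integrable_on \<Omega>" if "w absolutely_integrable_on \<Omega>"
    using that S \<Omega> B D by (intro absolutely_integrable_bounded_scaleR(2))
      (auto simp: bounded_iff intro: continuous_on_subset)
  show "(\<lambda>x. \<phi> x *\<^sub>R G x) absolutely_integrable_on \<Omega>" if "G absolutely_integrable_on \<Omega>"
    using that S \<Omega> B D by (intro absolutely_integrable_bounded_scaleR(1))
      (auto simp: bounded_iff intro: continuous_on_subset)
qed

lemma W11_gradient_linear:
  assumes \<Omega>: "open \<Omega>" and w: "W11_gradient \<Omega> w G" and v: "W11_gradient \<Omega> v H"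
  shows "W11_gradient \<Omega> (\<lambda>x. a * w x + b * v x) (\<lambda>x. a *\<^sub>R G x + b *\<^sub>R H x)"
  unfolding W11_gradient_def
proof (intro conjI allI impI)
  have i: "w absolutely_integrable_on \<Omega>" "v absolutely_integrable_on \<Omega>"
      "G absolutely_integrable_on \<Omega>" "H absolutely_integrable_on \<Omega>"
    using w v by (auto simp: W11_gradient_def)
  then show "(\<lambda>x. a * w x + b * v x) absolutely_integrable_on \<Omega>"
    "(\<lambda>x. a *\<^sub>R G x + b *\<^sub>R H x) absolutely_integrable_on \<Omega>"
    by (auto intro!: set_integral_add absolutely_integrable_scaleR_left)
  fix \<phi> D\<phi> assume t: "C1_test \<Omega> \<phi> D\<phi>"
  note p = C1_test_products[OF t \<Omega>]
  have "(LINT x:\<Omega>|lebesgue. (a * w x + b * v x) *\<^sub>R D\<phi> x)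
      = (LINT x:\<Omega>|lebesgue. a *\<^sub>R (w x *\<^sub>R D\<phi> x) + b *\<^sub>R (v x *\<^sub>R D\<phi> x))"
    by (simp add: scaleR_add_left)
  also have "\<dots> = (LINT x:\<Omega>|lebesgue. a *\<^sub>R (w x *\<^sub>R D\<phi> x)) + (LINT x:\<Omega>|lebesgue. b *\<^sub>R (v x *\<^sub>R D\<phi> x))"
    by (intro set_integral_add(2) absolutely_integrable_scaleR_left p i)
  also have "\<dots> = a *\<^sub>R (LINT x:\<Omega>|lebesgue. w x *\<^sub>R D\<phi> x) + b *\<^sub>R (LINT x:\<Omega>|lebesgue. v x *\<^sub>R D\<phi> x)"
    by (simp only: set_integral_scaleR_right)
  also have "\<dots> = - (a *\<^sub>R (LINT x:\<Omega>|lebesgue. \<phi> x *\<^sub>R G x) + b *\<^sub>R (LINT x:\<Omega>|lebesgue. \<phi> x *\<^sub>R H x))"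
    using w v t by (simp add: W11_gradient_def)
  also have "a *\<^sub>R (LINT x:\<Omega>|lebesgue. \<phi> x *\<^sub>R G x) + b *\<^sub>R (LINT x:\<Omega>|lebesgue. \<phi> x *\<^sub>R H x)
      = (LINT x:\<Omega>|lebesgue. a *\<^sub>R (\<phi> x *\<^sub>R G x)) + (LINT x:\<Omega>|lebesgue. b *\<^sub>R (\<phi> x *\<^sub>R H x))"
    by (simp only: set_integral_scaleR_right)
  also have "\<dots> = (LINT x:\<Omega>|lebesgue. a *\<^sub>R (\<phi> x *\<^sub>R G x) + b *\<^sub>R (\<phi> x *\<^sub>R H x))"
    by (intro set_integral_add(2)[symmetric] absolutely_integrable_scaleR_left p i)
  also have "\<dots> = (LINT x:\<Omega>|lebesgue. \<phi> x *\<^sub>R (a *\<^sub>R G x + b *\<^sub>R H x))"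
    by (simp add: scaleR_add_right mult.commute)
  finally show "(LINT x:\<Omega>|lebesgue. (a * w x + b * v x) *\<^sub>R D\<phi> x)
      = - (LINT x:\<Omega>|lebesgue. \<phi> x *\<^sub>R (a *\<^sub>R G x + b *\<^sub>R H x))" .
qed

lemma W11_gradient_diff:
  assumes "open \<Omega>" "W11_gradient \<Omega> w G" "W11_gradient \<Omega> v H"
  shows "W11_gradient \<Omega> (\<lambda>x. w x - v x) (\<lambda>x. G x - H x)"
  using W11_gradient_linear[OF assms, of 1 "-1"] by simp

text \<open>Translation invariance of the Lebesgue measure: the difference quotients of \<open>\<phi>\<close> in a direction \<open>b\<close>
have integral 0, and they converge dominatedly to \<open>D\<phi> x \<bullet> b\<close>.\<close>

lemma integral_C1_test_gradient:
  assumes t: "C1_test \<Omega> \<phi> (D\<phi> :: 'a::euclidean_space \<Rightarrow> 'a)"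
  shows "integral\<^sup>L lborel D\<phi> = 0"
proof -
  obtain R B where R: "\<And>x. norm x > R \<Longrightarrow> \<phi> x = 0" "\<And>x. norm x > R \<Longrightarrow> D\<phi> x = 0" "0 < R"
    and cont: "continuous_on UNIV \<phi>" and B: "\<And>x. norm (\<phi> x) \<le> B" "\<And>x. norm (D\<phi> x) \<le> B"
    using C1_test_bounded[OF t] by metis
  have der: "(\<phi> has_derivative (\<lambda>h. h \<bullet> D\<phi> x)) (at x)" and D: "continuous_on UNIV D\<phi>" for x
    using t by (auto simp: C1_test_def gderiv_def)
  have meas[measurable]: "\<phi> \<in> borel_measurable borel" "D\<phi> \<in> borel_measurable borel"
    using cont D by (auto intro: borel_measurable_continuous_onI)
  have lip: "norm (\<phi> x - \<phi> y) \<le> B * norm (x - y)" for x y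
  proof (rule differentiable_bound[where S=UNIV and f'="\<lambda>x h. h \<bullet> D\<phi> x"])
    fix x
    have "norm (h \<bullet> D\<phi> x) \<le> B * norm h" for h
    proof -
      have "norm (h \<bullet> D\<phi> x) \<le> norm h * norm (D\<phi> x)" by (simp add: Cauchy_Schwarz_ineq2)
      also have "\<dots> \<le> norm h * B" by (intro mult_left_mono B) auto
      finally show ?thesis by (simp add: mult.commute)
    qed
    then show "onorm (\<lambda>h. h \<bullet> D\<phi> x) \<le> B" by (rule onorm_le)
  qed (use der in auto)
  have ind: "integrable lborel (\<lambda>x :: 'a. indicator (cball 0 r) x * (c :: real))" for r c
    by (intro integrable_mult_left integrable_real_indicator) (use emeasure_bounded_finite[OF bounded_cball, of 0 r] in auto)
  have dom: "norm (\<phi> x) \<le> norm (indicator (cball 0 R) x * B)" "norm (D\<phi> x) \<le> norm (indicator (cball 0 R) x * B)" for x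
    using R(1)[of x] R(2)[of x] B(1)[of x] B(2)[of x]
    by (cases "norm x \<le> R"; simp; linarith)+
  have int_\<phi>: "integrable lborel \<phi>"
    by (rule Bochner_Integration.integrable_bound[OF ind[of R B] _ AE_I2[OF dom(1)]]) simp
  have "norm b = 1 \<Longrightarrow> integral\<^sup>L lborel (\<lambda>x. D\<phi> x \<bullet> b) = 0" for b
  proof -
    assume b: "norm b = 1"
    \<comment> \<open>difference quotients with step \<open>1 / (n + 1)\<close> in direction \<open>b\<close>\<close>
    define q where "q n x = real (Suc n) * (\<phi> (b /\<^sub>R real (Suc n) + x) - \<phi> x)" for n x
    have q0: "integral\<^sup>L lborel (q n) = 0" for n
    proof -
      have tr: "integrable lborel (\<lambda>x. \<phi> (b /\<^sub>R real (Suc n) + x))"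
        "integral\<^sup>L lborel (\<lambda>x. \<phi> (b /\<^sub>R real (Suc n) + x)) = integral\<^sup>L lborel \<phi>"
      proof -
        let ?T = "\<lambda>x. b /\<^sub>R real (Suc n) + x"
        have e: "distr lborel borel ?T = lborel" by (rule lborel_distr_plus)
        have "integrable (distr lborel borel ?T) \<phi>" unfolding e by (rule int_\<phi>)
        then show "integrable lborel (\<lambda>x. \<phi> (?T x))" by (subst (asm) integrable_distr_eq) auto
        have "integral\<^sup>L lborel (\<lambda>x. \<phi> (?T x)) = integral\<^sup>L (distr lborel borel ?T) \<phi>"
          by (rule integral_distr[symmetric]) auto
        then show "integral\<^sup>L lborel (\<lambda>x. \<phi> (?T x)) = integral\<^sup>L lborel \<phi>" by (simp only: e)
      qed
      show ?thesis unfolding q_def using tr int_\<phi> by simp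
    qed
    have lim: "(\<lambda>n. integral\<^sup>L lborel (q n)) \<longlonglongrightarrow> integral\<^sup>L lborel (\<lambda>x. D\<phi> x \<bullet> b)"
    proof (rule integral_dominated_convergence[where w="\<lambda>x. indicator (cball 0 (R + 1)) x * B"])
      show "AE x in lborel. (\<lambda>n. q n x) \<longlonglongrightarrow> D\<phi> x \<bullet> b"
      proof (rule AE_I2)
        fix x
        have "((\<lambda>t. \<phi> (t *\<^sub>R b + x)) has_derivative (\<lambda>t. (t *\<^sub>R b) \<bullet> D\<phi> (0 *\<^sub>R b + x))) (at 0)"
          by (rule has_derivative_compose[of "\<lambda>t. t *\<^sub>R b + x" _ _ _ \<phi>, OF _ der])
            (auto intro!: derivative_eq_intros)
        then have "((\<lambda>t. \<phi> (t *\<^sub>R b + x)) has_real_derivative (D\<phi> x \<bullet> b)) (at 0)"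
          by (simp add: has_field_derivative_def inner_commute mult_commute_abs)
        then have "((\<lambda>h. (\<phi> (h *\<^sub>R b + x) - \<phi> x) / h) \<longlongrightarrow> D\<phi> x \<bullet> b) (at 0)"
          by (simp add: DERIV_def)
        moreover have "filterlim (\<lambda>n. 1 / real (Suc n)) (at 0) sequentially"
          unfolding filterlim_at using LIMSEQ_Suc[OF lim_inverse_n'] by auto
        ultimately have "(\<lambda>n. (\<phi> ((1 / real (Suc n)) *\<^sub>R b + x) - \<phi> x) / (1 / real (Suc n))) \<longlonglongrightarrow> D\<phi> x \<bullet> b"
          by (rule filterlim_compose)
        then show "(\<lambda>n. q n x) \<longlonglongrightarrow> D\<phi> x \<bullet> b"
          unfolding q_def by (simp add: inverse_eq_divide mult.commute)
      qed
      fix n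
      show "AE x in lborel. norm (q n x) \<le> indicator (cball 0 (R + 1)) x * B"
      proof (rule AE_I2)
        fix x
        have s: "norm (b /\<^sub>R real (Suc n)) \<le> 1" using b by (simp add: field_simps)
        show "norm (q n x) \<le> indicator (cball 0 (R + 1)) x * B"
        proof (cases "norm x \<le> R + 1")
          case True
          have "norm (\<phi> (b /\<^sub>R real (Suc n) + x) - \<phi> x) \<le> B * norm (b /\<^sub>R real (Suc n))"
            using lip[of "b /\<^sub>R real (Suc n) + x" x] by simp
          then have "real (Suc n) * norm (\<phi> (b /\<^sub>R real (Suc n) + x) - \<phi> x) \<le> B"
            using b by (simp add: field_simps)
          then show ?thesis using True by (simp add: q_def abs_mult)
        next
          case False
          have "norm x \<le> norm (b /\<^sub>R real (Suc n) + x) + norm (b /\<^sub>R real (Suc n))"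
            by (metis add_diff_cancel_left' norm_triangle_ineq4)
          then have "norm (b /\<^sub>R real (Suc n) + x) > R" using False s by linarith
          then show ?thesis using False R by (simp add: q_def)
        qed
      qed
    qed (use ind in \<open>auto simp: q_def[abs_def]\<close>)
    show ?thesis using LIMSEQ_unique[OF lim] by (simp add: q0)
  qed
  moreover have "integrable lborel D\<phi>"
    by (rule Bochner_Integration.integrable_bound[OF ind[of R B] _ AE_I2[OF dom(2)]]) simp
  ultimately have "integral\<^sup>L lborel D\<phi> \<bullet> b = 0" if "b \<in> Basis" for b
    using that by (subst integral_inner_left[symmetric]) auto
  then show ?thesis by (metis euclidean_all_zero_iff)
qed

lemma W11_gradient_const:
  assumes "open \<Omega>" "bounded \<Omega>"
  shows "W11_gradient \<Omega> (\<lambda>_. c) (\<lambda>_. 0)"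
  unfolding W11_gradient_def
proof (intro conjI allI impI)
  have "\<Omega> \<in> lmeasurable" using assms by (intro lmeasurable_open)
  then show "(\<lambda>_. c) absolutely_integrable_on \<Omega>" by (rule absolutely_integrable_on_const)
  show "(\<lambda>_. 0 :: 'a) absolutely_integrable_on \<Omega>" by simp
  fix \<phi> D\<phi> assume t: "C1_test \<Omega> \<phi> D\<phi>"
  have z: "indicator \<Omega> x *\<^sub>R D\<phi> x = D\<phi> x" for x
  proof (cases "x \<in> \<Omega>")
    case False
    from t obtain K where K: "compact K" "K \<subseteq> \<Omega>" "\<And>x. x \<notin> K \<Longrightarrow> \<phi> x = 0"
      and der: "(\<phi> has_derivative (\<lambda>h. h \<bullet> D\<phi> x)) (at x)"
      by (auto simp: C1_test_def gderiv_def)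
    have "((\<lambda>_. 0) has_derivative (\<lambda>h. h \<bullet> D\<phi> x)) (at x)"
      by (rule has_derivative_transform_within_open[OF der, of "- K"])
        (use K False in \<open>auto simp: compact_imp_closed open_Compl\<close>)
    then have "(\<lambda>h. h \<bullet> D\<phi> x) = (\<lambda>h. 0)"
      using has_derivative_unique has_derivative_const by blast
    then have "D\<phi> x \<bullet> D\<phi> x = 0" by metis
    then show ?thesis by simp
  qed simp
  have "D\<phi> \<in> borel_measurable borel"
    using t by (auto simp: C1_test_def intro: borel_measurable_continuous_onI)
  then have "integral\<^sup>L lebesgue D\<phi> = 0"
    using integral_C1_test_gradient[OF t] by (simp add: integral_completion)
  then show "(LINT x:\<Omega>|lebesgue. c *\<^sub>R D\<phi> x) = - (LINT x:\<Omega>|lebesgue. \<phi> x *\<^sub>R 0)"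
    by (simp add: set_lebesgue_integral_def z)
qed

section \<open>Radial test fields\<close>

text \<open>\<open>Q\<close> is a \<open>C\<^sup>1\<close> function on the punctured plane with gradient \<open>DQ\<close>, and its radial derivative
vanishes. Radial derivatives are all that enters the divergence of a radial field, and in this
form the class is evidently closed under products.\<close>

definition angular :: "(real^2 \<Rightarrow> real) \<Rightarrow> (real^2 \<Rightarrow> real^2) \<Rightarrow> bool" where
  "angular Q DQ \<longleftrightarrow>
     (\<forall>x. x \<noteq> 0 \<longrightarrow> (Q has_derivative (\<lambda>h. h \<bullet> DQ x)) (at x) \<and> x \<bullet> DQ x = 0) \<and>
     continuous_on (- {0}) DQ"

text \<open>Profiles are functions of \<open>|x|\<^sup>2\<close> rather than of \<open>|x|\<close>, so that they compose smoothly at the origin and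
no square roots occur in derivatives.\<close>

definition profile :: "real \<Rightarrow> real \<Rightarrow> (real \<Rightarrow> real) \<Rightarrow> bool" where
  "profile a b k \<longleftrightarrow> continuous_on UNIV k \<and> (\<exists>c d. a < c \<and> c < d \<and> d < b \<and> (\<forall>s. s \<notin> {c..d} \<longrightarrow> k s = 0))"

lemma angular_continuous: "angular Q DQ \<Longrightarrow> continuous_on (- {0}) Q"
  unfolding angular_def
  by (auto intro!: continuous_at_imp_continuous_on has_derivative_continuous)

lemma angular_const: "angular (\<lambda>_. c) (\<lambda>_. 0)"
  by (auto simp: angular_def)

lemma angular_mult:
  assumes "angular Q DQ" "angular R DR"
  shows "angular (\<lambda>x. Q x * R x) (\<lambda>x. Q x *\<^sub>R DR x + R x *\<^sub>R DQ x)"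
  unfolding angular_def
proof (intro conjI allI impI)
  show "continuous_on (- {0}) (\<lambda>x. Q x *\<^sub>R DR x + R x *\<^sub>R DQ x)"
    using assms angular_continuous by (auto simp: angular_def intro!: continuous_intros)
  fix x :: "real^2" assume "x \<noteq> 0"
  then show "((\<lambda>x. Q x * R x) has_derivative (\<lambda>h. h \<bullet> (Q x *\<^sub>R DR x + R x *\<^sub>R DQ x))) (at x)"
    "x \<bullet> (Q x *\<^sub>R DR x + R x *\<^sub>R DQ x) = 0"
    using assms by (auto simp: angular_def inner_add_right intro!: derivative_eq_intros)
qed

lemma angular_linear:
  "angular (\<lambda>x. (x \<bullet> v) / norm x) (\<lambda>x. v /\<^sub>R norm x - ((x \<bullet> v) / norm x ^ 3) *\<^sub>R x)"
  unfolding angular_def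
proof (intro conjI allI impI)
  show "continuous_on (- {0}) (\<lambda>x. v /\<^sub>R norm x - ((x \<bullet> v) / norm x ^ 3) *\<^sub>R x)"
    by (auto intro!: continuous_intros)
  fix x :: "real^2" assume x: "x \<noteq> 0"
  show "((\<lambda>x. (x \<bullet> v) / norm x) has_derivative (\<lambda>h. h \<bullet> (v /\<^sub>R norm x - ((x \<bullet> v) / norm x ^ 3) *\<^sub>R x))) (at x)"
    using x by (auto intro!: derivative_eq_intros has_derivative_norm
        simp: sgn_div_norm inner_diff_right field_simps power3_eq_cube inner_commute fun_eq_iff)
  have "x \<bullet> x = norm x * norm x" by (simp add: power2_norm_eq_inner[symmetric] power2_eq_square)
  then show "x \<bullet> (v /\<^sub>R norm x - ((x \<bullet> v) / norm x ^ 3) *\<^sub>R x) = 0"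
    using x by (simp add: inner_diff_right power3_eq_cube) (simp add: field_simps)
qed

lemma bounded_ring_image:
  fixes f :: "real^2 \<Rightarrow> 'a::real_normed_vector"
  assumes "0 < \<rho>1" "continuous_on (- {0}) f"
  obtains B where "\<And>x. x \<in> annulus \<rho>1 \<rho>2 \<Longrightarrow> norm (f x) \<le> B"
proof -
  have "compact (cball (0 :: real^2) \<rho>2 \<inter> {x. \<rho>1 \<le> norm x})"
    by (intro compact_Int_closed compact_cball closed_Collect_le continuous_intros)
  then have "bounded (f ` (cball 0 \<rho>2 \<inter> {x. \<rho>1 \<le> norm x}))"
    using assms by (intro compact_imp_bounded compact_continuous_image) (auto intro: continuous_on_subset)
  then obtain B where "\<forall>y\<in>f ` (cball 0 \<rho>2 \<inter> {x. \<rho>1 \<le> norm x}). norm y \<le> B"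
    unfolding bounded_iff by blast
  then show thesis by (intro that[of B]) (auto simp: annulus_def)
qed

lemma angular_bounded:
  assumes "0 < \<rho>1" "angular Q DQ"
  obtains B where "0 \<le> B" "\<And>x. x \<in> annulus \<rho>1 \<rho>2 \<Longrightarrow> \<bar>Q x\<bar> \<le> B"
proof -
  obtain B where "\<And>x. x \<in> annulus \<rho>1 \<rho>2 \<Longrightarrow> norm (Q x) \<le> B"
    using bounded_ring_image[OF assms(1) angular_continuous[OF assms(2)]] by metis
  then show thesis by (intro that[of "max 0 B"]) (auto simp: le_max_iff_disj)
qed

text \<open>The cutoff \<open>\<kappa>\<close> vanishes near 0 and thereby removes the singularity that \<open>P\<close> may have there.\<close>

lemma C1_test_radial_cutoff:
  fixes P :: "real^2 \<Rightarrow> real"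
  assumes P: "\<And>x. x \<noteq> 0 \<Longrightarrow> (P has_derivative (\<lambda>h. h \<bullet> DP x)) (at x)" "continuous_on (- {0}) DP"
    and \<kappa>: "\<And>s. (\<kappa> has_real_derivative k s) (at s)" "continuous_on UNIV k"
    and cd: "0 \<le> \<rho>1" "\<rho>1\<^sup>2 < c" "d < \<rho>2\<^sup>2" "0 \<le> \<rho>2" "\<And>s. s \<notin> {c..d} \<Longrightarrow> \<kappa> s = 0" "\<And>s. s \<notin> {c..d} \<Longrightarrow> k s = 0"
  shows "C1_test (annulus \<rho>1 \<rho>2) (\<lambda>x. \<kappa> (x \<bullet> x) * P x)
    (\<lambda>x. (2 * k (x \<bullet> x) * P x) *\<^sub>R x + \<kappa> (x \<bullet> x) *\<^sub>R DP x)"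
    (is "C1_test _ ?\<phi> ?D")
  unfolding C1_test_def
proof (intro conjI allI)
  define U where "U = {x :: real^2. x \<bullet> x < c}"
  have "0 < c" using cd(2) by (meson le_less_trans zero_le_power2)
  have U: "open U" "0 \<in> U" using \<open>0 < c\<close> by (auto simp: U_def intro!: open_Collect_less continuous_intros)
  have zU: "?\<phi> x = 0" "?D x = 0" if "x \<in> U" for x using that cd(5,6)[of "x \<bullet> x"] by (auto simp: U_def)
  have P_cont: "continuous_on (- {0}) P"
    using P(1) by (auto intro!: continuous_at_imp_continuous_on has_derivative_continuous)
  have \<kappa>_cont: "continuous_on UNIV \<kappa>"
    using \<kappa>(1) by (auto intro!: continuous_at_imp_continuous_on DERIV_isCont)
  have "continuous_on (- {0} \<union> U) ?D"
  proof (rule continuous_on_open_Un)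
    have c: "continuous_on (- {0}) (\<lambda>x :: real^2. k (x \<bullet> x))" "continuous_on (- {0}) (\<lambda>x :: real^2. \<kappa> (x \<bullet> x))"
      by (rule continuous_on_compose2[OF \<kappa>(2)] continuous_on_compose2[OF \<kappa>_cont]; auto intro!: continuous_intros)+
    show "continuous_on (- {0}) ?D" by (intro continuous_intros c P_cont P(2))
    show "continuous_on U ?D"
      using zU(2) by (subst continuous_on_cong[OF refl, of _ _ "\<lambda>_. 0"]) auto
  qed (use U in auto)
  moreover have "- {0} \<union> U = UNIV" using U by auto
  ultimately show "continuous_on UNIV ?D" by simp
  show "GDERIV ?\<phi> x :> ?D x" for x
  proof (cases "x \<in> U")
    case True
    have "((\<lambda>_. 0) has_derivative (\<lambda>h. h \<bullet> ?D x)) (at x)" using zU(2)[OF True] by simp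
    then show ?thesis unfolding gderiv_def
      by (rule has_derivative_transform_within_open[OF _ U(1) True]) (use zU(1) in auto)
  next
    case False
    then have "x \<noteq> 0" using U by auto
    have s: "((\<lambda>x. x \<bullet> x) has_derivative (\<lambda>h. 2 * (h \<bullet> x))) (at x)"
      by (auto intro!: derivative_eq_intros simp: inner_commute)
    have "((\<lambda>x. \<kappa> (x \<bullet> x)) has_derivative (\<lambda>h. k (x \<bullet> x) * (2 * (h \<bullet> x)))) (at x)"
      by (rule has_derivative_compose[OF s]) (use \<kappa>(1) in \<open>simp add: has_field_derivative_def\<close>)
    from has_derivative_mult[OF this P(1)[OF \<open>x \<noteq> 0\<close>]] show ?thesis
      unfolding gderiv_def
      by (rule has_derivative_eq_rhs) (simp add: fun_eq_iff inner_add_right algebra_simps)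
  qed
  show "\<exists>K. compact K \<and> K \<subseteq> annulus \<rho>1 \<rho>2 \<and> (\<forall>x. x \<notin> K \<longrightarrow> ?\<phi> x = 0)"
  proof (intro exI conjI allI impI)
    let ?K = "{x :: real^2. c \<le> x \<bullet> x} \<inter> ({x. x \<bullet> x \<le> d} \<inter> cball 0 \<rho>2)"
    show "compact ?K"
      by (intro closed_Int_compact compact_cball closed_Collect_le continuous_intros)
    show "?K \<subseteq> annulus \<rho>1 \<rho>2"
    proof
      fix x assume "x \<in> ?K"
      then have "\<rho>1\<^sup>2 < (norm x)\<^sup>2" "(norm x)\<^sup>2 < \<rho>2\<^sup>2"
        using cd by (auto simp: power2_norm_eq_inner)
      then show "x \<in> annulus \<rho>1 \<rho>2"
        using cd by (auto simp: annulus_def intro: power2_less_imp_less)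
    qed
    fix x assume x: "x \<notin> ?K"
    have "x \<bullet> x \<notin> {c..d}"
    proof
      assume "x \<bullet> x \<in> {c..d}"
      then have "(norm x)\<^sup>2 \<le> \<rho>2\<^sup>2" using cd by (auto simp: power2_norm_eq_inner)
      then have "norm x \<le> \<rho>2" using cd(4) by (rule power2_le_imp_le)
      with x \<open>x \<bullet> x \<in> {c..d}\<close> show False by auto
    qed
    then show "?\<phi> x = 0" using cd by simp
  qed
qed

text \<open>The primitive that vanishes to the left of the support vanishes also to its right, because the total
integral is 0.\<close>

lemma profile_primitive:
  assumes "profile a b k" "integral {a..b} k = 0"
  obtains \<kappa> c d where "\<And>s. (\<kappa> has_real_derivative k s) (at s)" "a < c" "d < b"
    "\<And>s. s \<notin> {c..d} \<Longrightarrow> \<kappa> s = 0" "\<And>s. s \<notin> {c..d} \<Longrightarrow> k s = 0"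
    "\<And>s. \<bar>\<kappa> s\<bar> \<le> integral {a..b} (\<lambda>s. \<bar>k s\<bar>)"
proof -
  obtain c d where cd: "a < c" "c < d" "d < b" "\<And>s. s \<notin> {c..d} \<Longrightarrow> k s = 0" and k: "continuous_on UNIV k"
    using assms(1) by (auto simp: profile_def)
  have k_int: "k integrable_on {x..y}" for x y
    by (intro integrable_continuous_interval continuous_on_subset[OF k]) auto
  have ak_int: "(\<lambda>s. \<bar>k s\<bar>) integrable_on {x..y}" for x y
    by (intro integrable_continuous_interval continuous_intros continuous_on_subset[OF k]) auto
  define \<kappa> where "\<kappa> s = integral {a..s} k" for s
  have below: "\<kappa> s = 0" if "s < c" for s
  proof -
    have "\<kappa> s = integral {a..s} (\<lambda>_. 0)"
      unfolding \<kappa>_def by (rule integral_cong) (use cd(4) that in auto)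
    then show ?thesis by simp
  qed
  have above: "\<kappa> s = 0" if "d < s" for s
  proof -
    have "integral {d..x} k = integral {d..x} (\<lambda>_. 0)" for x
      by (rule integral_spike[of "{d}"]) (use cd(4) in auto)
    then have z: "integral {d..x} k = 0" for x by simp
    have "\<kappa> s = integral {a..d} k + integral {d..s} k"
      unfolding \<kappa>_def using cd that k_int
      by (intro Henstock_Kurzweil_Integration.integral_combine[symmetric]) auto
    moreover have "integral {a..b} k = integral {a..d} k + integral {d..b} k"
      using cd that k_int
      by (intro Henstock_Kurzweil_Integration.integral_combine[symmetric]) auto
    ultimately show ?thesis using assms(2) z by simp
  qed
  have der: "(\<kappa> has_real_derivative k s) (at s)" for s
  proof (cases "s < c")
    case True
    have "((\<lambda>_. 0) has_real_derivative k s) (at s)" using cd(4)[of s] True by simp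
    then show ?thesis
      by (rule has_field_derivative_transform_within_open[where S="{..<c}"]) (use True below in auto)
  next
    case False
    have "(\<kappa> has_real_derivative k s) (at s within {a..s + 1})"
      unfolding \<kappa>_def by (rule integral_has_real_derivative)
        (use False cd in \<open>auto intro: continuous_on_subset[OF k]\<close>)
    then show ?thesis using False cd by (simp add: at_within_Icc_at)
  qed
  have bd: "\<bar>\<kappa> s\<bar> \<le> integral {a..b} (\<lambda>s. \<bar>k s\<bar>)" for s
  proof (cases "s \<le> d")
    case True
    have "norm (integral {a..s} k) \<le> integral {a..s} (\<lambda>s. \<bar>k s\<bar>)"
      by (rule integral_norm_bound_integral) (use k_int ak_int in auto)
    also have "\<dots> \<le> integral {a..b} (\<lambda>s. \<bar>k s\<bar>)"
      by (rule integral_subset_le) (use True cd ak_int in auto)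
    finally show ?thesis by (simp add: \<kappa>_def)
  next
    case False
    then show ?thesis using above by (auto intro!: integral_nonneg ak_int)
  qed
  show thesis
    by (rule that[of \<kappa> c d]) (use der cd below above bd in \<open>auto simp: not_le\<close>)
qed

lemma cont_bounded_integrable_annulus:
  fixes v :: "real^2 \<Rightarrow> real"
  assumes "0 < \<rho>1" "continuous_on (- {0}) P" "v absolutely_integrable_on annulus \<rho>1 \<rho>2"
  shows "(\<lambda>x. v x * P x) absolutely_integrable_on annulus \<rho>1 \<rho>2"
proof -
  obtain B where "\<And>x. x \<in> annulus \<rho>1 \<rho>2 \<Longrightarrow> norm (P x) \<le> B"
    using bounded_ring_image[OF assms(1,2)] by metis
  then have "bounded (P ` annulus \<rho>1 \<rho>2)" by (auto simp: bounded_iff)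
  moreover have "continuous_on (annulus \<rho>1 \<rho>2) P"
    using assms by (auto intro!: continuous_on_subset[OF assms(2)] simp: annulus_def)
  ultimately have "(\<lambda>x. v x *\<^sub>R P x) absolutely_integrable_on annulus \<rho>1 \<rho>2"
    by (intro absolutely_integrable_bounded_scaleR(2)[OF annulus_lebesgue open_annulus _ _ assms(3)])
  then show ?thesis by simp
qed

lemma annulus_nonzero: "0 < \<rho>1 \<Longrightarrow> x \<in> annulus \<rho>1 \<rho>2 \<Longrightarrow> x \<noteq> 0"
  by (auto simp: annulus_def)

text \<open>The weak gradient is tested with the two components of the field \<open>\<kappa>(|x|\<^sup>2) Q(x) x / |x|\<^sup>2\<close>. In
its divergence the derivative of \<open>Q\<close> contributes \<open>x \<bullet> DQ x = 0\<close>, and the divergence of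
\<open>x / |x|\<^sup>2\<close> is 0 in dimension two, so only the derivative of \<open>\<kappa>\<close> remains.\<close>

lemma radial_weak_identity:
  assumes \<rho>: "0 < \<rho>1" "\<rho>1 < \<rho>2" and v: "W11_gradient (annulus \<rho>1 \<rho>2) v G" and Q: "angular Q DQ"
    and \<kappa>: "\<And>s. (\<kappa> has_real_derivative k s) (at s)" "continuous_on UNIV k"
    and cd: "\<rho>1\<^sup>2 < c" "d < \<rho>2\<^sup>2" "\<And>s. s \<notin> {c..d} \<Longrightarrow> \<kappa> s = 0" "\<And>s. s \<notin> {c..d} \<Longrightarrow> k s = 0"
  shows "2 * (LINT x:annulus \<rho>1 \<rho>2|lebesgue. v x * (Q x * k (x \<bullet> x)))
      = - (LINT x:annulus \<rho>1 \<rho>2|lebesgue. (\<kappa> (x \<bullet> x) * Q x / (x \<bullet> x)) * (G x \<bullet> x))"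
    and "(\<lambda>x. (\<kappa> (x \<bullet> x) * Q x / (x \<bullet> x)) * (G x \<bullet> x)) absolutely_integrable_on annulus \<rho>1 \<rho>2"
proof -
  let ?A = "annulus \<rho>1 \<rho>2"
  \<comment> \<open>\<open>P b\<close> is the component in direction \<open>b\<close> of the field without its cutoff\<close>
  define P where "P b x = Q x * (x \<bullet> b) / (x \<bullet> x)" for b x :: "real^2"
  define DP where "DP b x = ((x \<bullet> b) / (x \<bullet> x)) *\<^sub>R DQ x + (Q x / (x \<bullet> x)) *\<^sub>R b
      - (2 * Q x * (x \<bullet> b) / (x \<bullet> x)\<^sup>2) *\<^sub>R x" for b x
  define D where "D b x = (2 * k (x \<bullet> x) * P b x) *\<^sub>R x + \<kappa> (x \<bullet> x) *\<^sub>R DP b x" for b x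
  have Qd: "(Q has_derivative (\<lambda>h. h \<bullet> DQ x)) (at x)" "x \<bullet> DQ x = 0" if "x \<noteq> 0" for x
    using Q that by (auto simp: angular_def)
  have DPd: "(P b has_derivative (\<lambda>h. h \<bullet> DP b x)) (at x)" if "x \<noteq> 0" for b x
  proof -
    have "x \<bullet> x \<noteq> 0" using that by simp
    have "((\<lambda>x. Q x * (x \<bullet> b) / (x \<bullet> x)) has_derivative
       (\<lambda>h. ((Q x * (h \<bullet> b) + (h \<bullet> DQ x) * (x \<bullet> b)) * (x \<bullet> x) - Q x * (x \<bullet> b) * (2 * (h \<bullet> x))) / ((x \<bullet> x) * (x \<bullet> x)))) (at x)"
      using \<open>x \<bullet> x \<noteq> 0\<close>
      by (auto intro!: derivative_eq_intros Qd that simp: inner_commute)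
    then show ?thesis
      unfolding P_def[abs_def]
      by (rule has_derivative_eq_rhs)
        (use \<open>x \<bullet> x \<noteq> 0\<close> in \<open>simp add: DP_def fun_eq_iff inner_add_right inner_diff_right field_simps power2_eq_square\<close>)
  qed
  have DPc: "continuous_on (- {0}) (DP b)" for b
    unfolding DP_def[abs_def] using Q angular_continuous[OF Q]
    by (auto simp: angular_def intro!: continuous_intros)
  have t: "C1_test ?A (\<lambda>x. \<kappa> (x \<bullet> x) * P b x) (D b)" for b
    unfolding D_def[abs_def]
    by (rule C1_test_radial_cutoff[OF DPd DPc \<kappa>]) (use \<rho> cd in auto)
  have vi: "v absolutely_integrable_on ?A" and Gi: "G absolutely_integrable_on ?A"
    using v by (auto simp: W11_gradient_def)
  note pr = C1_test_products[OF t open_annulus]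
  have eq: "(LINT x:?A|lebesgue. v x * (D b x \<bullet> b)) = - (LINT x:?A|lebesgue. (\<kappa> (x \<bullet> x) * P b x) * (G x \<bullet> b))" for b
  proof -
    have "(LINT x:?A|lebesgue. v x *\<^sub>R D b x) \<bullet> b = (- (LINT x:?A|lebesgue. (\<kappa> (x \<bullet> x) * P b x) *\<^sub>R G x)) \<bullet> b"
      by (simp only: v[unfolded W11_gradient_def, THEN conjunct2, THEN conjunct2, rule_format, OF t[of b]])
    then show ?thesis
      using set_integral_inner(1)[OF pr(1)[OF vi], of b b]
        set_integral_inner(1)[OF pr(2)[OF Gi], of b b] by simp
  qed
  have iL: "(\<lambda>x. v x * (D b x \<bullet> b)) absolutely_integrable_on ?A" for b
    using set_integral_inner(2)[OF pr(1)[OF vi], of b b] by simp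
  have iR: "(\<lambda>x. (\<kappa> (x \<bullet> x) * P b x) * (G x \<bullet> b)) absolutely_integrable_on ?A" for b
    using set_integral_inner(2)[OF pr(2)[OF Gi], of b b] by simp
  define e1 e2 :: "real^2" where "e1 = axis 1 1" and "e2 = axis 2 1"
  have ip: "x \<bullet> y = (x \<bullet> e1) * (y \<bullet> e1) + (x \<bullet> e2) * (y \<bullet> e2)" for x y :: "real^2"
    by (simp add: e1_def e2_def inner_vec_def sum_2 axis_def)
  have ee: "e1 \<bullet> e1 = 1" "e2 \<bullet> e2 = 1" by (simp_all add: e1_def e2_def inner_axis_axis)
  have div: "D e1 x \<bullet> e1 + D e2 x \<bullet> e2 = 2 * (Q x * k (x \<bullet> x))" if x: "x \<in> ?A" for x
  proof -
    have "x \<noteq> 0" using x \<rho> annulus_nonzero by blast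
    then have s: "x \<bullet> x \<noteq> 0" by simp
    have dq: "(x \<bullet> e1) * (DQ x \<bullet> e1) + (x \<bullet> e2) * (DQ x \<bullet> e2) = 0"
      using Qd(2)[OF \<open>x \<noteq> 0\<close>] ip[of x "DQ x"] by simp
    have xx: "(x \<bullet> e1) * (x \<bullet> e1) + (x \<bullet> e2) * (x \<bullet> e2) = x \<bullet> x" using ip[of x x] by simp
    have 1: "P e1 x * (x \<bullet> e1) + P e2 x * (x \<bullet> e2) = Q x"
    proof -
      have "P e1 x * (x \<bullet> e1) + P e2 x * (x \<bullet> e2)
          = Q x * ((x \<bullet> e1) * (x \<bullet> e1) + (x \<bullet> e2) * (x \<bullet> e2)) / (x \<bullet> x)"
        by (simp add: P_def add_divide_distrib distrib_left)
      then show ?thesis unfolding xx using s by simp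
    qed
    have 2: "DP e1 x \<bullet> e1 + DP e2 x \<bullet> e2 = 0"
    proof -
      have "DP e1 x \<bullet> e1 + DP e2 x \<bullet> e2
          = ((x \<bullet> e1) * (DQ x \<bullet> e1) + (x \<bullet> e2) * (DQ x \<bullet> e2)) / (x \<bullet> x) + 2 * Q x / (x \<bullet> x)
            - 2 * Q x * ((x \<bullet> e1) * (x \<bullet> e1) + (x \<bullet> e2) * (x \<bullet> e2)) / (x \<bullet> x)\<^sup>2"
        by (simp add: DP_def inner_add_left inner_diff_left ee add_divide_distrib distrib_left)
      then show ?thesis unfolding dq xx using s by (simp add: power2_eq_square)
    qed
    have "D e1 x \<bullet> e1 + D e2 x \<bullet> e2
        = 2 * k (x \<bullet> x) * (P e1 x * (x \<bullet> e1) + P e2 x * (x \<bullet> e2)) + \<kappa> (x \<bullet> x) * (DP e1 x \<bullet> e1 + DP e2 x \<bullet> e2)"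
      by (simp add: D_def inner_add_left algebra_simps)
    then show ?thesis unfolding 1 2 by simp
  qed
  have rhs: "(\<kappa> (x \<bullet> x) * P e1 x) * (G x \<bullet> e1) + (\<kappa> (x \<bullet> x) * P e2 x) * (G x \<bullet> e2)
      = (\<kappa> (x \<bullet> x) * Q x / (x \<bullet> x)) * (G x \<bullet> x)" for x
    unfolding ip[of "G x" x] P_def by (simp add: add_divide_distrib distrib_left mult_ac)
  have "2 * (LINT x:?A|lebesgue. v x * (Q x * k (x \<bullet> x))) = (LINT x:?A|lebesgue. 2 * (v x * (Q x * k (x \<bullet> x))))"
    by simp
  also have "\<dots> = (LINT x:?A|lebesgue. v x * (D e1 x \<bullet> e1) + v x * (D e2 x \<bullet> e2))"
    by (rule set_lebesgue_integral_cong) (auto simp: distrib_left[symmetric] div)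
  also have "\<dots> = (LINT x:?A|lebesgue. v x * (D e1 x \<bullet> e1)) + (LINT x:?A|lebesgue. v x * (D e2 x \<bullet> e2))"
    by (rule set_integral_add(2)[OF iL iL])
  also have "\<dots> = - ((LINT x:?A|lebesgue. (\<kappa> (x \<bullet> x) * P e1 x) * (G x \<bullet> e1)) + (LINT x:?A|lebesgue. (\<kappa> (x \<bullet> x) * P e2 x) * (G x \<bullet> e2)))"
    by (simp only: eq)
  also have "(LINT x:?A|lebesgue. (\<kappa> (x \<bullet> x) * P e1 x) * (G x \<bullet> e1)) + (LINT x:?A|lebesgue. (\<kappa> (x \<bullet> x) * P e2 x) * (G x \<bullet> e2))
      = (LINT x:?A|lebesgue. (\<kappa> (x \<bullet> x) * P e1 x) * (G x \<bullet> e1) + (\<kappa> (x \<bullet> x) * P e2 x) * (G x \<bullet> e2))"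
    by (rule set_integral_add(2)[OF iR iR, symmetric])
  finally show "2 * (LINT x:?A|lebesgue. v x * (Q x * k (x \<bullet> x)))
      = - (LINT x:?A|lebesgue. (\<kappa> (x \<bullet> x) * Q x / (x \<bullet> x)) * (G x \<bullet> x))"
    by (simp only: rhs)
  show "(\<lambda>x. (\<kappa> (x \<bullet> x) * Q x / (x \<bullet> x)) * (G x \<bullet> x)) absolutely_integrable_on ?A"
    using set_integral_add(1)[OF iR[of e1] iR[of e2]] by (simp only: rhs)
qed

text \<open>The primitive of \<open>k\<close> is bounded by the integral of \<open>\<bar>k\<bar>\<close>, hence uniformly when \<open>k\<close> contains ever
thinner bumps of integral 1. This uniformity allows passing to the boundary circles.\<close>

lemma radial_weak_bound:
  assumes \<rho>: "0 < \<rho>1" "\<rho>1 < \<rho>2" and v: "W11_gradient (annulus \<rho>1 \<rho>2) v G" and Q: "angular Q DQ"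
    and CQ: "\<And>x. x \<in> annulus \<rho>1 \<rho>2 \<Longrightarrow> \<bar>Q x\<bar> \<le> CQ"
    and k: "profile (\<rho>1\<^sup>2) (\<rho>2\<^sup>2) k" "integral {\<rho>1\<^sup>2..\<rho>2\<^sup>2} k = 0"
    and B: "integral {\<rho>1\<^sup>2..\<rho>2\<^sup>2} (\<lambda>s. \<bar>k s\<bar>) \<le> B"
  shows "\<bar>LINT x:annulus \<rho>1 \<rho>2|lebesgue. v x * (Q x * k (x \<bullet> x))\<bar>
      \<le> B * CQ / \<rho>1 * (LINT x:annulus \<rho>1 \<rho>2|lebesgue. norm (G x))"
proof -
  let ?A = "annulus \<rho>1 \<rho>2"
  obtain \<kappa> c d where \<kappa>: "\<And>s. (\<kappa> has_real_derivative k s) (at s)" "\<rho>1\<^sup>2 < c" "d < \<rho>2\<^sup>2"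
    "\<And>s. s \<notin> {c..d} \<Longrightarrow> \<kappa> s = 0" "\<And>s. s \<notin> {c..d} \<Longrightarrow> k s = 0"
    and \<kappa>b: "\<And>s. \<bar>\<kappa> s\<bar> \<le> integral {\<rho>1\<^sup>2..\<rho>2\<^sup>2} (\<lambda>s. \<bar>k s\<bar>)"
    using profile_primitive[OF k] by metis
  have kc: "continuous_on UNIV k" using k by (auto simp: profile_def)
  have id: "2 * (LINT x:?A|lebesgue. v x * (Q x * k (x \<bullet> x)))
      = - (LINT x:?A|lebesgue. (\<kappa> (x \<bullet> x) * Q x / (x \<bullet> x)) * (G x \<bullet> x))"
    "(\<lambda>x. (\<kappa> (x \<bullet> x) * Q x / (x \<bullet> x)) * (G x \<bullet> x)) absolutely_integrable_on ?A"
    by (rule radial_weak_identity[OF \<rho> v Q \<kappa>(1) kc \<kappa>(2,3)]; rule \<kappa>; assumption)+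
  have Gi: "G absolutely_integrable_on ?A" using v by (auto simp: W11_gradient_def)
  have "\<bar>LINT x:?A|lebesgue. v x * (Q x * k (x \<bullet> x))\<bar>
      \<le> 2 * \<bar>LINT x:?A|lebesgue. v x * (Q x * k (x \<bullet> x))\<bar>" by simp
  also have "\<dots> = \<bar>2 * (LINT x:?A|lebesgue. v x * (Q x * k (x \<bullet> x)))\<bar>" by (simp only: abs_mult abs_numeral)
  also have "\<dots> = norm (LINT x:?A|lebesgue. (\<kappa> (x \<bullet> x) * Q x / (x \<bullet> x)) * (G x \<bullet> x))"
    unfolding id(1) real_norm_def by (rule abs_minus_cancel)
  also have "\<dots> \<le> (LINT x:?A|lebesgue. norm ((\<kappa> (x \<bullet> x) * Q x / (x \<bullet> x)) * (G x \<bullet> x)))"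
    by (rule set_integral_norm_bound[OF id(2)])
  also have "\<dots> \<le> (LINT x:?A|lebesgue. B * CQ / \<rho>1 * norm (G x))"
  proof (rule set_integral_mono)
    show "set_integrable lebesgue ?A (\<lambda>x. norm ((\<kappa> (x \<bullet> x) * Q x / (x \<bullet> x)) * (G x \<bullet> x)))"
      by (rule set_integrable_norm[OF id(2)])
    show "set_integrable lebesgue ?A (\<lambda>x. B * CQ / \<rho>1 * norm (G x))"
      by (intro set_integrable_mult_right set_integrable_norm Gi)
    fix x assume x: "x \<in> ?A"
    then have nx: "\<rho>1 < norm x" by (simp add: annulus_def)
    have B0: "\<bar>\<kappa> (x \<bullet> x)\<bar> \<le> B" using \<kappa>b B order_trans by blast
    have xx: "x \<bullet> x = norm x * norm x" by (simp add: power2_norm_eq_inner[symmetric] power2_eq_square)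
    have "norm ((\<kappa> (x \<bullet> x) * Q x / (x \<bullet> x)) * (G x \<bullet> x))
        = \<bar>\<kappa> (x \<bullet> x)\<bar> * \<bar>Q x\<bar> * \<bar>G x \<bullet> x\<bar> / (norm x * norm x)"
      by (simp add: abs_mult xx)
    also have "\<dots> \<le> \<bar>\<kappa> (x \<bullet> x)\<bar> * \<bar>Q x\<bar> * (norm (G x) * norm x) / (norm x * norm x)"
      by (intro divide_right_mono mult_left_mono Cauchy_Schwarz_ineq2) auto
    also have "\<dots> = \<bar>\<kappa> (x \<bullet> x)\<bar> * \<bar>Q x\<bar> * norm (G x) / norm x"
      using nx \<rho> by simp
    also have "\<dots> \<le> B * CQ * norm (G x) / norm x"
      using B0 CQ[OF x] by (intro divide_right_mono mult_right_mono mult_mono) auto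
    also have "\<dots> \<le> B * CQ * norm (G x) / \<rho>1"
      using nx \<rho> B0 CQ[OF x] by (intro divide_left_mono mult_nonneg_nonneg mult_pos_pos) (auto intro: order_trans[OF abs_ge_zero])
    finally show "norm ((\<kappa> (x \<bullet> x) * Q x / (x \<bullet> x)) * (G x \<bullet> x)) \<le> B * CQ / \<rho>1 * norm (G x)" by simp
  qed
  also have "\<dots> = B * CQ / \<rho>1 * (LINT x:?A|lebesgue. norm (G x))" by simp
  finally show ?thesis .
qed

section \<open>Thin shells and the integral over a circle\<close>

text \<open>A normalized parabola arc.\<close>

lemma bump_exists:
  fixes a \<alpha> \<beta> b :: real
  assumes "a \<le> \<alpha>" "\<alpha> < \<beta>" "\<beta> \<le> b"
  shows "\<exists>k :: real \<Rightarrow> real. continuous_on UNIV k \<and> (\<forall>s. 0 \<le> k s) \<and> (\<forall>s. s \<notin> {\<alpha>..\<beta>} \<longrightarrow> k s = 0) \<and>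
    integral {a..b} k = 1 \<and> (\<forall>s\<in>{\<alpha><..<\<beta>}. 0 < k s)"
proof -
  define k0 where "k0 s = max 0 ((s - \<alpha>) * (\<beta> - s))" for s
  have c: "continuous_on A k0" for A unfolding k0_def by (intro continuous_intros)
  have pos: "0 < k0 s" if "s \<in> {\<alpha><..<\<beta>}" for s using that by (simp add: k0_def)
  have nonneg: "0 \<le> k0 s" for s by (simp add: k0_def)
  have "integral {a..b} k0 \<noteq> 0"
  proof
    assume "integral {a..b} k0 = 0"
    then have "\<forall>s\<in>{a..b}. k0 s = 0"
      using assms nonneg c by (subst (asm) integral_eq_0_iff) auto
    moreover have "(\<alpha> + \<beta>) / 2 \<in> {a..b}" "(\<alpha> + \<beta>) / 2 \<in> {\<alpha><..<\<beta>}" using assms by auto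
    ultimately show False using pos by fastforce
  qed
  moreover have "0 \<le> integral {a..b} k0"
    by (intro integral_nonneg integrable_continuous_interval c) (auto simp: k0_def)
  ultimately have I: "0 < integral {a..b} k0" by simp
  have z: "k0 s = 0" if "s \<notin> {\<alpha>..\<beta>}" for s
  proof -
    have "(s - \<alpha>) * (\<beta> - s) \<le> 0" using that assms(2) by (auto simp: mult_le_0_iff not_le)
    then show ?thesis by (simp add: k0_def)
  qed
  show ?thesis
  proof (intro exI[of _ "\<lambda>s. k0 s / integral {a..b} k0"] conjI ballI)
    show "continuous_on UNIV (\<lambda>s. k0 s / integral {a..b} k0)"
      using I by (intro continuous_intros c) auto
    show "integral {a..b} (\<lambda>s. k0 s / integral {a..b} k0) = 1" using I by simp
    fix s assume "s \<in> {\<alpha><..<\<beta>}"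
    then show "0 < k0 s / integral {a..b} k0" using pos I by simp
  qed (use I z in \<open>auto simp: k0_def\<close>)
qed

lemma profile_lincomb:
  assumes "profile a b k" "profile a b l"
  shows "profile a b (\<lambda>s. k s + r * l s)"
proof -
  obtain c d where 1: "a < c" "c < d" "d < b" "\<forall>s. s \<notin> {c..d} \<longrightarrow> k s = 0" and kc: "continuous_on UNIV k"
    using assms(1) by (auto simp: profile_def)
  obtain c' d' where 2: "a < c'" "c' < d'" "d' < b" "\<forall>s. s \<notin> {c'..d'} \<longrightarrow> l s = 0" and lc: "continuous_on UNIV l"
    using assms(2) by (auto simp: profile_def)
  show ?thesis unfolding profile_def
  proof (intro conjI exI)
    show "continuous_on UNIV (\<lambda>s. k s + r * l s)" by (intro continuous_intros kc lc)
    show "a < min c c'" "min c c' < max d d'" "max d d' < b" using 1 2 by auto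
    show "\<forall>s. s \<notin> {min c c'..max d d'} \<longrightarrow> k s + r * l s = 0"
    proof (intro allI impI)
      fix s assume "s \<notin> {min c c'..max d d'}"
      then have "s \<notin> {c..d}" "s \<notin> {c'..d'}" by auto
      then show "k s + r * l s = 0" using 1(4) 2(4) by simp
    qed
  qed
qed

lemma profile_integrable: "profile a b k \<Longrightarrow> k integrable_on {x..y}" "profile a b k \<Longrightarrow> (\<lambda>s. \<bar>k s\<bar>) integrable_on {x..y}"
  by (auto simp: profile_def intro!: integrable_continuous_interval continuous_intros
      intro: continuous_on_subset)

lemma profile_bounded:
  assumes "profile a b k"
  obtains M where "0 \<le> M" "\<And>s. \<bar>k s\<bar> \<le> M"
proof -
  obtain c d where 1: "\<forall>s. s \<notin> {c..d} \<longrightarrow> k s = 0" and kc: "continuous_on UNIV k"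
    using assms(1) by (auto simp: profile_def)
  have "bounded (k ` {c..d})"
    by (intro compact_imp_bounded compact_continuous_image continuous_on_subset[OF kc]) auto
  then obtain M where M: "\<forall>y\<in>k ` {c..d}. norm y \<le> M" unfolding bounded_iff by blast
  show thesis
  proof (rule that[of "max 0 M"])
    show "\<bar>k s\<bar> \<le> max 0 M" for s using M 1 by (cases "s \<in> {c..d}") (auto simp: le_max_iff_disj)
  qed simp
qed

lemma profile_off_annulus:
  assumes "profile (\<rho>1\<^sup>2) (\<rho>2\<^sup>2) k" "0 < \<rho>1" "\<rho>1 < \<rho>2" "x \<notin> annulus \<rho>1 \<rho>2"
  shows "k (x \<bullet> x) = 0"
proof -
  obtain c d where 1: "\<rho>1\<^sup>2 < c" "c < d" "d < \<rho>2\<^sup>2" "\<forall>s. s \<notin> {c..d} \<longrightarrow> k s = 0"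
    using assms(1) by (auto simp: profile_def)
  have "x \<bullet> x \<notin> {c..d}"
  proof
    assume "x \<bullet> x \<in> {c..d}"
    then have "\<rho>1\<^sup>2 < (norm x)\<^sup>2" "(norm x)\<^sup>2 < \<rho>2\<^sup>2" using 1 by (auto simp: power2_norm_eq_inner)
    then have "\<rho>1 < norm x" "norm x < \<rho>2" using assms by (auto intro: power2_less_imp_less)
    then show False using assms(4) by (simp add: annulus_def)
  qed
  then show ?thesis using 1 by simp
qed

lemma profile_continuous_radial: "profile a b k \<Longrightarrow> continuous_on A (\<lambda>x :: real^2. k (x \<bullet> x))"
  by (rule continuous_on_compose2[of UNIV k]) (auto simp: profile_def intro!: continuous_intros)

text \<open>The constant \<open>C\<close> is \<open>pi\<close>. It arises without integration in polar coordinates: constants have weak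
gradient 0, so \<open>radial_weak_bound\<close> shows that the left-hand side depends only on the integral of \<open>k\<close>. Positivity follows
by integrating a bump.\<close>

lemma profile_shell_integral:
  assumes \<rho>: "0 < \<rho>1" "\<rho>1 < \<rho>2"
  shows "\<exists>C>0. \<forall>k. profile (\<rho>1\<^sup>2) (\<rho>2\<^sup>2) k \<longrightarrow>
        (LINT x:annulus \<rho>1 \<rho>2|lebesgue. k (x \<bullet> x)) = C * integral {\<rho>1\<^sup>2..\<rho>2\<^sup>2} k"
proof -
  let ?A = "annulus \<rho>1 \<rho>2" and ?a = "\<rho>1\<^sup>2" and ?b = "\<rho>2\<^sup>2"
  have ab: "?a < ?b" using \<rho> by (simp add: power_strict_mono)
  define p q where "p = ?a + (?b - ?a) / 3" and "q = ?a + 2 * (?b - ?a) / 3"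
  have pq: "?a < p" "p < q" "q < ?b" using ab by (auto simp: p_def q_def field_simps)
  obtain k0 :: "real \<Rightarrow> real" where k0: "continuous_on UNIV k0" "\<And>s. 0 \<le> k0 s" "\<And>s. s \<notin> {p..q} \<Longrightarrow> k0 s = 0"
    "integral {?a..?b} k0 = 1" "\<And>s. s \<in> {p<..<q} \<Longrightarrow> 0 < k0 s"
    using bump_exists[OF less_imp_le[OF pq(1)] pq(2) less_imp_le[OF pq(3)]] by blast
  have pk0: "profile ?a ?b k0" using k0 pq by (auto simp: profile_def)
  have one: "(\<lambda>_. 1 :: real) absolutely_integrable_on ?A"
    by (intro absolutely_integrable_on_const annulus_lmeasurable)
  have int: "(\<lambda>x. k (x \<bullet> x)) absolutely_integrable_on ?A" if "profile ?a ?b k" for k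
    using cont_bounded_integrable_annulus[OF \<rho>(1) profile_continuous_radial[OF that] one] by simp
  define C where "C = (LINT x:?A|lebesgue. k0 (x \<bullet> x))"
  have zero: "(LINT x:?A|lebesgue. k (x \<bullet> x)) = 0" if k: "profile ?a ?b k" "integral {?a..?b} k = 0" for k
  proof -
    have "\<bar>LINT x:?A|lebesgue. 1 * (1 * k (x \<bullet> x))\<bar>
        \<le> integral {?a..?b} (\<lambda>s. \<bar>k s\<bar>) * 1 / \<rho>1 * (LINT x:?A|lebesgue. norm (0 :: real^2))"
      by (rule radial_weak_bound[OF \<rho> W11_gradient_const[OF open_annulus bounded_annulus] angular_const _ k order_refl]) simp
    then show ?thesis by simp
  qed
  have eq: "(LINT x:?A|lebesgue. k (x \<bullet> x)) = C * integral {?a..?b} k" if k: "profile ?a ?b k" for k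
  proof -
    define I where "I = integral {?a..?b} k"
    have p: "profile ?a ?b (\<lambda>s. k s + (- I) * k0 s)" by (rule profile_lincomb[OF k pk0])
    have "integral {?a..?b} (\<lambda>s. k s + (- I) * k0 s) = integral {?a..?b} k + integral {?a..?b} (\<lambda>s. (- I) * k0 s)"
      by (intro Henstock_Kurzweil_Integration.integral_add integrable_on_mult_right profile_integrable[OF k] profile_integrable[OF pk0])
    also have "\<dots> = 0" using k0(4) by (simp add: I_def)
    finally have "(LINT x:?A|lebesgue. k (x \<bullet> x) + (- I) * k0 (x \<bullet> x)) = 0"
      using zero[OF p] by simp
    also have "(LINT x:?A|lebesgue. k (x \<bullet> x) + (- I) * k0 (x \<bullet> x))
        = (LINT x:?A|lebesgue. k (x \<bullet> x)) + (LINT x:?A|lebesgue. (- I) * k0 (x \<bullet> x))"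
      by (intro set_integral_add(2) int k set_integrable_mult_right pk0)
    also have "\<dots> = (LINT x:?A|lebesgue. k (x \<bullet> x)) + (- I) * C"
      by (simp only: set_integral_mult_right C_def)
    finally show ?thesis by (simp add: I_def)
  qed
  have "C \<noteq> 0"
  proof
    assume C0: "C = 0"
    have i: "integrable lebesgue (\<lambda>x. indicator ?A x *\<^sub>R k0 (x \<bullet> x))"
      using int[OF pk0] by (simp add: set_integrable_def)
    have "AE x in lebesgue. indicator ?A x *\<^sub>R k0 (x \<bullet> x) = 0"
      using C0 integral_nonneg_eq_0_iff_AE[OF i] k0(2)
      by (auto simp: C_def set_lebesgue_integral_def)
    then have "AE x in lebesgue. x \<notin> {x :: real^2. p < x \<bullet> x \<and> x \<bullet> x < q}"
    proof eventually_elim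
      case (elim x)
      show ?case
      proof
        assume "x \<in> {x. p < x \<bullet> x \<and> x \<bullet> x < q}"
        then have "0 < k0 (x \<bullet> x)" using k0(5) by auto
        then show False using elim profile_off_annulus[OF pk0 \<rho>, of x] by (auto split: split_indicator_asm)
      qed
    qed
    moreover have op: "open {x :: real^2. p < x \<bullet> x \<and> x \<bullet> x < q}"
      by (intro open_Collect_conj open_Collect_less continuous_intros)
    ultimately have "negligible {x :: real^2. p < x \<bullet> x \<and> x \<bullet> x < q}"
      by (simp add: negligible_iff_null_sets AE_iff_null_sets borel_open sets_completionI_sets)
    moreover have "0 < (p + q) / 2" using pq by (smt (verit) zero_le_power2 half_gt_zero)
    then have "sqrt ((p + q) / 2) *\<^sub>R axis 1 1 \<in> {x :: real^2. p < x \<bullet> x \<and> x \<bullet> x < q}"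
      using pq by (simp add: inner_axis_axis)
    ultimately show False using open_not_negligible[OF op] by blast
  qed
  moreover have "0 \<le> C"
    unfolding C_def set_lebesgue_integral_def using k0(2) by (intro integral_nonneg_AE) simp
  ultimately have "0 < C" by simp
  then show ?thesis using eq by blast
qed

definition circ_length :: "real \<Rightarrow> real" where "circ_length \<rho> = measure hausdorff1 (circ \<rho>)"

lemma circ_length_pos: "0 < \<rho> \<Longrightarrow> 0 < circ_length \<rho>"
  using emeasure_circ_pos[of \<rho>] emeasure_circ_finite[of \<rho>]
  unfolding circ_length_def measure_def by (simp add: enn2real_positive_iff)

lemma compact_circ: "compact (circ \<rho>)"
proof -
  have "circ \<rho> = sphere 0 \<rho>" by (auto simp: circ_def)
  then show ?thesis by simp
qed

lemma continuous_circ_bounded: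
  fixes f :: "real^2 \<Rightarrow> real"
  assumes "continuous_on (circ \<rho>) f"
  obtains B where "\<And>x. \<bar>indicator (circ \<rho>) x *\<^sub>R f x\<bar> \<le> B"
    "(\<lambda>x. indicator (circ \<rho>) x *\<^sub>R f x) \<in> borel_measurable borel"
proof -
  have "bounded (f ` circ \<rho>)"
    by (intro compact_imp_bounded compact_continuous_image assms compact_circ)
  then obtain B where B: "\<forall>y\<in>f ` circ \<rho>. norm y \<le> B" unfolding bounded_iff by blast
  show thesis
  proof (rule that[of "max 0 B"])
    show "\<bar>indicator (circ \<rho>) x *\<^sub>R f x\<bar> \<le> max 0 B" for x
      using B by (auto split: split_indicator simp: le_max_iff_disj)
    show "(\<lambda>x. indicator (circ \<rho>) x *\<^sub>R f x) \<in> borel_measurable borel"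
      by (rule borel_measurable_continuous_on_indicator[OF _ assms]) simp
  qed
qed

lemma set_integrable_circ_const: "0 < \<rho> \<Longrightarrow> set_integrable hausdorff1 (circ \<rho>) (\<lambda>_. c :: real)"
  unfolding set_integrable_def
  using emeasure_circ_finite[of \<rho>] by (intro integrable_scaleR_left integrable_real_indicator) auto

lemma set_integral_circ_const: "0 < \<rho> \<Longrightarrow> (LINT x:circ \<rho>|hausdorff1. c :: real) = circ_length \<rho> * c"
  using emeasure_circ_finite[of \<rho>]
  by (simp add: set_lebesgue_integral_def circ_length_def)

lemma continuous_integrable_circ:
  fixes f :: "real^2 \<Rightarrow> real"
  assumes "0 < \<rho>" "continuous_on (circ \<rho>) f"
  shows "set_integrable hausdorff1 (circ \<rho>) f"
proof -
  obtain B where B: "\<And>x. \<bar>indicator (circ \<rho>) x *\<^sub>R f x\<bar> \<le> B"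
    "(\<lambda>x. indicator (circ \<rho>) x *\<^sub>R f x) \<in> borel_measurable borel"
    using continuous_circ_bounded[OF assms(2)] by metis
  show ?thesis unfolding set_integrable_def
  proof (rule Bochner_Integration.integrable_bound)
    show "integrable hausdorff1 (\<lambda>x :: real^2. indicator (circ \<rho>) x *\<^sub>R B)"
      using set_integrable_circ_const[OF assms(1), of B] by (simp add: set_integrable_def)
    show "AE x in hausdorff1. norm (indicator (circ \<rho>) x *\<^sub>R f x) \<le> norm (indicator (circ \<rho>) x *\<^sub>R B)"
    proof (rule AE_I2)
      fix x show "norm (indicator (circ \<rho>) x *\<^sub>R f x) \<le> norm (indicator (circ \<rho>) x *\<^sub>R B)"
        using B(1)[of x] by (cases "x \<in> circ \<rho>") auto
    qed
  qed (use B(2) in simp)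
qed

lemma sgn_cmul: "norm e = 1 \<Longrightarrow> sgn (cmul e y) = cmul e (sgn y)"
  by (simp add: sgn_div_norm norm_cmul cmul_scaleR)

text \<open>An instance of \<open>invariant_means_agree\<close> for the Hausdorff measure on the circle and the image under
the radial projection of the Lebesgue measure with density \<open>k(|y|\<^sup>2)\<close>.\<close>

lemma circle_mean:
  fixes f :: "real^2 \<Rightarrow> real"
  assumes \<rho>: "0 < \<rho>1" "\<rho>1 < \<rho>2" "0 < \<rho>" and f: "continuous_on (circ \<rho>) f"
    and k: "profile (\<rho>1\<^sup>2) (\<rho>2\<^sup>2) k" "\<And>s. 0 \<le> k s"
  shows "(LINT x:circ \<rho>|hausdorff1. f x) * (LINT y:annulus \<rho>1 \<rho>2|lebesgue. k (y \<bullet> y))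
      = (LINT y:annulus \<rho>1 \<rho>2|lebesgue. f (\<rho> *\<^sub>R sgn y) * k (y \<bullet> y)) * circ_length \<rho>"
proof -
  let ?A = "annulus \<rho>1 \<rho>2"
  define F where "F x = indicator (circ \<rho>) x *\<^sub>R f x" for x
  obtain B where B: "\<And>x. \<bar>F x\<bar> \<le> B" and Fm [measurable]: "F \<in> borel_measurable borel"
    using continuous_circ_bounded[OF f] unfolding F_def by metis
  have km [measurable]: "(\<lambda>y :: real^2. k (y \<bullet> y)) \<in> borel_measurable borel"
    by (intro borel_measurable_continuous_onI profile_continuous_radial[OF k(1)])
  have sg [measurable]: "(sgn :: real^2 \<Rightarrow> real^2) \<in> borel_measurable borel"
    unfolding sgn_div_norm[abs_def] by measurable
  define \<mu> where "\<mu> = density (hausdorff1 :: (real^2) measure) (indicator (circ \<rho>))"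
  define L where "L = density lborel (\<lambda>y :: real^2. ennreal (k (y \<bullet> y)))"
  define \<nu> where "\<nu> = distr L borel sgn"
  have sL [measurable_cong]: "sets L = sets borel" by (simp add: L_def)
  have kA: "indicator ?A y *\<^sub>R (g y * k (y \<bullet> y)) = g y * k (y \<bullet> y)" for g and y :: "real^2"
    using profile_off_annulus[OF k(1) \<rho>(1,2), of y] by (auto split: split_indicator)
  have kA': "indicator ?A y *\<^sub>R k (y \<bullet> y) = k (y \<bullet> y)" for y :: "real^2"
    using kA[of y "\<lambda>_. 1"] by simp
  have one: "(\<lambda>_. 1 :: real) absolutely_integrable_on ?A"
    by (intro absolutely_integrable_on_const annulus_lmeasurable)
  have "(\<lambda>x. k (x \<bullet> x)) absolutely_integrable_on ?A"
    using cont_bounded_integrable_annulus[OF \<rho>(1) profile_continuous_radial[OF k(1)] one] by simp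
  then have "integrable lebesgue (\<lambda>y :: real^2. k (y \<bullet> y))" by (simp add: set_integrable_def kA'[unfolded real_scaleR_def])
  then have ik: "integrable lborel (\<lambda>y :: real^2. k (y \<bullet> y))"
    by (subst (asm) integrable_completion) auto
  have "emeasure L (space L) = ennreal (integral\<^sup>L lborel (\<lambda>y :: real^2. k (y \<bullet> y)))"
    using k(2) by (simp add: L_def emeasure_density nn_integral_eq_integral[OF ik])
  then have finL: "finite_measure L" by (intro finite_measureI) simp
  have rotL: "distr L borel (cmul e) = L" if e: "norm e = 1" for e
  proof -
    have "cmul e y \<bullet> cmul e y = y \<bullet> y" for y
      using e by (simp add: power2_norm_eq_inner[symmetric] norm_cmul)
    then have "L = density lborel (\<lambda>y. (\<lambda>y :: real^2. ennreal (k (y \<bullet> y))) (cmul e y))"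
      by (simp add: L_def)
    then have "distr L lborel (cmul e) = density (distr lborel lborel (cmul e)) (\<lambda>y :: real^2. ennreal (k (y \<bullet> y)))"
      by (subst density_distr) auto
    also have "\<dots> = L" by (simp add: distr_lborel_rotation[OF e] L_def)
    finally have "distr L lborel (cmul e) = L" .
    moreover have "distr L borel (cmul e) = distr L lborel (cmul e)" by (rule distr_cong) auto
    ultimately show ?thesis by simp
  qed
  have "(\<integral>x. F x \<partial>\<mu>) * measure \<nu> UNIV = (\<integral>y. F (\<rho> *\<^sub>R y) \<partial>\<nu>) * measure \<mu> UNIV"
  proof (rule invariant_means_agree[where K=B])
    show "finite_measure \<mu>"
      using emeasure_circ_finite[OF \<rho>(3)] by (intro finite_measureI) (simp add: \<mu>_def emeasure_density)
    show "sets \<mu> = sets borel" by (simp add: \<mu>_def)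
    show "AE x in \<mu>. norm x = \<rho>"
      unfolding \<mu>_def by (subst AE_density) (auto simp: circ_def intro!: AE_I2 split: split_indicator)
    show "distr \<mu> borel (cmul e) = \<mu>" if e: "norm e = 1" for e
    proof -
      have "\<mu> = density hausdorff1 (\<lambda>y. indicator (circ \<rho>) (cmul e y))"
        using e by (auto simp: \<mu>_def circ_def norm_cmul indicator_def intro!: arg_cong[where f="density _"])
      then have "distr \<mu> hausdorff1 (cmul e) = density (distr hausdorff1 hausdorff1 (cmul e)) (indicator (circ \<rho>))"
        by (subst density_distr) auto
      also have "\<dots> = \<mu>" by (simp add: distr_hausdorff1_rotation[OF e] \<mu>_def)
      finally have "distr \<mu> hausdorff1 (cmul e) = \<mu>" .
      moreover have "distr \<mu> borel (cmul e) = distr \<mu> hausdorff1 (cmul e)" by (rule distr_cong) auto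
      ultimately show ?thesis by simp
    qed
    show "finite_measure \<nu>" unfolding \<nu>_def
      by (rule finite_measure.finite_measure_distr[OF finL]) simp
    show "sets \<nu> = sets borel" by (simp add: \<nu>_def)
    show "AE y in \<nu>. norm y = 1"
    proof -
      have "AE y in L. norm (sgn y) = 1"
        unfolding L_def
      proof (subst AE_density, simp, rule AE_I2, rule impI)
        fix y :: "real^2" assume "0 < ennreal (k (y \<bullet> y))"
        then have "y \<in> ?A" using profile_off_annulus[OF k(1) \<rho>(1,2), of y] by auto
        then have "y \<noteq> 0" using annulus_nonzero \<rho> by blast
        then show "norm (sgn y) = 1" by (simp add: norm_sgn)
      qed
      then show ?thesis unfolding \<nu>_def by (subst AE_distr_iff) auto
    qed
    show "distr \<nu> borel (cmul e) = \<nu>" if e: "norm e = 1" for e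
    proof -
      have "distr \<nu> borel (cmul e) = distr L borel (cmul e \<circ> sgn)"
        unfolding \<nu>_def by (rule distr_distr) auto
      also have "\<dots> = distr L borel (sgn \<circ> cmul e)"
        by (rule distr_cong) (auto simp: sgn_cmul[OF e])
      also have "\<dots> = distr (distr L borel (cmul e)) borel sgn"
        by (rule distr_distr[symmetric]) auto
      finally show ?thesis by (simp add: rotL[OF e] \<nu>_def)
    qed
  qed (use B \<rho> in auto)
  moreover have "(\<integral>x. F x \<partial>\<mu>) = (LINT x:circ \<rho>|hausdorff1. f x)"
  proof -
    have "\<mu> = density hausdorff1 (\<lambda>x. ennreal (indicator (circ \<rho>) x))" by (simp add: \<mu>_def ennreal_indicator)
    then have "(\<integral>x. F x \<partial>\<mu>) = (\<integral>x. indicator (circ \<rho>) x *\<^sub>R F x \<partial>hausdorff1)"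
      by (simp only:) (rule integral_density; auto)
    also have "\<dots> = (\<integral>x. indicator (circ \<rho>) x *\<^sub>R f x \<partial>hausdorff1)"
      by (rule Bochner_Integration.integral_cong) (auto simp: F_def split: split_indicator)
    finally show ?thesis by (simp add: set_lebesgue_integral_def)
  qed
  moreover have "measure \<mu> UNIV = circ_length \<rho>"
    by (simp add: \<mu>_def circ_length_def measure_def emeasure_density)
  moreover have "measure \<nu> UNIV = (LINT y:?A|lebesgue. k (y \<bullet> y))"
  proof -
    have "measure \<nu> UNIV = enn2real (emeasure L UNIV)"
      by (simp add: \<nu>_def measure_def emeasure_distr sets_eq_imp_space_eq[OF sL])
    also have "\<dots> = integral\<^sup>L lborel (\<lambda>y :: real^2. k (y \<bullet> y))"
      using k(2) by (simp add: L_def emeasure_density nn_integral_eq_integral[OF ik] integral_nonneg_AE)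
    also have "\<dots> = integral\<^sup>L lebesgue (\<lambda>y :: real^2. k (y \<bullet> y))" by (rule integral_completion[symmetric]) simp
    finally show ?thesis by (simp add: set_lebesgue_integral_def kA'[unfolded real_scaleR_def])
  qed
  moreover have "(\<integral>y. F (\<rho> *\<^sub>R y) \<partial>\<nu>) = (LINT y:?A|lebesgue. f (\<rho> *\<^sub>R sgn y) * k (y \<bullet> y))"
  proof -
    have "(\<integral>y. F (\<rho> *\<^sub>R y) \<partial>\<nu>) = (\<integral>y. F (\<rho> *\<^sub>R sgn y) \<partial>L)"
      unfolding \<nu>_def by (rule integral_distr) auto
    also have "\<dots> = (\<integral>y. k (y \<bullet> y) *\<^sub>R F (\<rho> *\<^sub>R sgn y) \<partial>lborel)"
      unfolding L_def using k(2) by (intro integral_density) auto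
    also have "\<dots> = (\<integral>y. k (y \<bullet> y) *\<^sub>R F (\<rho> *\<^sub>R sgn y) \<partial>lebesgue)"
      by (rule integral_completion[symmetric]) auto
    also have "\<dots> = (\<integral>y. indicator ?A y *\<^sub>R (f (\<rho> *\<^sub>R sgn y) * k (y \<bullet> y)) \<partial>lebesgue)"
    proof (rule Bochner_Integration.integral_cong[OF refl])
      fix y :: "real^2"
      show "k (y \<bullet> y) *\<^sub>R F (\<rho> *\<^sub>R sgn y) = indicator ?A y *\<^sub>R (f (\<rho> *\<^sub>R sgn y) * k (y \<bullet> y))"
      proof (cases "y \<in> ?A")
        case True
        then have "y \<noteq> 0" using annulus_nonzero \<rho> by blast
        then have "\<rho> *\<^sub>R sgn y \<in> circ \<rho>" using \<rho> by (simp add: circ_def norm_sgn)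
        then show ?thesis using True by (simp add: F_def)
      qed (use profile_off_annulus[OF k(1) \<rho>(1,2), of y] in simp)
    qed
    finally show ?thesis by (simp add: set_lebesgue_integral_def)
  qed
  ultimately show ?thesis by simp
qed

section \<open>Circle integrals of Sobolev functions and of their traces\<close>

lemma closure_annulus:
  assumes "0 < \<rho>1" "\<rho>1 < \<rho>2"
  shows "closure (annulus \<rho>1 \<rho>2) = {x. \<rho>1 \<le> norm x \<and> norm x \<le> \<rho>2}"
proof
  show "closure (annulus \<rho>1 \<rho>2) \<subseteq> {x. \<rho>1 \<le> norm x \<and> norm x \<le> \<rho>2}"
    by (rule closure_minimal)
      (auto simp: annulus_def intro!: closed_Collect_conj closed_Collect_le continuous_intros)
  show "{x. \<rho>1 \<le> norm x \<and> norm x \<le> \<rho>2} \<subseteq> closure (annulus \<rho>1 \<rho>2)"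
  proof
    fix x :: "real^2" assume x: "x \<in> {x. \<rho>1 \<le> norm x \<and> norm x \<le> \<rho>2}"
    then have nx: "0 < norm x" using assms by auto
    show "x \<in> closure (annulus \<rho>1 \<rho>2)"
      unfolding closure_approachable
    proof (intro allI impI)
      fix e :: real assume "0 < e"
      define t where "t = min e (\<rho>2 - \<rho>1) / 3"
      have t: "0 < t" "t < e" "3 * t \<le> \<rho>2 - \<rho>1" using \<open>0 < e\<close> assms by (auto simp: t_def min_def)
      define r where "r = (if norm x + t < \<rho>2 then norm x + t else norm x - t)"
      have r: "\<rho>1 < r" "r < \<rho>2" "\<bar>r - norm x\<bar> = t"
        using x t by (auto simp: r_def)
      define y where "y = (r / norm x) *\<^sub>R x"
      have "norm y = r" using r(1) nx assms(1) by (simp add: y_def)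
      then have "y \<in> annulus \<rho>1 \<rho>2" using r(1,2) by (simp add: annulus_def)
      moreover have "y - x = ((r - norm x) / norm x) *\<^sub>R x"
        using nx by (simp add: y_def diff_divide_distrib scaleR_diff_left)
      then have "norm (y - x) = \<bar>r - norm x\<bar>" using nx by simp
      then have "dist y x < e" using r(3) t(2) by (simp only: dist_norm)
      ultimately show "\<exists>y\<in>annulus \<rho>1 \<rho>2. dist y x < e" by blast
    qed
  qed
qed

lemma frontier_annulus:
  assumes "0 < \<rho>1" "\<rho>1 < \<rho>2"
  shows "frontier (annulus \<rho>1 \<rho>2) = circ \<rho>1 \<union> circ \<rho>2"
proof -
  have "frontier (annulus \<rho>1 \<rho>2) = closure (annulus \<rho>1 \<rho>2) - annulus \<rho>1 \<rho>2"
    using open_annulus by (simp add: frontier_def interior_open)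
  also have "\<dots> = circ \<rho>1 \<union> circ \<rho>2"
  proof (rule set_eqI)
    fix x :: "real^2"
    have "(\<rho>1 \<le> n \<and> n \<le> \<rho>2) \<and> \<not> (\<rho>1 < n \<and> n < \<rho>2) \<longleftrightarrow> n = \<rho>1 \<or> n = \<rho>2" for n
      using assms by auto
    then show "x \<in> closure (annulus \<rho>1 \<rho>2) - annulus \<rho>1 \<rho>2 \<longleftrightarrow> x \<in> circ \<rho>1 \<union> circ \<rho>2"
      unfolding closure_annulus[OF assms]
      by (simp only: annulus_def circ_def Diff_iff Un_iff mem_Collect_eq)
  qed
  finally show ?thesis .
qed

lemma compact_closure_annulus: "compact (closure (annulus \<rho>1 \<rho>2))"
  using bounded_annulus by simp

lemma continuous_absolutely_integrable_annulus:
  fixes f :: "real^2 \<Rightarrow> real"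
  assumes "continuous_on (closure (annulus \<rho>1 \<rho>2)) f"
  shows "f absolutely_integrable_on annulus \<rho>1 \<rho>2"
proof -
  have "bounded (f ` closure (annulus \<rho>1 \<rho>2))"
    by (intro compact_imp_bounded compact_continuous_image assms compact_closure_annulus)
  then have b: "bounded (f ` annulus \<rho>1 \<rho>2)"
    by (rule bounded_subset) (use closure_subset in blast)
  have c: "continuous_on (annulus \<rho>1 \<rho>2) f"
    using assms closure_subset by (rule continuous_on_subset)
  have one: "(\<lambda>_. 1 :: real) absolutely_integrable_on annulus \<rho>1 \<rho>2"
    by (intro absolutely_integrable_on_const annulus_lmeasurable)
  show ?thesis
    using absolutely_integrable_bounded_scaleR(2)[OF annulus_lebesgue open_annulus c b one] by simp
qed

lemma absolutely_integrable_times_radial: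
  fixes f :: "real^2 \<Rightarrow> real"
  assumes "0 < \<rho>1" "f absolutely_integrable_on annulus \<rho>1 \<rho>2" "profile a b k" "continuous_on (- {0}) Q"
  shows "(\<lambda>x. f x * (Q x * k (x \<bullet> x))) absolutely_integrable_on annulus \<rho>1 \<rho>2"
  using assms by (intro cont_bounded_integrable_annulus continuous_intros profile_continuous_radial)

text \<open>For the inner circle the shell lies just outside of it, for the outer circle just inside.\<close>

lemma thin_shell:
  assumes "0 < \<rho>1" "\<rho>1 < \<rho>2" "\<rho> \<in> {\<rho>1, \<rho>2}" "0 < \<delta>"
  shows "\<exists>k. profile (\<rho>1\<^sup>2) (\<rho>2\<^sup>2) k \<and> (\<forall>s. 0 \<le> k s) \<and> integral {\<rho>1\<^sup>2..\<rho>2\<^sup>2} k = 1 \<and>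
    (\<forall>x :: real^2. k (x \<bullet> x) \<noteq> 0 \<longrightarrow> \<bar>norm x - \<rho>\<bar> < \<delta>)"
proof -
  define t where "t = min \<delta> (\<rho>2 - \<rho>1) / 3"
  have t: "0 < t" "2 * t < \<delta>" "3 * t \<le> \<rho>2 - \<rho>1" using assms by (auto simp: t_def min_def)
  define p where "p = (if \<rho> = \<rho>1 then \<rho>1 + t else \<rho>2 - 2 * t)"
  define q where "q = p + t"
  have pq: "\<rho>1 < p" "p < q" "q < \<rho>2" "\<And>r. p \<le> r \<Longrightarrow> r \<le> q \<Longrightarrow> \<bar>r - \<rho>\<bar> < \<delta>"
    using assms t by (auto simp: p_def q_def split: if_splits)
  have sq: "\<rho>1\<^sup>2 < p\<^sup>2" "p\<^sup>2 < q\<^sup>2" "q\<^sup>2 < \<rho>2\<^sup>2"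
    using pq assms by (auto intro!: power_strict_mono)
  obtain k :: "real \<Rightarrow> real" where k: "continuous_on UNIV k" "\<And>s. 0 \<le> k s" "\<And>s. s \<notin> {p\<^sup>2..q\<^sup>2} \<Longrightarrow> k s = 0"
    "integral {\<rho>1\<^sup>2..\<rho>2\<^sup>2} k = 1"
    using bump_exists[OF less_imp_le[OF sq(1)] sq(2) less_imp_le[OF sq(3)]] by blast
  show ?thesis
  proof (intro exI[of _ k] conjI allI impI)
    show "profile (\<rho>1\<^sup>2) (\<rho>2\<^sup>2) k" using k sq unfolding profile_def by blast
    fix x :: "real^2" assume "k (x \<bullet> x) \<noteq> 0"
    then have "x \<bullet> x \<in> {p\<^sup>2..q\<^sup>2}" using k(3) by blast
    then have "p\<^sup>2 \<le> (norm x)\<^sup>2" "(norm x)\<^sup>2 \<le> q\<^sup>2" by (auto simp: power2_norm_eq_inner)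
    then have "p \<le> norm x" "norm x \<le> q"
      using pq assms by (auto intro: power2_le_imp_le)
    then show "\<bar>norm x - \<rho>\<bar> < \<delta>" by (rule pq(4))
  qed (use k in auto)
qed

text \<open>On a thin shell a uniformly continuous function differs little from its value at the radial projection to
the circle, and for the latter \<open>circle_mean\<close> is exact.\<close>

lemma shell_average:
  fixes f :: "real^2 \<Rightarrow> real"
  assumes \<rho>: "0 < \<rho>1" "\<rho>1 < \<rho>2" "\<rho> \<in> {\<rho>1, \<rho>2}" and f: "continuous_on (closure (annulus \<rho>1 \<rho>2)) f"
    and C: "0 < C" "\<And>k. profile (\<rho>1\<^sup>2) (\<rho>2\<^sup>2) k \<Longrightarrow>
        (LINT x:annulus \<rho>1 \<rho>2|lebesgue. k (x \<bullet> x)) = C * integral {\<rho>1\<^sup>2..\<rho>2\<^sup>2} k"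
    and "0 < \<eta>"
  shows "\<exists>k. profile (\<rho>1\<^sup>2) (\<rho>2\<^sup>2) k \<and> (\<forall>s. 0 \<le> k s) \<and> integral {\<rho>1\<^sup>2..\<rho>2\<^sup>2} k = 1 \<and>
    \<bar>circ_length \<rho> * (LINT x:annulus \<rho>1 \<rho>2|lebesgue. f x * k (x \<bullet> x)) - C * (LINT x:circ \<rho>|hausdorff1. f x)\<bar> \<le> \<eta>"
proof -
  let ?A = "annulus \<rho>1 \<rho>2"
  have \<rho>0: "0 < \<rho>" "\<rho>1 \<le> \<rho>" "\<rho> \<le> \<rho>2" using \<rho> by auto
  define \<eta>' where "\<eta>' = \<eta> / (circ_length \<rho> * C)"
  have "0 < circ_length \<rho>" using circ_length_pos \<rho>0 by blast
  then have \<eta>': "0 < \<eta>'" using \<open>0 < \<eta>\<close> C by (simp add: \<eta>'_def)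
  have "uniformly_continuous_on (closure ?A) f"
    by (rule compact_uniformly_continuous[OF f compact_closure_annulus])
  then obtain \<delta> where \<delta>: "0 < \<delta>" "\<And>x y. x \<in> closure ?A \<Longrightarrow> y \<in> closure ?A \<Longrightarrow> dist y x < \<delta> \<Longrightarrow> dist (f y) (f x) < \<eta>'"
    unfolding uniformly_continuous_on_def using \<eta>' by metis
  obtain k where k: "profile (\<rho>1\<^sup>2) (\<rho>2\<^sup>2) k" "\<And>s. 0 \<le> k s" "integral {\<rho>1\<^sup>2..\<rho>2\<^sup>2} k = 1"
    "\<And>x :: real^2. k (x \<bullet> x) \<noteq> 0 \<Longrightarrow> \<bar>norm x - \<rho>\<bar> < \<delta>"
    using thin_shell[OF \<rho> \<delta>(1)] by blast
  have circ_sub: "circ \<rho> \<subseteq> closure ?A"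
    unfolding closure_annulus[OF \<rho>(1,2)] using \<rho>0 by (auto simp: circ_def)
  have near: "\<bar>f x - f (\<rho> *\<^sub>R sgn x)\<bar> * k (x \<bullet> x) \<le> \<eta>' * k (x \<bullet> x)" if x: "x \<in> ?A" for x
  proof (cases "k (x \<bullet> x) = 0")
    case False
    then have d: "\<bar>norm x - \<rho>\<bar> < \<delta>" by (rule k(4))
    have nz: "x \<noteq> 0" using x annulus_nonzero \<rho> by blast
    then have in_c: "\<rho> *\<^sub>R sgn x \<in> circ \<rho>" using \<rho>0 by (simp add: circ_def norm_sgn)
    have "x - \<rho> *\<^sub>R sgn x = (norm x - \<rho>) *\<^sub>R sgn x"
    proof -
      have "norm x *\<^sub>R sgn x = x" using nz by (simp add: sgn_div_norm)
      then show ?thesis by (simp add: scaleR_diff_left)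
    qed
    then have "dist x (\<rho> *\<^sub>R sgn x) < \<delta>" using d nz by (simp add: dist_norm norm_sgn)
    then have "dist (f x) (f (\<rho> *\<^sub>R sgn x)) < \<eta>'"
      using \<delta>(2) in_c circ_sub x closure_subset by blast
    then show ?thesis by (intro mult_right_mono k(2)) (simp add: dist_real_def)
  qed simp
  have fi: "f absolutely_integrable_on ?A" by (rule continuous_absolutely_integrable_annulus[OF f])
  have cont2: "continuous_on (- {0}) (\<lambda>x. f (\<rho> *\<^sub>R sgn x))"
    by (rule continuous_on_compose2[OF continuous_on_subset[OF f circ_sub]])
      (use \<rho>0 in \<open>auto simp: circ_def norm_sgn sgn_div_norm intro!: continuous_intros\<close>)
  have one: "(\<lambda>_. 1 :: real) absolutely_integrable_on ?A"
    by (intro absolutely_integrable_on_const annulus_lmeasurable)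
  have i1: "(\<lambda>x. f x * k (x \<bullet> x)) absolutely_integrable_on ?A"
    using absolutely_integrable_times_radial[OF \<rho>(1) fi k(1) continuous_on_const[of _ 1]] by simp
  have i2: "(\<lambda>x. f (\<rho> *\<^sub>R sgn x) * k (x \<bullet> x)) absolutely_integrable_on ?A"
    using absolutely_integrable_times_radial[OF \<rho>(1) one k(1) cont2] by simp
  have i3: "(\<lambda>x. k (x \<bullet> x)) absolutely_integrable_on ?A"
    using absolutely_integrable_times_radial[OF \<rho>(1) one k(1) continuous_on_const[of _ 1]] by simp
  have i4: "(\<lambda>x. f x * k (x \<bullet> x) - f (\<rho> *\<^sub>R sgn x) * k (x \<bullet> x)) absolutely_integrable_on ?A"
    by (rule set_integral_diff(1)[OF i1 i2])
  have kC: "(LINT x:?A|lebesgue. k (x \<bullet> x)) = C" using C(2)[OF k(1)] k(3) by simp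
  have "\<bar>(LINT x:?A|lebesgue. f x * k (x \<bullet> x)) - (LINT x:?A|lebesgue. f (\<rho> *\<^sub>R sgn x) * k (x \<bullet> x))\<bar>
      = norm (LINT x:?A|lebesgue. f x * k (x \<bullet> x) - f (\<rho> *\<^sub>R sgn x) * k (x \<bullet> x))"
    by (simp add: set_integral_diff(2)[OF i1 i2])
  also have "\<dots> \<le> (LINT x:?A|lebesgue. norm (f x * k (x \<bullet> x) - f (\<rho> *\<^sub>R sgn x) * k (x \<bullet> x)))"
    by (rule set_integral_norm_bound[OF i4])
  also have "\<dots> \<le> (LINT x:?A|lebesgue. \<eta>' * k (x \<bullet> x))"
  proof (rule set_integral_mono[OF set_integrable_norm[OF i4] set_integrable_mult_right])
    fix x assume "x \<in> ?A"
    then show "norm (f x * k (x \<bullet> x) - f (\<rho> *\<^sub>R sgn x) * k (x \<bullet> x)) \<le> \<eta>' * k (x \<bullet> x)"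
      using near[of x] k(2)[of "x \<bullet> x"] by (simp add: left_diff_distrib[symmetric] abs_mult)
  qed (use i3 in blast)
  also have "\<dots> = \<eta>' * C" by (simp add: kC)
  finally have "circ_length \<rho> * \<bar>(LINT x:?A|lebesgue. f x * k (x \<bullet> x)) - (LINT x:?A|lebesgue. f (\<rho> *\<^sub>R sgn x) * k (x \<bullet> x))\<bar>
      \<le> circ_length \<rho> * (\<eta>' * C)"
    using \<open>0 < circ_length \<rho>\<close> by (intro mult_left_mono) auto
  also have "\<dots> = \<eta>" using \<open>0 < circ_length \<rho>\<close> C by (simp add: \<eta>'_def)
  finally have "\<bar>circ_length \<rho> * (LINT x:?A|lebesgue. f x * k (x \<bullet> x)) - circ_length \<rho> * (LINT x:?A|lebesgue. f (\<rho> *\<^sub>R sgn x) * k (x \<bullet> x))\<bar> \<le> \<eta>"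
    using \<open>0 < circ_length \<rho>\<close> by (simp add: right_diff_distrib[symmetric] abs_mult)
  moreover have "circ_length \<rho> * (LINT x:?A|lebesgue. f (\<rho> *\<^sub>R sgn x) * k (x \<bullet> x)) = C * (LINT x:circ \<rho>|hausdorff1. f x)"
    using circle_mean[OF \<rho>(1,2) \<rho>0(1) continuous_on_subset[OF f circ_sub] k(1,2)] kC
    by (simp add: mult.commute)
  ultimately show ?thesis using k(1-3) by (intro exI[of _ k]) simp
qed

text \<open>The bound does not depend on the bump \<open>k\<close>; it feeds the uniform constant of \<open>radial_weak_bound\<close>.\<close>

lemma integral_abs_lincomb_le:
  assumes "profile a b k" "\<And>s. 0 \<le> k s" "integral {a..b} k = 1"
    and "profile a b l"
  shows "integral {a..b} (\<lambda>s. \<bar>l s + r * k s\<bar>) \<le> integral {a..b} (\<lambda>s. \<bar>l s\<bar>) + \<bar>r\<bar>"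
proof -
  have "integral {a..b} (\<lambda>s. \<bar>l s + r * k s\<bar>) \<le> integral {a..b} (\<lambda>s. \<bar>l s\<bar> + \<bar>r\<bar> * k s)"
  proof (rule integral_le)
    show "(\<lambda>s. \<bar>l s + r * k s\<bar>) integrable_on {a..b}"
      by (rule profile_integrable(2)[OF profile_lincomb[OF assms(4,1)]])
    show "(\<lambda>s. \<bar>l s\<bar> + \<bar>r\<bar> * k s) integrable_on {a..b}"
      by (intro integrable_add integrable_on_mult_right profile_integrable[OF assms(4)] profile_integrable[OF assms(1)])
    fix s show "\<bar>l s + r * k s\<bar> \<le> \<bar>l s\<bar> + \<bar>r\<bar> * k s"
      using abs_triangle_ineq[of "l s" "r * k s"] assms(2)[of s] by (simp add: abs_mult)
  qed
  also have "\<dots> = integral {a..b} (\<lambda>s. \<bar>l s\<bar>) + integral {a..b} (\<lambda>s. \<bar>r\<bar> * k s)"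
    by (intro Henstock_Kurzweil_Integration.integral_add integrable_on_mult_right profile_integrable[OF assms(4)] profile_integrable[OF assms(1)])
  also have "\<dots> = integral {a..b} (\<lambda>s. \<bar>l s\<bar>) + \<bar>r\<bar>" using assms(3) by simp
  finally show ?thesis .
qed

text \<open>The trace inequality for circle integrals. Replacing a thin bump at the circle by the fixed bump \<open>k0\<close>
costs at most a multiple of the \<open>L\<^sup>1\<close> norm of \<open>G\<close>, by \<open>radial_weak_bound\<close> with \<open>Q = 1\<close>; the integral
against \<open>k0\<close> is bounded by the \<open>L\<^sup>1\<close> norm of \<open>f\<close>, and the integral against the thin bump
approximates the circle integral.\<close>

lemma circle_integral_bound:
  assumes \<rho>: "0 < \<rho>1" "\<rho>1 < \<rho>2" "\<rho> \<in> {\<rho>1, \<rho>2}"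
  shows "\<exists>K\<ge>0. \<forall>f G. continuous_on (closure (annulus \<rho>1 \<rho>2)) f \<longrightarrow> W11_gradient (annulus \<rho>1 \<rho>2) f G \<longrightarrow>
     \<bar>LINT x:circ \<rho>|hausdorff1. f x\<bar> \<le>
       K * ((LINT x:annulus \<rho>1 \<rho>2|lebesgue. \<bar>f x\<bar>) + (LINT x:annulus \<rho>1 \<rho>2|lebesgue. norm (G x)))"
proof -
  let ?A = "annulus \<rho>1 \<rho>2" and ?a = "\<rho>1\<^sup>2" and ?b = "\<rho>2\<^sup>2"
  obtain C where C: "0 < C" "\<And>k. profile ?a ?b k \<Longrightarrow> (LINT x:?A|lebesgue. k (x \<bullet> x)) = C * integral {?a..?b} k"
    using profile_shell_integral[OF \<rho>(1,2)] by blast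
  obtain k0 where k0: "profile ?a ?b k0" "\<And>s. 0 \<le> k0 s" "integral {?a..?b} k0 = 1"
    using thin_shell[OF \<rho> zero_less_one] by blast
  obtain M where M: "0 \<le> M" "\<And>s. \<bar>k0 s\<bar> \<le> M" using profile_bounded[OF k0(1)] by metis
  define H where "H = circ_length \<rho>"
  have "0 < H" unfolding H_def using circ_length_pos \<rho> by auto
  \<comment> \<open>2 bounds the integral of \<open>\<bar>k0 - k\<bar>\<close> for two bumps of integral 1\<close>
  define K where "K = H / C * (M + 2 / \<rho>1)"
  have main: "\<bar>LINT x:circ \<rho>|hausdorff1. f x\<bar> \<le> K * ((LINT x:?A|lebesgue. \<bar>f x\<bar>) + (LINT x:?A|lebesgue. norm (G x)))"
    if f: "continuous_on (closure ?A) f" and W: "W11_gradient ?A f G" for f G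
  proof -
    define a1 where "a1 = (LINT x:?A|lebesgue. \<bar>f x\<bar>)"
    define a2 where "a2 = (LINT x:?A|lebesgue. norm (G x))"
    have a: "0 \<le> a1" "0 \<le> a2"
      unfolding a1_def a2_def set_lebesgue_integral_def by (auto intro!: integral_nonneg_AE)
    have fi: "f absolutely_integrable_on ?A" by (rule continuous_absolutely_integrable_annulus[OF f])
    have i: "(\<lambda>x. f x * k (x \<bullet> x)) absolutely_integrable_on ?A" if "profile ?a ?b k" for k
      using absolutely_integrable_times_radial[OF \<rho>(1) fi that continuous_on_const[of _ 1]] by simp
    have i0: "\<bar>LINT x:?A|lebesgue. f x * k0 (x \<bullet> x)\<bar> \<le> M * a1"
    proof -
      have "norm (LINT x:?A|lebesgue. f x * k0 (x \<bullet> x)) \<le> (LINT x:?A|lebesgue. norm (f x * k0 (x \<bullet> x)))"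
        by (rule set_integral_norm_bound[OF i[OF k0(1)]])
      also have "\<dots> \<le> (LINT x:?A|lebesgue. M * \<bar>f x\<bar>)"
      proof (rule set_integral_mono[OF set_integrable_norm[OF i[OF k0(1)]] set_integrable_mult_right])
        show "norm (f x * k0 (x \<bullet> x)) \<le> M * \<bar>f x\<bar>" for x
          using mult_right_mono[OF M(2)[of "x \<bullet> x"], of "\<bar>f x\<bar>"] by (simp add: abs_mult mult.commute)
      qed (use set_integrable_abs[OF fi] in blast)
      finally show ?thesis by (simp add: a1_def)
    qed
    have "C * \<bar>LINT x:circ \<rho>|hausdorff1. f x\<bar> \<le> H * (M * a1 + 2 / \<rho>1 * a2)"
    proof (rule field_le_epsilon)
      fix \<eta> :: real assume "0 < \<eta>"
      obtain k where k: "profile ?a ?b k" "\<And>s. 0 \<le> k s" "integral {?a..?b} k = 1"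
        "\<bar>H * (LINT x:?A|lebesgue. f x * k (x \<bullet> x)) - C * (LINT x:circ \<rho>|hausdorff1. f x)\<bar> \<le> \<eta>"
        using shell_average[OF \<rho> f C \<open>0 < \<eta>\<close>] unfolding H_def by blast
      have p: "profile ?a ?b (\<lambda>s. k0 s + (-1) * k s)" by (rule profile_lincomb[OF k0(1) k(1)])
      have "integral {?a..?b} (\<lambda>s. k0 s + (-1) * k s) = integral {?a..?b} k0 + integral {?a..?b} (\<lambda>s. (-1) * k s)"
        by (intro Henstock_Kurzweil_Integration.integral_add integrable_on_mult_right profile_integrable[OF k(1)] profile_integrable[OF k0(1)])
      then have z: "integral {?a..?b} (\<lambda>s. k0 s + (-1) * k s) = 0" using k(3) k0(3) by simp
      have "integral {?a..?b} (\<lambda>s. \<bar>k0 s + (-1) * k s\<bar>) \<le> integral {?a..?b} (\<lambda>s. \<bar>k0 s\<bar>) + \<bar>-1\<bar>"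
        by (rule integral_abs_lincomb_le[OF k(1-3) k0(1)])
      also have "\<dots> = 2" using k0 by simp
      finally have two: "integral {?a..?b} (\<lambda>s. \<bar>k0 s + (-1) * k s\<bar>) \<le> 2" .
      have "\<bar>LINT x:?A|lebesgue. f x * (1 * (k0 (x \<bullet> x) + (-1) * k (x \<bullet> x)))\<bar> \<le> 2 * 1 / \<rho>1 * a2"
        unfolding a2_def
        by (rule radial_weak_bound[OF \<rho>(1,2) W angular_const _ p z two]) simp
      also have "(LINT x:?A|lebesgue. f x * (1 * (k0 (x \<bullet> x) + (-1) * k (x \<bullet> x))))
          = (LINT x:?A|lebesgue. f x * k0 (x \<bullet> x) - f x * k (x \<bullet> x))"
        by (simp add: algebra_simps)
      also have "\<dots> = (LINT x:?A|lebesgue. f x * k0 (x \<bullet> x)) - (LINT x:?A|lebesgue. f x * k (x \<bullet> x))"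
        by (intro set_integral_diff(2) i k k0)
      finally have "\<bar>LINT x:?A|lebesgue. f x * k (x \<bullet> x)\<bar> \<le> M * a1 + 2 / \<rho>1 * a2"
        using i0 by simp
      then have "H * \<bar>LINT x:?A|lebesgue. f x * k (x \<bullet> x)\<bar> \<le> H * (M * a1 + 2 / \<rho>1 * a2)"
        using \<open>0 < H\<close> by (intro mult_left_mono) auto
      then have "\<bar>H * (LINT x:?A|lebesgue. f x * k (x \<bullet> x))\<bar> \<le> H * (M * a1 + 2 / \<rho>1 * a2)"
        using \<open>0 < H\<close> by (simp add: abs_mult)
      then have "\<bar>C * (LINT x:circ \<rho>|hausdorff1. f x)\<bar> \<le> H * (M * a1 + 2 / \<rho>1 * a2) + \<eta>"
        using k(4) by linarith
      then show "C * \<bar>LINT x:circ \<rho>|hausdorff1. f x\<bar> \<le> H * (M * a1 + 2 / \<rho>1 * a2) + \<eta>"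
        using C by (simp add: abs_mult)
    qed
    also have "\<dots> \<le> H * ((M + 2 / \<rho>1) * (a1 + a2))"
    proof (rule mult_left_mono)
      have "0 \<le> M * a2" "0 \<le> 2 / \<rho>1 * a1" using a M \<rho> by auto
      then show "M * a1 + 2 / \<rho>1 * a2 \<le> (M + 2 / \<rho>1) * (a1 + a2)"
        by (simp add: distrib_left distrib_right)
    qed (use \<open>0 < H\<close> in simp)
    finally have "\<bar>LINT x:circ \<rho>|hausdorff1. f x\<bar> \<le> H * ((M + 2 / \<rho>1) * (a1 + a2)) / C"
      using C by (simp add: pos_le_divide_eq mult.commute)
    then show ?thesis by (simp add: K_def a1_def a2_def)
  qed
  have "0 \<le> K" unfolding K_def using \<open>0 < H\<close> C M \<rho> by simp
  then show ?thesis using main by blast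
qed

lemma continuous_integrable_frontier:
  fixes f :: "real^2 \<Rightarrow> real"
  assumes \<rho>: "0 < \<rho>1" "\<rho>1 < \<rho>2" and f: "continuous_on (closure (annulus \<rho>1 \<rho>2)) f"
  shows "set_integrable hausdorff1 (frontier (annulus \<rho>1 \<rho>2)) f"
proof -
  have "circ \<rho>1 \<subseteq> closure (annulus \<rho>1 \<rho>2)" "circ \<rho>2 \<subseteq> closure (annulus \<rho>1 \<rho>2)"
    unfolding closure_annulus[OF \<rho>] using \<rho> by (auto simp: circ_def)
  then show ?thesis
    unfolding frontier_annulus[OF \<rho>] using \<rho> f
    by (intro set_integrable_Un continuous_integrable_circ) (auto intro: continuous_on_subset)
qed

lemma set_integrable_circ:
  assumes \<rho>: "0 < \<rho>1" "\<rho>1 < \<rho>2" "\<rho> \<in> {\<rho>1, \<rho>2}" and "set_integrable hausdorff1 (frontier (annulus \<rho>1 \<rho>2)) (T :: real^2 \<Rightarrow> real)"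
  shows "set_integrable hausdorff1 (circ \<rho>) T"
  by (rule set_integrable_subset[OF assms(4)]) (use \<rho> frontier_annulus[OF \<rho>(1,2)] in auto)

lemma circle_integral_le_frontier:
  assumes \<rho>: "0 < \<rho>1" "\<rho>1 < \<rho>2" "\<rho> \<in> {\<rho>1, \<rho>2}" and T: "set_integrable hausdorff1 (frontier (annulus \<rho>1 \<rho>2)) (T :: real^2 \<Rightarrow> real)"
  shows "(LINT x:circ \<rho>|hausdorff1. \<bar>T x\<bar>) \<le> (LINT x:frontier (annulus \<rho>1 \<rho>2)|hausdorff1. \<bar>T x\<bar>)"
proof -
  have sub: "circ \<rho> \<subseteq> frontier (annulus \<rho>1 \<rho>2)" using \<rho> frontier_annulus[OF \<rho>(1,2)] by auto
  show ?thesis unfolding set_lebesgue_integral_def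
  proof (rule integral_mono)
    show "integrable hausdorff1 (\<lambda>x. indicator (circ \<rho>) x *\<^sub>R \<bar>T x\<bar>)"
      using set_integrable_abs[OF set_integrable_circ[OF \<rho> T]] by (simp add: set_integrable_def)
    show "integrable hausdorff1 (\<lambda>x. indicator (frontier (annulus \<rho>1 \<rho>2)) x *\<^sub>R \<bar>T x\<bar>)"
      using set_integrable_abs[OF T] by (simp add: set_integrable_def)
    show "indicator (circ \<rho>) x *\<^sub>R \<bar>T x\<bar> \<le> indicator (frontier (annulus \<rho>1 \<rho>2)) x *\<^sub>R \<bar>T x\<bar>" for x
      using sub by (auto simp: indicator_def)
  qed
qed

text \<open>Apply \<open>circle_integral_bound\<close> to \<open>v k - u\<close> for the approximating sequence \<open>v\<close> of the trace. Equality of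
the integrals suffices below, because radial functions are constant on circles.\<close>

lemma trace_circle_integral:
  assumes \<rho>: "0 < \<rho>1" "\<rho>1 < \<rho>2" "\<rho> \<in> {\<rho>1, \<rho>2}"
    and u: "continuous_on (closure (annulus \<rho>1 \<rho>2)) u" and T: "has_trace (annulus \<rho>1 \<rho>2) u T"
  shows "(LINT x:circ \<rho>|hausdorff1. T x) = (LINT x:circ \<rho>|hausdorff1. u x)"
proof -
  let ?A = "annulus \<rho>1 \<rho>2"
  from T obtain G v Dv where Ti: "set_integrable hausdorff1 (frontier ?A) T"
    and G: "W11_gradient ?A u G" and v: "\<And>k::nat. continuous_on (closure ?A) (v k)" "\<And>k. W11_gradient ?A (v k) (Dv k)"
    and lim: "(\<lambda>k. LINT x:?A|lebesgue. \<bar>v k x - u x\<bar>) \<longlonglongrightarrow> 0"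
      "(\<lambda>k. LINT x:?A|lebesgue. norm (Dv k x - G x)) \<longlonglongrightarrow> 0"
      "(\<lambda>k. LINT x:frontier ?A|hausdorff1. \<bar>v k x - T x\<bar>) \<longlonglongrightarrow> 0"
    unfolding has_trace_def by blast
  obtain K where K: "0 \<le> K" "\<And>f G. continuous_on (closure ?A) f \<Longrightarrow> W11_gradient ?A f G \<Longrightarrow>
     \<bar>LINT x:circ \<rho>|hausdorff1. f x\<bar> \<le> K * ((LINT x:?A|lebesgue. \<bar>f x\<bar>) + (LINT x:?A|lebesgue. norm (G x)))"
    using circle_integral_bound[OF \<rho>] by blast
  have vi: "set_integrable hausdorff1 (frontier ?A) (v k)" for k
    by (rule continuous_integrable_frontier[OF \<rho>(1,2) v(1)])
  have ui: "set_integrable hausdorff1 (frontier ?A) u"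
    by (rule continuous_integrable_frontier[OF \<rho>(1,2) u])
  note c = set_integrable_circ[OF \<rho>]
  have "\<bar>(LINT x:circ \<rho>|hausdorff1. T x) - (LINT x:circ \<rho>|hausdorff1. u x)\<bar>
      \<le> (LINT x:frontier ?A|hausdorff1. \<bar>v k x - T x\<bar>)
        + K * ((LINT x:?A|lebesgue. \<bar>v k x - u x\<bar>) + (LINT x:?A|lebesgue. norm (Dv k x - G x)))" for k
  proof -
    have "\<bar>LINT x:circ \<rho>|hausdorff1. v k x - u x\<bar>
        \<le> K * ((LINT x:?A|lebesgue. \<bar>v k x - u x\<bar>) + (LINT x:?A|lebesgue. norm (Dv k x - G x)))"
      by (intro K(2) continuous_intros v u W11_gradient_diff open_annulus G)
    moreover have "(LINT x:circ \<rho>|hausdorff1. v k x - u x)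
        = (LINT x:circ \<rho>|hausdorff1. v k x) - (LINT x:circ \<rho>|hausdorff1. u x)"
      by (intro set_integral_diff(2) c vi ui)
    moreover have "\<bar>LINT x:circ \<rho>|hausdorff1. v k x - T x\<bar> \<le> (LINT x:frontier ?A|hausdorff1. \<bar>v k x - T x\<bar>)"
    proof -
      have d: "set_integrable hausdorff1 (frontier ?A) (\<lambda>x. v k x - T x)"
        by (intro set_integral_diff(1) vi Ti)
      have "norm (LINT x:circ \<rho>|hausdorff1. v k x - T x) \<le> (LINT x:circ \<rho>|hausdorff1. norm (v k x - T x))"
        by (rule set_integral_norm_bound[OF c[OF d]])
      also have "\<dots> \<le> (LINT x:frontier ?A|hausdorff1. \<bar>v k x - T x\<bar>)"
        using circle_integral_le_frontier[OF \<rho> d] by simp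
      finally show ?thesis by simp
    qed
    moreover have "(LINT x:circ \<rho>|hausdorff1. v k x - T x)
        = (LINT x:circ \<rho>|hausdorff1. v k x) - (LINT x:circ \<rho>|hausdorff1. T x)"
      by (intro set_integral_diff(2) c vi Ti)
    ultimately show ?thesis by linarith
  qed
  moreover have "(\<lambda>k. (LINT x:frontier ?A|hausdorff1. \<bar>v k x - T x\<bar>)
        + K * ((LINT x:?A|lebesgue. \<bar>v k x - u x\<bar>) + (LINT x:?A|lebesgue. norm (Dv k x - G x)))) \<longlonglongrightarrow> 0 + K * (0 + 0)"
    by (intro tendsto_intros lim)
  ultimately have "\<bar>(LINT x:circ \<rho>|hausdorff1. T x) - (LINT x:circ \<rho>|hausdorff1. u x)\<bar> \<le> 0 + K * (0 + 0)"
    by (intro LIMSEQ_le_const) auto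
  then show ?thesis by simp
qed

section \<open>Functions with zero gradient and zero outer trace\<close>

text \<open>The closed sets are an intersection stable generator of the Borel sets.\<close>

lemma integral_zero_on_closed_imp_AE_zero:
  fixes h :: "'a::euclidean_space \<Rightarrow> real"
  assumes h: "integrable lborel h" and closed: "\<And>F. closed F \<Longrightarrow> (LINT x:F|lborel. h x) = 0"
  shows "AE x in lborel. h x = 0"
proof (rule density_unique_real[OF h integrable_zero])
  have si: "set_integrable lborel A h" if "A \<in> sets borel" for A
    using integrable_mult_indicator[OF _ h, of A] that by (simp add: set_integrable_def)
  fix A :: "'a set" assume "A \<in> sets lborel"
  then have A: "A \<in> sigma_sets UNIV (Collect closed)" by (simp add: borel_eq_closed)
  have stable: "Int_stable (Collect (closed :: 'a set \<Rightarrow> bool))" by (auto simp: Int_stable_def)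
  have "Collect (closed :: 'a set \<Rightarrow> bool) \<subseteq> Pow UNIV" by simp
  from stable this A have "(LINT x:A|lborel. h x) = 0"
  proof (induction rule: sigma_sets_induct_disjoint)
    case (basic A)
    then show ?case using closed by simp
  next
    case empty
    then show ?case by (simp add: set_lebesgue_integral_def)
  next
    case (compl A)
    then have A: "A \<in> sets borel" by (simp add: borel_eq_closed)
    have "(LINT x:(A \<union> (UNIV - A))|lborel. h x) = (LINT x:A|lborel. h x) + (LINT x:(UNIV - A)|lborel. h x)"
      by (rule set_integral_Un) (use A in \<open>auto intro!: si\<close>)
    moreover have "A \<union> (UNIV - A) = UNIV" by auto
    ultimately show ?case using compl closed[of UNIV] by simp
  next
    case (union A)
    then have A: "A i \<in> sets borel" for i by (auto simp: borel_eq_closed)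
    have "(LINT x:(\<Union>i. A i)|lborel. h x) = (\<Sum>i. (LINT x:A i|lborel. h x))"
      by (rule lebesgue_integral_countable_add)
        (use union A in \<open>auto simp: disjoint_family_on_def intro!: si\<close>)
    then show ?case using union by simp
  qed
  then show "(LINT x:A|lborel. h x) = (LINT x:A|lborel. 0)" by (simp add: set_lebesgue_integral_def)
qed

text \<open>By the Stone-Weierstrass theorem all moments against continuous functions vanish; indicators of closed sets
are dominated limits of continuous functions of the distance.\<close>

lemma polynomial_moments_zero_imp_AE_zero:
  fixes h :: "'a::euclidean_space \<Rightarrow> real"
  assumes h: "integrable lebesgue h" and S: "compact S" "\<And>x. x \<notin> S \<Longrightarrow> h x = 0"
    and poly: "\<And>p. real_polynomial_function p \<Longrightarrow> (\<integral>x. h x * p x \<partial>lebesgue) = 0"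
  shows "AE x in lebesgue. h x = 0"
proof -
  have hm: "h \<in> borel_measurable lebesgue" using h by simp
  have prod: "integrable lebesgue (\<lambda>x. h x * f x)" if f: "continuous_on UNIV f" for f
  proof -
    have "bounded (f ` S)"
      by (intro compact_imp_bounded compact_continuous_image continuous_on_subset[OF f] S) auto
    then obtain B where B: "\<forall>y\<in>f ` S. norm y \<le> B" unfolding bounded_iff by blast
    have fm: "f \<in> borel_measurable lebesgue"
      using borel_measurable_continuous_onI[OF f] by (simp add: measurable_completion)
    show ?thesis
    proof (rule Bochner_Integration.integrable_bound[OF integrable_mult_left[OF integrable_norm[OF h], of B]])
      show "AE x in lebesgue. norm (h x * f x) \<le> norm (norm (h x) * B)"
      proof (rule AE_I2)
        fix x show "norm (h x * f x) \<le> norm (norm (h x) * B)"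
        proof (cases "x \<in> S")
          case True
          then have "norm (f x) \<le> \<bar>B\<bar>" using B by force
          then show ?thesis by (simp add: abs_mult mult_left_mono)
        qed (use S(2) in simp)
      qed
    qed (use hm fm in measurable)
  qed
  have cont: "(\<integral>x. h x * f x \<partial>lebesgue) = 0" if f: "continuous_on UNIV f" for f
  proof -
    define N where "N = (\<integral>x. norm (h x) \<partial>lebesgue)"
    have N: "0 \<le> N" unfolding N_def by (intro integral_nonneg_AE) simp
    have "\<bar>\<integral>x. h x * f x \<partial>lebesgue\<bar> \<le> 0 + e" if "0 < e" for e
    proof -
      have "0 < e / (N + 1)" using that N by simp
      then obtain p where p: "real_polynomial_function p" "\<And>x. x \<in> S \<Longrightarrow> \<bar>f x - p x\<bar> < e / (N + 1)"
        using Stone_Weierstrass_real_polynomial_function[OF S(1) continuous_on_subset[OF f]] by (metis subset_UNIV)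
      have pc: "continuous_on UNIV p"
        using p(1) continuous_on_polymonial_function real_polynomial_function_eq by blast
      have "(\<integral>x. h x * f x \<partial>lebesgue) = (\<integral>x. h x * f x \<partial>lebesgue) - (\<integral>x. h x * p x \<partial>lebesgue)"
        using poly[OF p(1)] by simp
      also have "\<dots> = (\<integral>x. h x * f x - h x * p x \<partial>lebesgue)"
        by (rule Bochner_Integration.integral_diff[symmetric]) (intro prod f pc)+
      also have "norm \<dots> \<le> (\<integral>x. norm (h x) * (e / (N + 1)) \<partial>lebesgue)"
      proof (rule Bochner_Integration.integral_norm_bound_integral)
        show "integrable lebesgue (\<lambda>x. h x * f x - h x * p x)"
          by (intro Bochner_Integration.integrable_diff prod f pc)
        show "integrable lebesgue (\<lambda>x. norm (h x) * (e / (N + 1)))" using h by simp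
        fix x
        show "norm (h x * f x - h x * p x) \<le> norm (h x) * (e / (N + 1))"
        proof (cases "x \<in> S")
          case True
          have "norm (h x * f x - h x * p x) = norm (h x) * \<bar>f x - p x\<bar>"
            by (simp add: right_diff_distrib[symmetric] abs_mult)
          also have "\<dots> \<le> norm (h x) * (e / (N + 1))"
            using p(2)[OF True] by (intro mult_left_mono) auto
          finally show ?thesis .
        qed (use S(2) in simp)
      qed
      also have "\<dots> = N * (e / (N + 1))" by (simp add: N_def)
      also have "\<dots> \<le> e" using N that by (simp add: field_simps)
      finally show ?thesis by simp
    qed
    then have "\<bar>\<integral>x. h x * f x \<partial>lebesgue\<bar> \<le> 0" by (rule field_le_epsilon)
    then show ?thesis by simp
  qed
  have closed: "(\<integral>x. indicator F x * h x \<partial>lebesgue) = 0" if F: "closed F" for F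
  proof (cases "F = {}")
    case False
    \<comment> \<open>continuous functions that decrease to the indicator of \<open>F\<close>\<close>
    define f where "f n x = max 0 (1 - real n * infdist x F)" for n x
    have fc: "continuous_on UNIV (f n)" for n
      unfolding f_def by (intro continuous_intros)
    have "(\<lambda>n. \<integral>x. h x * f n x \<partial>lebesgue) \<longlonglongrightarrow> (\<integral>x. indicator F x * h x \<partial>lebesgue)"
    proof (rule integral_dominated_convergence[where w="\<lambda>x. norm (h x)"])
      show "AE x in lebesgue. (\<lambda>n. h x * f n x) \<longlonglongrightarrow> indicator F x * h x"
      proof (rule AE_I2)
        fix x
        show "(\<lambda>n. h x * f n x) \<longlonglongrightarrow> indicator F x * h x"
        proof (cases "x \<in> F")
          case True
          then show ?thesis by (simp add: f_def)
        next
          case F': False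
          then have d: "0 < infdist x F" by (rule infdist_pos_not_in_closed[OF F False])
          obtain N :: nat where N: "1 / infdist x F < real N" using reals_Archimedean2 by blast
          have "h x * f n x = 0" if "N \<le> n" for n
          proof -
            have "1 / infdist x F < real n" using N that by linarith
            then have "1 < real n * infdist x F" using d by (simp add: field_simps)
            then show ?thesis by (simp add: f_def)
          qed
          then have "eventually (\<lambda>n. h x * f n x = 0) sequentially"
            using eventually_sequentially by blast
          then show ?thesis using F' by (simp add: tendsto_eventually)
        qed
      qed
      fix n show "AE x in lebesgue. norm (h x * f n x) \<le> norm (h x)"
      proof (rule AE_I2)
        fix x
        have "0 \<le> f n x" "f n x \<le> 1" using infdist_nonneg[of x F] by (auto simp: f_def)
        then show "norm (h x * f n x) \<le> norm (h x)" by (simp add: abs_mult mult_left_le)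
      qed
    next
      show "(\<lambda>x. indicator F x * h x) \<in> borel_measurable lebesgue"
        using hm F by (intro borel_measurable_times borel_measurable_indicator) (auto simp: sets_completionI_sets borel_closed)
    qed (use prod[OF fc] h in \<open>auto dest: borel_measurable_integrable\<close>)
    then have "(\<lambda>n. 0 :: real) \<longlonglongrightarrow> (\<integral>x. indicator F x * h x \<partial>lebesgue)" by (simp only: cont[OF fc])
    then show ?thesis using LIMSEQ_unique tendsto_const by blast
  qed simp
  obtain g where g: "g \<in> borel_measurable lborel" "AE x in lborel. h x = g x"
    using completion_ex_borel_measurable_real[OF hm] by blast
  have gl: "AE x in lebesgue. h x = g x" using g(2) by (rule AE_completion)
  have gm: "g \<in> borel_measurable lebesgue" using g(1) by (rule measurable_completion)
  have "integrable lebesgue g" using h integrable_cong_AE[OF hm gm gl] by simp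
  then have gi: "integrable lborel g" using integrable_completion[OF g(1)] by simp
  have "AE x in lborel. g x = 0"
  proof (rule integral_zero_on_closed_imp_AE_zero[OF gi])
    fix F :: "'a set" assume F: "closed F"
    then have Fm: "F \<in> sets borel" by simp
    have m: "(\<lambda>x. indicator F x * g x) \<in> borel_measurable lborel"
      using g(1) Fm by (intro borel_measurable_times borel_measurable_indicator) auto
    have "(LINT x:F|lborel. g x) = (\<integral>x. indicator F x * g x \<partial>lebesgue)"
      using integral_completion[OF m] by (simp add: set_lebesgue_integral_def)
    also have "\<dots> = (\<integral>x. indicator F x * h x \<partial>lebesgue)"
    proof (rule integral_cong_AE)
      show "AE x in lebesgue. indicator F x * g x = indicator F x * h x" using gl by eventually_elim simp
      show "(\<lambda>x. indicator F x * g x) \<in> borel_measurable lebesgue" using m by (rule measurable_completion)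
      show "(\<lambda>x. indicator F x * h x) \<in> borel_measurable lebesgue"
        using hm Fm by (intro borel_measurable_times borel_measurable_indicator) (auto simp: sets_completionI_sets)
    qed
    finally show "(LINT x:F|lborel. g x) = 0" using closed[OF F] by simp
  qed
  then have "AE x in lebesgue. g x = 0" by (rule AE_completion)
  then show ?thesis using gl by eventually_elim simp
qed

text \<open>With \<open>angular_linear\<close> this splits a linear function into \<open>((x \<bullet> v) / |x|) * sqrt (|x|\<^sup>2)\<close>, an angular
factor times a radial one.\<close>

lemma profile_times_sqrt: "profile a b k \<Longrightarrow> profile a b (\<lambda>s. sqrt s * k s)"
  unfolding profile_def
proof (elim conjE exE, intro conjI)
  assume "continuous_on UNIV k"
  then show "continuous_on UNIV (\<lambda>s. sqrt s * k s)" by (intro continuous_intros)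
qed auto

text \<open>Induction on the polynomial, with the accumulated factor \<open>r\<close> in the hypothesis: for a product \<open>p1 * p2\<close>
the factor \<open>p1\<close> moves into \<open>r\<close> before \<open>p2\<close> is treated. A linear polynomial is absorbed by \<open>Q\<close> and \<open>k\<close>.\<close>

lemma radial_angular_moments_polynomial:
  fixes w :: "real^2 \<Rightarrow> real"
  assumes \<rho>: "0 < \<rho>1" "\<rho>1 < \<rho>2" and w: "w absolutely_integrable_on annulus \<rho>1 \<rho>2"
    and p: "real_polynomial_function p" and r: "continuous_on UNIV r"
    and hyp: "\<And>Q DQ k. angular Q DQ \<Longrightarrow> profile (\<rho>1\<^sup>2) (\<rho>2\<^sup>2) k \<Longrightarrow>
      (LINT x:annulus \<rho>1 \<rho>2|lebesgue. w x * (r x * (Q x * k (x \<bullet> x)))) = 0"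
    and Q: "angular Q DQ" and k: "profile (\<rho>1\<^sup>2) (\<rho>2\<^sup>2) k"
  shows "(LINT x:annulus \<rho>1 \<rho>2|lebesgue. w x * (r x * p x * (Q x * k (x \<bullet> x)))) = 0"
  using p r hyp Q k
proof (induction p arbitrary: r Q DQ k rule: real_polynomial_function.induct)
  case (linear f)
  define v where "v = adjoint f 1"
  have f: "f x = x \<bullet> v" for x
    using adjoint_works[OF bounded_linear.linear[OF linear.hyps], of x 1] by (simp add: v_def)
  have "(LINT x:annulus \<rho>1 \<rho>2|lebesgue. w x * (r x * f x * (Q x * k (x \<bullet> x))))
      = (LINT x:annulus \<rho>1 \<rho>2|lebesgue. w x * (r x * ((Q x * ((x \<bullet> v) / norm x)) * (sqrt (x \<bullet> x) * k (x \<bullet> x)))))"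
  proof (rule set_lebesgue_integral_cong)
    show "\<forall>x. x \<in> annulus \<rho>1 \<rho>2 \<longrightarrow> w x * (r x * f x * (Q x * k (x \<bullet> x)))
        = w x * (r x * ((Q x * ((x \<bullet> v) / norm x)) * (sqrt (x \<bullet> x) * k (x \<bullet> x))))"
    proof (intro allI impI)
      fix x assume "x \<in> annulus \<rho>1 \<rho>2"
      then have "norm x \<noteq> 0" using annulus_nonzero \<rho> by auto
      then show "w x * (r x * f x * (Q x * k (x \<bullet> x)))
        = w x * (r x * ((Q x * ((x \<bullet> v) / norm x)) * (sqrt (x \<bullet> x) * k (x \<bullet> x))))"
        by (simp add: f norm_eq_sqrt_inner[symmetric])
    qed
  qed simp
  also have "\<dots> = 0"
    by (rule linear.prems(2)[OF angular_mult[OF linear.prems(3) angular_linear] profile_times_sqrt[OF linear.prems(4)]])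
  finally show ?case .
next
  case (const c)
  have "(LINT x:annulus \<rho>1 \<rho>2|lebesgue. w x * (r x * c * (Q x * k (x \<bullet> x))))
      = (LINT x:annulus \<rho>1 \<rho>2|lebesgue. c * (w x * (r x * (Q x * k (x \<bullet> x)))))"
    by (simp add: mult_ac)
  then show ?case using const.prems(2)[OF const.prems(3,4)] by simp
next
  case (add p1 p2)
  have cp: "continuous_on UNIV p1" "continuous_on UNIV p2"
    using add.hyps continuous_on_polymonial_function real_polynomial_function_eq by blast+
  have i: "(\<lambda>x. w x * (r x * q x * (Q x * k (x \<bullet> x)))) absolutely_integrable_on annulus \<rho>1 \<rho>2"
    if "continuous_on UNIV q" for q
    by (intro cont_bounded_integrable_annulus[OF \<rho>(1) _ w] continuous_intros
        profile_continuous_radial[OF add.prems(4)] angular_continuous[OF add.prems(3)]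
        continuous_on_subset[OF that] continuous_on_subset[OF add.prems(1)]) auto
  have "(LINT x:annulus \<rho>1 \<rho>2|lebesgue. w x * (r x * (p1 x + p2 x) * (Q x * k (x \<bullet> x))))
      = (LINT x:annulus \<rho>1 \<rho>2|lebesgue. w x * (r x * p1 x * (Q x * k (x \<bullet> x))) + w x * (r x * p2 x * (Q x * k (x \<bullet> x))))"
    by (simp add: algebra_simps)
  also have "\<dots> = 0"
    using set_integral_add(2)[OF i[OF cp(1)] i[OF cp(2)]]
      add.IH(1)[OF add.prems(1,2,3,4)] add.IH(2)[OF add.prems(1,2,3,4)] by simp
  finally show ?case .
next
  case (mult p1 p2)
  have cp: "continuous_on UNIV (\<lambda>x. r x * p1 x)"
    using mult.hyps mult.prems(1) continuous_on_polymonial_function real_polynomial_function_eq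
    by (intro continuous_intros) blast+
  have "(LINT x:annulus \<rho>1 \<rho>2|lebesgue. w x * ((r x * p1 x) * p2 x * (Q x * k (x \<bullet> x)))) = 0"
  proof (rule mult.IH(2)[OF cp _ mult.prems(3,4)])
    fix Q' DQ' k' assume a: "angular Q' DQ'" "profile (\<rho>1\<^sup>2) (\<rho>2\<^sup>2) k'"
    show "(LINT x:annulus \<rho>1 \<rho>2|lebesgue. w x * ((r x * p1 x) * (Q' x * k' (x \<bullet> x)))) = 0"
      by (rule mult.IH(1)[OF mult.prems(1) _ a]) (rule mult.prems(2))
  qed
  then show ?case by (simp add: mult.assoc)
qed

text \<open>For each profile \<open>k\<close> the function \<open>w(x) k(|x|\<^sup>2)\<close> has vanishing polynomial moments. Countably many
profiles exhaust the annulus.\<close>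

lemma radial_angular_moments_zero_imp_AE_zero:
  fixes w :: "real^2 \<Rightarrow> real"
  assumes \<rho>: "0 < \<rho>1" "\<rho>1 < \<rho>2" and w: "w absolutely_integrable_on annulus \<rho>1 \<rho>2"
    and hyp: "\<And>Q DQ k. angular Q DQ \<Longrightarrow> profile (\<rho>1\<^sup>2) (\<rho>2\<^sup>2) k \<Longrightarrow>
      (LINT x:annulus \<rho>1 \<rho>2|lebesgue. w x * (Q x * k (x \<bullet> x))) = 0"
  shows "AE x in lebesgue. x \<in> annulus \<rho>1 \<rho>2 \<longrightarrow> w x = 0"
proof -
  let ?A = "annulus \<rho>1 \<rho>2" and ?a = "\<rho>1\<^sup>2" and ?b = "\<rho>2\<^sup>2"
  have ab: "?a < ?b" using \<rho> by (simp add: power_strict_mono)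
  have zero: "AE x in lebesgue. x \<in> ?A \<longrightarrow> w x * k (x \<bullet> x) = 0" if k: "profile ?a ?b k" for k
  proof -
    define h where "h x = indicator ?A x * (w x * k (x \<bullet> x))" for x
    have i: "(\<lambda>x. w x * k (x \<bullet> x)) absolutely_integrable_on ?A"
      using absolutely_integrable_times_radial[OF \<rho>(1) w k continuous_on_const[of _ 1]] by simp
    have "AE x in lebesgue. h x = 0"
    proof (rule polynomial_moments_zero_imp_AE_zero)
      show "integrable lebesgue h" using i by (simp add: set_integrable_def h_def[abs_def])
      show "compact (closure ?A)" by (rule compact_closure_annulus)
      show "h x = 0" if "x \<notin> closure ?A" for x
      proof -
        have "x \<notin> ?A" using that closure_subset by blast
        then show ?thesis by (simp add: h_def)
      qed
      fix p :: "real^2 \<Rightarrow> real" assume p: "real_polynomial_function p"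
      have "(LINT x:?A|lebesgue. w x * (1 * p x * (1 * k (x \<bullet> x)))) = 0"
        by (rule radial_angular_moments_polynomial[OF \<rho> w p continuous_on_const _ angular_const k])
          (simp add: hyp)
      then show "(\<integral>x. h x * p x \<partial>lebesgue) = 0"
        by (simp add: set_lebesgue_integral_def h_def mult_ac)
    qed
    then show ?thesis by eventually_elim (auto simp: h_def)
  qed
  have "\<exists>k. profile ?a ?b k \<and> (\<forall>s\<in>{?a + (?b - ?a) / real (n + 3)<..<?b - (?b - ?a) / real (n + 3)}. 0 < k s)" for n
  proof -
    define e where "e = (?b - ?a) / real (n + 3)"
    have "0 < e" using ab by (simp add: e_def)
    then have "3 * e \<le> real (n + 3) * e" by (intro mult_right_mono) auto
    also have "\<dots> = ?b - ?a" by (simp add: e_def)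
    finally have e: "?a < ?a + e" "?a + e < ?b - e" "?b - e < ?b" using \<open>0 < e\<close> by auto
    obtain k :: "real \<Rightarrow> real" where k: "continuous_on UNIV k" "\<And>s. s \<notin> {?a + e..?b - e} \<Longrightarrow> k s = 0"
      "\<And>s. s \<in> {?a + e<..<?b - e} \<Longrightarrow> 0 < k s"
      using bump_exists[OF less_imp_le[OF e(1)] e(2) less_imp_le[OF e(3)]] by blast
    have "profile ?a ?b k" using k e unfolding profile_def by blast
    then show ?thesis using k(3) unfolding e_def[symmetric] by blast
  qed
  then obtain K where K: "\<And>n. profile ?a ?b (K n)"
    "\<And>n s. s \<in> {?a + (?b - ?a) / real (n + 3)<..<?b - (?b - ?a) / real (n + 3)} \<Longrightarrow> 0 < K n s"
    by metis
  have "AE x in lebesgue. \<forall>n. x \<in> ?A \<longrightarrow> w x * K n (x \<bullet> x) = 0"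
    unfolding AE_all_countable using zero[OF K(1)] by blast
  then show ?thesis
  proof eventually_elim
    case (elim x)
    show ?case
    proof
      assume x: "x \<in> ?A"
      then have nx: "\<rho>1 < norm x" "norm x < \<rho>2" by (auto simp: annulus_def)
      have "?a < (norm x)\<^sup>2" "(norm x)\<^sup>2 < ?b"
        using nx \<rho> by (auto intro!: power_strict_mono)
      then have s: "?a < x \<bullet> x" "x \<bullet> x < ?b" by (simp_all add: power2_norm_eq_inner)
      define d where "d = min (x \<bullet> x - ?a) (?b - x \<bullet> x)"
      have "0 < d" using s by (simp add: d_def)
      obtain n :: nat where n: "(?b - ?a) / d < real n" using reals_Archimedean2 by blast
      then have "(?b - ?a) / d < real (n + 3)" by simp
      then have "(?b - ?a) / real (n + 3) < d" using \<open>0 < d\<close> by (simp add: field_simps)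
      then have "0 < K n (x \<bullet> x)" by (intro K(2)) (auto simp: d_def)
      then show "w x = 0" using elim x by auto
    qed
  qed
qed

lemma set_integral_mult_bound:
  fixes f :: "real^2 \<Rightarrow> real"
  assumes f: "f absolutely_integrable_on annulus \<rho>1 \<rho>2"
    and fP: "(\<lambda>x. f x * P x) absolutely_integrable_on annulus \<rho>1 \<rho>2"
    and P: "\<And>x. x \<in> annulus \<rho>1 \<rho>2 \<Longrightarrow> \<bar>P x\<bar> \<le> B"
  shows "\<bar>LINT x:annulus \<rho>1 \<rho>2|lebesgue. f x * P x\<bar> \<le> B * (LINT x:annulus \<rho>1 \<rho>2|lebesgue. \<bar>f x\<bar>)"
proof -
  have "norm (LINT x:annulus \<rho>1 \<rho>2|lebesgue. f x * P x) \<le> (LINT x:annulus \<rho>1 \<rho>2|lebesgue. norm (f x * P x))"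
    by (rule set_integral_norm_bound[OF fP])
  also have "\<dots> \<le> (LINT x:annulus \<rho>1 \<rho>2|lebesgue. B * \<bar>f x\<bar>)"
  proof (rule set_integral_mono[OF set_integrable_norm[OF fP] set_integrable_mult_right])
    fix x assume "x \<in> annulus \<rho>1 \<rho>2"
    then show "norm (f x * P x) \<le> B * \<bar>f x\<bar>"
      using mult_right_mono[OF P, of x "\<bar>f x\<bar>"] by (simp add: abs_mult mult.commute)
  qed (use set_integrable_abs[OF f] in blast)
  finally show ?thesis by simp
qed

text \<open>To obtain a profile with mean zero, \<open>radial_weak_bound\<close> is applied to \<open>l = k - I * t\<close>, where \<open>I\<close> is
the integral of \<open>k\<close> and \<open>t\<close> is a bump of integral 1 at the outer circle. The moment of \<open>w\<close> against \<open>Q l\<close> is 0. The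
moment against \<open>Q t\<close> is estimated for the continuous functions \<open>v j\<close> that approximate the trace: by
\<open>shell_average\<close> it is controlled by the circle integral of \<open>\<bar>v j\<bar>\<close>, which tends to 0 because the trace is 0
there. The differences between \<open>v j\<close> and \<open>w\<close> tend to 0 because \<open>v j\<close> converges to \<open>w\<close> in \<open>W\<^sup>1\<^sup>,\<^sup>1\<close>.\<close>

lemma zero_trace_moments_zero:
  assumes \<rho>: "0 < \<rho>1" "\<rho>1 < \<rho>2"
    and w: "W11_gradient (annulus \<rho>1 \<rho>2) w G0" "(LINT x:annulus \<rho>1 \<rho>2|lebesgue. norm (G0 x)) = 0"
    and T: "has_trace (annulus \<rho>1 \<rho>2) w T" "AE x in hausdorff1. norm x = \<rho>2 \<longrightarrow> T x = 0"
    and Q: "angular Q DQ" and k: "profile (\<rho>1\<^sup>2) (\<rho>2\<^sup>2) k"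
  shows "(LINT x:annulus \<rho>1 \<rho>2|lebesgue. w x * (Q x * k (x \<bullet> x))) = 0"
proof -
  let ?A = "annulus \<rho>1 \<rho>2" and ?a = "\<rho>1\<^sup>2" and ?b = "\<rho>2\<^sup>2"
  have \<rho>2: "\<rho>2 \<in> {\<rho>1, \<rho>2}" by simp
  from T obtain G v Dv where Ti: "set_integrable hausdorff1 (frontier ?A) T"
    and G: "W11_gradient ?A w G" and v: "\<And>k::nat. continuous_on (closure ?A) (v k)" "\<And>k. W11_gradient ?A (v k) (Dv k)"
    and lim: "(\<lambda>k. LINT x:?A|lebesgue. \<bar>v k x - w x\<bar>) \<longlonglongrightarrow> 0"
      "(\<lambda>k. LINT x:?A|lebesgue. norm (Dv k x - G x)) \<longlonglongrightarrow> 0"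
      "(\<lambda>k. LINT x:frontier ?A|hausdorff1. \<bar>v k x - T x\<bar>) \<longlonglongrightarrow> 0"
    unfolding has_trace_def by blast
  obtain C where C: "0 < C" and C': "\<forall>k. profile ?a ?b k \<longrightarrow> (LINT x:?A|lebesgue. k (x \<bullet> x)) = C * integral {?a..?b} k"
    using profile_shell_integral[OF \<rho>] by blast
  obtain M where M: "0 \<le> M" "\<And>s. \<bar>k s\<bar> \<le> M" using profile_bounded[OF k] by metis
  obtain CQ where CQ: "0 \<le> CQ" "\<And>x. x \<in> ?A \<Longrightarrow> \<bar>Q x\<bar> \<le> CQ" using angular_bounded[OF \<rho>(1) Q] by metis
  define H where "H = circ_length \<rho>2"
  have "0 < H" unfolding H_def using circ_length_pos \<rho> by auto
  define I where "I = integral {?a..?b} k"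
  define D where "D = integral {?a..?b} (\<lambda>s. \<bar>k s\<bar>) + \<bar>- I\<bar>"
  define m where "m = (LINT x:?A|lebesgue. w x * (Q x * k (x \<bullet> x)))"
  \<comment> \<open>the three quantities that tend to 0 by the definition of the trace\<close>
  define e where "e j = (LINT x:?A|lebesgue. \<bar>v j x - w x\<bar>)" for j
  define d where "d j = (LINT x:?A|lebesgue. norm (Dv j x - G x))" for j
  define f where "f j = (LINT x:frontier ?A|hausdorff1. \<bar>v j x - T x\<bar>)" for j
  have Qc: "continuous_on (- {0}) Q" by (rule angular_continuous[OF Q])
  have wi: "w absolutely_integrable_on ?A" using w by (simp add: W11_gradient_def)
  have vi: "v j absolutely_integrable_on ?A" for j by (rule continuous_absolutely_integrable_annulus[OF v(1)])
  have dwi: "(\<lambda>x. v j x - w x) absolutely_integrable_on ?A" for j by (rule set_integral_diff(1)[OF vi wi])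
  have int: "(\<lambda>x. g x * (Q x * l (x \<bullet> x))) absolutely_integrable_on ?A"
    if "g absolutely_integrable_on ?A" "profile ?a ?b l" for g l
    by (rule absolutely_integrable_times_radial[OF \<rho>(1) that Qc])
  have diff: "(LINT x:?A|lebesgue. v j x * (Q x * l (x \<bullet> x))) - (LINT x:?A|lebesgue. w x * (Q x * l (x \<bullet> x)))
      = (LINT x:?A|lebesgue. (v j x - w x) * (Q x * l (x \<bullet> x)))" if l: "profile ?a ?b l" for j l
    using set_integral_diff(2)[OF int[OF vi l] int[OF wi l]] by (simp add: left_diff_distrib)
  have circ_v: "(LINT x:circ \<rho>2|hausdorff1. \<bar>v j x\<bar>) \<le> f j" for j
  proof -
    have dT: "set_integrable hausdorff1 (frontier ?A) (\<lambda>x. v j x - T x)"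
      by (intro set_integral_diff(1) continuous_integrable_frontier[OF \<rho> v(1)] Ti)
    have vf: "set_integrable hausdorff1 (frontier ?A) (v j)" by (rule continuous_integrable_frontier[OF \<rho> v(1)])
    have "(LINT x:circ \<rho>2|hausdorff1. \<bar>v j x\<bar>) = (LINT x:circ \<rho>2|hausdorff1. \<bar>v j x - T x\<bar>)"
      unfolding set_lebesgue_integral_def
    proof (rule integral_cong_AE)
      show "(\<lambda>x. indicator (circ \<rho>2) x *\<^sub>R \<bar>v j x\<bar>) \<in> borel_measurable hausdorff1"
        using set_integrable_abs[OF set_integrable_circ[OF \<rho> \<rho>2 vf]]
        unfolding set_integrable_def by (rule borel_measurable_integrable)
      show "(\<lambda>x. indicator (circ \<rho>2) x *\<^sub>R \<bar>v j x - T x\<bar>) \<in> borel_measurable hausdorff1"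
        using set_integrable_abs[OF set_integrable_circ[OF \<rho> \<rho>2 dT]]
        unfolding set_integrable_def by (rule borel_measurable_integrable)
      show "AE x in hausdorff1. indicator (circ \<rho>2) x *\<^sub>R \<bar>v j x\<bar> = indicator (circ \<rho>2) x *\<^sub>R \<bar>v j x - T x\<bar>"
        using T(2) by eventually_elim (auto simp: circ_def indicator_def)
    qed
    also have "\<dots> \<le> f j" unfolding f_def by (rule circle_integral_le_frontier[OF \<rho> \<rho>2 dT])
    finally show ?thesis .
  qed
  have est: "\<bar>m\<bar> \<le> CQ * M * e j + D * CQ / \<rho>1 * d j + \<bar>I\<bar> * (CQ * ((C * f j + 1 / real (Suc j)) / H))" for j
  proof -
    have "continuous_on (closure ?A) (\<lambda>x. \<bar>v j x\<bar>)" by (intro continuous_intros v(1))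
    from shell_average[OF \<rho> \<rho>2 this C C'[rule_format], of "1 / real (Suc j)"]
    have "\<exists>t. profile ?a ?b t \<and> (\<forall>s. 0 \<le> t s) \<and> integral {?a..?b} t = 1 \<and>
      \<bar>H * (LINT x:?A|lebesgue. \<bar>v j x\<bar> * t (x \<bullet> x)) - C * (LINT x:circ \<rho>2|hausdorff1. \<bar>v j x\<bar>)\<bar> \<le> 1 / real (Suc j)"
      by (simp add: H_def)
    then obtain t where t: "profile ?a ?b t" "\<And>s. 0 \<le> t s" "integral {?a..?b} t = 1"
      "\<bar>H * (LINT x:?A|lebesgue. \<bar>v j x\<bar> * t (x \<bullet> x)) - C * (LINT x:circ \<rho>2|hausdorff1. \<bar>v j x\<bar>)\<bar> \<le> 1 / real (Suc j)"
      by blast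
    define l where "l s = k s + (- I) * t s" for s
    have l: "profile ?a ?b l" unfolding l_def by (rule profile_lincomb[OF k t(1)])
    have "integral {?a..?b} l = integral {?a..?b} k + integral {?a..?b} (\<lambda>s. (- I) * t s)"
      unfolding l_def
      by (intro Henstock_Kurzweil_Integration.integral_add integrable_on_mult_right profile_integrable[OF k] profile_integrable[OF t(1)])
    then have l0: "integral {?a..?b} l = 0" using t(3) by (simp add: I_def)
    have lD: "integral {?a..?b} (\<lambda>s. \<bar>l s\<bar>) \<le> D"
      unfolding l_def D_def by (rule integral_abs_lincomb_le[OF t(1-3) k])
    have wl: "(LINT x:?A|lebesgue. w x * (Q x * l (x \<bullet> x))) = 0"
      using radial_weak_bound[OF \<rho> w(1) Q CQ(2) l l0 lD] w(2) by simp
    have "\<bar>LINT x:?A|lebesgue. (v j x - w x) * (Q x * l (x \<bullet> x))\<bar> \<le> D * CQ / \<rho>1 * d j"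
      unfolding d_def
      by (rule radial_weak_bound[OF \<rho> W11_gradient_diff[OF open_annulus v(2) G] Q CQ(2) l l0 lD])
    then have vl: "\<bar>LINT x:?A|lebesgue. v j x * (Q x * l (x \<bullet> x))\<bar> \<le> D * CQ / \<rho>1 * d j"
      using diff[OF l, of j] wl by simp
    have vk: "(LINT x:?A|lebesgue. v j x * (Q x * k (x \<bullet> x)))
        = (LINT x:?A|lebesgue. v j x * (Q x * l (x \<bullet> x))) + I * (LINT x:?A|lebesgue. v j x * (Q x * t (x \<bullet> x)))"
    proof -
      have "(LINT x:?A|lebesgue. v j x * (Q x * l (x \<bullet> x))) + (LINT x:?A|lebesgue. I * (v j x * (Q x * t (x \<bullet> x))))
          = (LINT x:?A|lebesgue. v j x * (Q x * l (x \<bullet> x)) + I * (v j x * (Q x * t (x \<bullet> x))))"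
        by (rule set_integral_add(2)[symmetric, OF int[OF vi l] set_integrable_mult_right]) (rule int[OF vi t(1)])
      also have "\<dots> = (LINT x:?A|lebesgue. v j x * (Q x * k (x \<bullet> x)))"
        by (simp add: l_def algebra_simps)
      finally show ?thesis by simp
    qed
    have vti: "(\<lambda>x. v j x * t (x \<bullet> x)) absolutely_integrable_on ?A"
      using absolutely_integrable_times_radial[OF \<rho>(1) vi t(1) continuous_on_const[of _ 1]] by simp
    have "\<bar>LINT x:?A|lebesgue. (v j x * t (x \<bullet> x)) * Q x\<bar> \<le> CQ * (LINT x:?A|lebesgue. \<bar>v j x * t (x \<bullet> x)\<bar>)"
      by (rule set_integral_mult_bound[OF vti cont_bounded_integrable_annulus[OF \<rho>(1) Qc vti] CQ(2)])
    also have "(LINT x:?A|lebesgue. (v j x * t (x \<bullet> x)) * Q x) = (LINT x:?A|lebesgue. v j x * (Q x * t (x \<bullet> x)))"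
      by (simp add: mult_ac)
    also have "(LINT x:?A|lebesgue. \<bar>v j x * t (x \<bullet> x)\<bar>) = (LINT x:?A|lebesgue. \<bar>v j x\<bar> * t (x \<bullet> x))"
      using t(2) by (simp add: abs_mult)
    finally have vt: "\<bar>LINT x:?A|lebesgue. v j x * (Q x * t (x \<bullet> x))\<bar> \<le> CQ * (LINT x:?A|lebesgue. \<bar>v j x\<bar> * t (x \<bullet> x))" .
    have "C * (LINT x:circ \<rho>2|hausdorff1. \<bar>v j x\<bar>) \<le> C * f j" using circ_v C by (intro mult_left_mono) auto
    then have "H * (LINT x:?A|lebesgue. \<bar>v j x\<bar> * t (x \<bullet> x)) \<le> C * f j + 1 / real (Suc j)" using t(4) by linarith
    then have "(LINT x:?A|lebesgue. \<bar>v j x\<bar> * t (x \<bullet> x)) \<le> (C * f j + 1 / real (Suc j)) / H"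
      using \<open>0 < H\<close> by (simp add: pos_le_divide_eq mult.commute)
    then have "CQ * (LINT x:?A|lebesgue. \<bar>v j x\<bar> * t (x \<bullet> x)) \<le> CQ * ((C * f j + 1 / real (Suc j)) / H)"
      using CQ(1) by (rule mult_left_mono)
    with vt have "\<bar>LINT x:?A|lebesgue. v j x * (Q x * t (x \<bullet> x))\<bar> \<le> CQ * ((C * f j + 1 / real (Suc j)) / H)" by linarith
    then have vt': "\<bar>I * (LINT x:?A|lebesgue. v j x * (Q x * t (x \<bullet> x)))\<bar> \<le> \<bar>I\<bar> * (CQ * ((C * f j + 1 / real (Suc j)) / H))"
      unfolding abs_mult by (rule mult_left_mono) simp
    have "\<bar>LINT x:?A|lebesgue. (v j x - w x) * (Q x * k (x \<bullet> x))\<bar> \<le> CQ * M * e j"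
      unfolding e_def
    proof (rule set_integral_mult_bound[OF dwi int[OF dwi k]])
      fix x assume "x \<in> ?A"
      then show "\<bar>Q x * k (x \<bullet> x)\<bar> \<le> CQ * M"
        unfolding abs_mult using CQ M by (intro mult_mono) auto
    qed
    then have "\<bar>(LINT x:?A|lebesgue. v j x * (Q x * k (x \<bullet> x))) - m\<bar> \<le> CQ * M * e j"
      using diff[OF k, of j] by (simp add: m_def)
    then show ?thesis using vk vl vt' by linarith
  qed
  have "(\<lambda>j. CQ * M * e j + D * CQ / \<rho>1 * d j + \<bar>I\<bar> * (CQ * ((C * f j + 1 / real (Suc j)) / H)))
      \<longlonglongrightarrow> CQ * M * 0 + D * CQ / \<rho>1 * 0 + \<bar>I\<bar> * (CQ * ((C * 0 + 0) / H))"
    unfolding e_def d_def f_def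
    by (intro tendsto_intros lim LIMSEQ_Suc[OF lim_inverse_n', simplified]) (use \<open>0 < H\<close> LIMSEQ_Suc[OF lim_inverse_n'] in auto)
  then have "\<bar>m\<bar> \<le> CQ * M * 0 + D * CQ / \<rho>1 * 0 + \<bar>I\<bar> * (CQ * ((C * 0 + 0) / H))"
    by (rule LIMSEQ_le_const) (use est in blast)
  then show ?thesis by (simp add: m_def)
qed

lemma zero_gradient_zero_trace_imp_AE_zero:
  assumes "0 < \<rho>1" "\<rho>1 < \<rho>2"
    and "W11_gradient (annulus \<rho>1 \<rho>2) w G0" "(LINT x:annulus \<rho>1 \<rho>2|lebesgue. norm (G0 x)) = 0"
    and "has_trace (annulus \<rho>1 \<rho>2) w T" "AE x in hausdorff1. norm x = \<rho>2 \<longrightarrow> T x = 0"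
  shows "AE x in lebesgue. x \<in> annulus \<rho>1 \<rho>2 \<longrightarrow> w x = 0"
proof (rule radial_angular_moments_zero_imp_AE_zero[OF assms(1,2)])
  show "w absolutely_integrable_on annulus \<rho>1 \<rho>2" using assms(3) by (simp add: W11_gradient_def)
qed (rule zero_trace_moments_zero[OF assms])

section \<open>Linear combinations of competitors\<close>

lemma L1_tendsto_zero_lincomb:
  fixes f h :: "nat \<Rightarrow> 'a \<Rightarrow> 'b::{banach, second_countable_topology}"
  assumes f: "\<And>k. set_integrable M A (f k)" and h: "\<And>k. set_integrable M A (h k)"
    and lim: "(\<lambda>k. LINT x:A|M. norm (f k x)) \<longlonglongrightarrow> 0" "(\<lambda>k. LINT x:A|M. norm (h k x)) \<longlonglongrightarrow> 0"
  shows "(\<lambda>k. LINT x:A|M. norm (a *\<^sub>R f k x + b *\<^sub>R h k x)) \<longlonglongrightarrow> 0"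
proof (rule real_tendsto_sandwich[OF always_eventually always_eventually])
  have i: "set_integrable M A (\<lambda>x. \<bar>a\<bar> * norm (f k x))" "set_integrable M A (\<lambda>x. \<bar>b\<bar> * norm (h k x))" for k
    using set_integrable_norm[OF f] set_integrable_norm[OF h] by auto
  show "\<forall>k. (LINT x:A|M. norm (a *\<^sub>R f k x + b *\<^sub>R h k x))
      \<le> \<bar>a\<bar> * (LINT x:A|M. norm (f k x)) + \<bar>b\<bar> * (LINT x:A|M. norm (h k x))"
  proof
    fix k
    have "set_integrable M A (\<lambda>x. a *\<^sub>R f k x + b *\<^sub>R h k x)"
      using f h by (intro set_integral_add(1)) auto
    from set_integrable_norm[OF this] have "(LINT x:A|M. norm (a *\<^sub>R f k x + b *\<^sub>R h k x))
        \<le> (LINT x:A|M. \<bar>a\<bar> * norm (f k x) + \<bar>b\<bar> * norm (h k x))"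
      by (rule set_integral_mono[OF _ set_integral_add(1)[OF i]])
        (auto intro: order_trans[OF norm_triangle_ineq])
    also have "\<dots> = (LINT x:A|M. \<bar>a\<bar> * norm (f k x)) + (LINT x:A|M. \<bar>b\<bar> * norm (h k x))"
      by (rule set_integral_add(2)[OF i])
    finally show "(LINT x:A|M. norm (a *\<^sub>R f k x + b *\<^sub>R h k x))
      \<le> \<bar>a\<bar> * (LINT x:A|M. norm (f k x)) + \<bar>b\<bar> * (LINT x:A|M. norm (h k x))" by simp
  qed
  show "\<forall>k. 0 \<le> (LINT x:A|M. norm (a *\<^sub>R f k x + b *\<^sub>R h k x))"
    unfolding set_lebesgue_integral_def by (intro allI integral_nonneg_AE) simp
  have "(\<lambda>k. \<bar>a\<bar> * (LINT x:A|M. norm (f k x)) + \<bar>b\<bar> * (LINT x:A|M. norm (h k x))) \<longlonglongrightarrow> \<bar>a\<bar> * 0 + \<bar>b\<bar> * 0"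
    by (intro tendsto_intros lim)
  then show "(\<lambda>k. \<bar>a\<bar> * (LINT x:A|M. norm (f k x)) + \<bar>b\<bar> * (LINT x:A|M. norm (h k x))) \<longlonglongrightarrow> 0" by simp
qed simp

lemma has_trace_linear:
  assumes \<rho>: "0 < \<rho>1" "\<rho>1 < \<rho>2"
    and w: "has_trace (annulus \<rho>1 \<rho>2) w T" and w': "has_trace (annulus \<rho>1 \<rho>2) w' T'"
  shows "has_trace (annulus \<rho>1 \<rho>2) (\<lambda>x. a * w x + b * w' x) (\<lambda>x. a * T x + b * T' x)"
proof -
  let ?A = "annulus \<rho>1 \<rho>2"
  from w obtain G v Dv where T: "set_integrable hausdorff1 (frontier ?A) T"
    and G: "W11_gradient ?A w G" and v: "\<And>k::nat. continuous_on (closure ?A) (v k)" "\<And>k. W11_gradient ?A (v k) (Dv k)"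
    and lim: "(\<lambda>k. LINT x:?A|lebesgue. \<bar>v k x - w x\<bar>) \<longlonglongrightarrow> 0"
      "(\<lambda>k. LINT x:?A|lebesgue. norm (Dv k x - G x)) \<longlonglongrightarrow> 0"
      "(\<lambda>k. LINT x:frontier ?A|hausdorff1. \<bar>v k x - T x\<bar>) \<longlonglongrightarrow> 0"
    unfolding has_trace_def by blast
  from w' obtain G' v' Dv' where T': "set_integrable hausdorff1 (frontier ?A) T'"
    and G': "W11_gradient ?A w' G'" and v': "\<And>k::nat. continuous_on (closure ?A) (v' k)" "\<And>k. W11_gradient ?A (v' k) (Dv' k)"
    and lim': "(\<lambda>k. LINT x:?A|lebesgue. \<bar>v' k x - w' x\<bar>) \<longlonglongrightarrow> 0"
      "(\<lambda>k. LINT x:?A|lebesgue. norm (Dv' k x - G' x)) \<longlonglongrightarrow> 0"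
      "(\<lambda>k. LINT x:frontier ?A|hausdorff1. \<bar>v' k x - T' x\<bar>) \<longlonglongrightarrow> 0"
    unfolding has_trace_def by blast
  show ?thesis unfolding has_trace_def
  proof (intro conjI exI allI)
    show "set_integrable hausdorff1 (frontier ?A) (\<lambda>x. a * T x + b * T' x)"
      using T T' by (intro set_integral_add(1)) auto
    show "W11_gradient ?A (\<lambda>x. a * w x + b * w' x) (\<lambda>x. a *\<^sub>R G x + b *\<^sub>R G' x)"
      by (rule W11_gradient_linear[OF open_annulus G G'])
    show "continuous_on (closure ?A) (\<lambda>x. a * v k x + b * v' k x)" for k
      by (intro continuous_intros v v')
    show "W11_gradient ?A (\<lambda>x. a * v k x + b * v' k x) (\<lambda>x. a *\<^sub>R Dv k x + b *\<^sub>R Dv' k x)" for k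
      by (rule W11_gradient_linear[OF open_annulus v(2) v'(2)])
    have L: "f absolutely_integrable_on ?A" "F absolutely_integrable_on ?A" if "W11_gradient ?A f F" for f F
      using that by (auto simp: W11_gradient_def)
    have "(\<lambda>k. LINT x:?A|lebesgue. norm (a *\<^sub>R (v k x - w x) + b *\<^sub>R (v' k x - w' x))) \<longlonglongrightarrow> 0"
      by (intro L1_tendsto_zero_lincomb set_integral_diff(1) L(1)[OF G] L(1)[OF G'] L(1)[OF v(2)] L(1)[OF v'(2)])
        (use lim lim' in simp_all)
    then show "(\<lambda>k. LINT x:?A|lebesgue. \<bar>a * v k x + b * v' k x - (a * w x + b * w' x)\<bar>) \<longlonglongrightarrow> 0"
      by (simp add: algebra_simps)
    have "(\<lambda>k. LINT x:?A|lebesgue. norm (a *\<^sub>R (Dv k x - G x) + b *\<^sub>R (Dv' k x - G' x))) \<longlonglongrightarrow> 0"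
      by (intro L1_tendsto_zero_lincomb set_integral_diff(1) L(2)[OF G] L(2)[OF G'] L(2)[OF v(2)] L(2)[OF v'(2)])
        (use lim lim' in simp_all)
    then show "(\<lambda>k. LINT x:?A|lebesgue. norm (a *\<^sub>R Dv k x + b *\<^sub>R Dv' k x - (a *\<^sub>R G x + b *\<^sub>R G' x))) \<longlonglongrightarrow> 0"
      by (simp add: algebra_simps)
    have "(\<lambda>k. LINT x:frontier ?A|hausdorff1. norm (a *\<^sub>R (v k x - T x) + b *\<^sub>R (v' k x - T' x))) \<longlonglongrightarrow> 0"
      by (intro L1_tendsto_zero_lincomb set_integral_diff(1) T T' continuous_integrable_frontier[OF \<rho>] v(1) v'(1))
        (use lim lim' in simp_all)
    then show "(\<lambda>k. LINT x:frontier ?A|hausdorff1. \<bar>a * v k x + b * v' k x - (a * T x + b * T' x)\<bar>) \<longlonglongrightarrow> 0"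
      by (simp add: algebra_simps)
  qed
qed

lemma has_trace_continuous:
  assumes "0 < \<rho>1" "\<rho>1 < \<rho>2" "continuous_on (closure (annulus \<rho>1 \<rho>2)) w" "W11_gradient (annulus \<rho>1 \<rho>2) w G"
  shows "has_trace (annulus \<rho>1 \<rho>2) w w"
  unfolding has_trace_def
proof (intro conjI exI allI)
  show "set_integrable hausdorff1 (frontier (annulus \<rho>1 \<rho>2)) w"
    by (rule continuous_integrable_frontier[OF assms(1-3)])
  show "W11_gradient (annulus \<rho>1 \<rho>2) w G" "W11_gradient (annulus \<rho>1 \<rho>2) w G" by fact+
  show "continuous_on (closure (annulus \<rho>1 \<rho>2)) w" by fact
qed simp_all

lemma competitor_lincomb:
  assumes \<rho>: "0 < \<rho>1" "\<rho>1 < \<rho>2" and "competitor \<rho>1 \<rho>2 m2 w G T" "competitor \<rho>1 \<rho>2 m2 w' G' T'" and ab: "a + b = 1"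
  shows "competitor \<rho>1 \<rho>2 m2 (\<lambda>x. a * w x + b * w' x) (\<lambda>x. a *\<^sub>R G x + b *\<^sub>R G' x) (\<lambda>x. a * T x + b * T' x)"
proof -
  have ae: "AE x in hausdorff1. norm x = \<rho>2 \<longrightarrow> T x = m2" "AE x in hausdorff1. norm x = \<rho>2 \<longrightarrow> T' x = m2"
    using assms(3,4) by (auto simp: competitor_def)
  have m: "a * m2 + b * m2 = m2" using ab by (metis distrib_right mult_1)
  have "AE x in hausdorff1. norm x = \<rho>2 \<longrightarrow> a * T x + b * T' x = m2"
    using ae by eventually_elim (use m in auto)
  then show ?thesis
    using assms has_trace_linear[OF \<rho>] W11_gradient_linear[OF open_annulus] by (simp add: competitor_def)
qed

lemma competitor_const:
  assumes "0 < \<rho>1" "\<rho>1 < \<rho>2"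
  shows "competitor \<rho>1 \<rho>2 m2 (\<lambda>_. m2) (\<lambda>_. 0) (\<lambda>_. m2)"
  using has_trace_continuous[OF assms continuous_on_const W11_gradient_const[OF open_annulus bounded_annulus]]
    W11_gradient_const[OF open_annulus bounded_annulus]
  by (simp add: competitor_def)

section \<open>Strictly convex densities of linear growth\<close>

text \<open>The properties of \<open>g\<close> on the half line that the variational argument needs. The lower
ellipticity bound provides the strict monotonicity of \<open>g'\<close>.\<close>

definition convex_density :: "(real \<Rightarrow> real) \<Rightarrow> (real \<Rightarrow> real) \<Rightarrow> bool" where
  "convex_density g g' \<longleftrightarrow>
    (\<forall>t\<ge>0. (g has_real_derivative g' t) (at t within {0..})) \<and> strict_mono_on {0..} g' \<and> g 0 = 0 \<and> g' 0 = 0"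

lemma strict_mono_on_of_pos_deriv:
  assumes der: "\<And>t. 0 \<le> t \<Longrightarrow> (f has_real_derivative f' t) (at t within {0..})"
    and pos: "\<And>t. 0 < t \<Longrightarrow> 0 < f' t"
  shows "strict_mono_on {0..} f"
proof (rule strict_mono_onI)
  fix s t :: real assume st: "s \<in> {0..}" "t \<in> {0..}" "s < t"
  have "\<exists>x\<in>{s<..<t}. f t - f s = f' x * (t - s)"
  proof (rule mvt_simple[OF st(3)])
    fix x assume "s \<le> x" "x \<le> t"
    then show "(f has_derivative (*) (f' x)) (at x within {s..t})"
      using der[of x] st by (auto simp: has_field_derivative_def elim!: has_derivative_subset)
  qed
  then obtain x where "x \<in> {s<..<t}" "f t - f s = f' x * (t - s)" by blast
  moreover have "0 < f' x * (t - s)" using calculation st pos by simp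
  ultimately show "f s < f t" by simp
qed

lemma convex_density_tangent:
  assumes g: "convex_density g g'" and st: "0 \<le> s" "0 \<le> t" "s \<noteq> t"
  shows "g s + g' s * (t - s) < g t"
proof -
  have der: "(g has_derivative (*) (g' x)) (at x within {p..q})" if "0 \<le> p" "p \<le> x" for x p q
    using g that by (auto simp: convex_density_def has_field_derivative_def elim!: allE[of _ x] has_derivative_subset)
  have mono: "g' x < g' y" if "0 \<le> x" "x < y" for x y
    using g that by (auto simp: convex_density_def strict_mono_on_def)
  consider "s < t" | "t < s" using st by linarith
  then show ?thesis
  proof cases
    case 1
    have "\<exists>x\<in>{s<..<t}. g t - g s = g' x * (t - s)" using der st by (intro mvt_simple[OF 1]) auto
    then obtain x where x: "x \<in> {s<..<t}" "g t - g s = g' x * (t - s)" by blast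
    have "g' s * (t - s) < g' x * (t - s)" using mono[of s x] x 1 st by simp
    then show ?thesis using x(2) by linarith
  next
    case 2
    have "\<exists>x\<in>{t<..<s}. g s - g t = g' x * (s - t)" using der st by (intro mvt_simple[OF 2]) auto
    then obtain x where x: "x \<in> {t<..<s}" "g s - g t = g' x * (s - t)" by blast
    have "g' x * (s - t) < g' s * (s - t)" using mono[of x s] x 2 st by simp
    then show ?thesis using x by (simp add: algebra_simps)
  qed
qed

lemma convex_density_mono:
  assumes g: "convex_density g g'" and "0 \<le> s" "s < t"
  shows "g s < g t"
proof -
  have "g' 0 < g' s" if "s \<noteq> 0"
    by (rule strict_mono_onD[of "{0..}" g']) (use g assms that in \<open>auto simp: convex_density_def\<close>)
  moreover have "g' 0 = 0" using g by (simp add: convex_density_def)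
  ultimately have "0 \<le> g' s" by (cases "s = 0") auto
  then have "0 \<le> g' s * (t - s)" using assms by simp
  then show ?thesis using convex_density_tangent[OF g, of s t] assms by simp
qed

text \<open>The tangent at \<open>a * s + b * t\<close> lies below the graph, strictly so away from the point of contact.\<close>

lemma convex_density_convex:
  assumes g: "convex_density g g'" and st: "0 \<le> s" "0 \<le> t" and ab: "0 \<le> a" "0 \<le> b" "a + b = 1"
  shows "g (a * s + b * t) \<le> a * g s + b * g t"
    and "0 < a \<Longrightarrow> 0 < b \<Longrightarrow> s \<noteq> t \<Longrightarrow> g (a * s + b * t) < a * g s + b * g t"
proof -
  define p where "p = a * s + b * t"
  have p: "0 \<le> p" using st ab by (simp add: p_def)
  have le: "g p + g' p * (r - p) \<le> g r" if "0 \<le> r" for r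
    using convex_density_tangent[OF g p that] by (cases "r = p") auto
  have "a * (g p + g' p * (s - p)) + b * (g p + g' p * (t - p)) = (a + b) * g p + g' p * (a * s + b * t - (a + b) * p)"
    by (simp add: algebra_simps)
  then have eq: "a * (g p + g' p * (s - p)) + b * (g p + g' p * (t - p)) = g p" using ab by (simp add: p_def)
  have "a * (g p + g' p * (s - p)) \<le> a * g s" "b * (g p + g' p * (t - p)) \<le> b * g t"
    using le st ab by (auto intro: mult_left_mono)
  then show "g (a * s + b * t) \<le> a * g s + b * g t" using eq by (simp add: p_def)
  assume pos: "0 < a" "0 < b" "s \<noteq> t"
  have "s - p = b * (s - t)" using ab by (simp add: p_def algebra_simps flip: distrib_right)
  then have "s \<noteq> p" using pos by auto
  then have "a * (g p + g' p * (s - p)) < a * g s"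
    using convex_density_tangent[OF g p st(1)] pos by simp
  with \<open>b * (g p + g' p * (t - p)) \<le> b * g t\<close> show "g (a * s + b * t) < a * g s + b * g t"
    using eq by (simp add: p_def)
qed

lemma convex_density_norm:
  fixes x y :: "'a::real_inner"
  assumes g: "convex_density g g'" and ab: "0 \<le> a" "0 \<le> b" "a + b = 1"
  shows "g (norm (a *\<^sub>R x + b *\<^sub>R y)) \<le> a * g (norm x) + b * g (norm y)"
proof -
  have "norm (a *\<^sub>R x + b *\<^sub>R y) \<le> a * norm x + b * norm y"
    using norm_triangle_ineq[of "a *\<^sub>R x" "b *\<^sub>R y"] ab by simp
  then have "g (norm (a *\<^sub>R x + b *\<^sub>R y)) \<le> g (a * norm x + b * norm y)"
  proof (cases "norm (a *\<^sub>R x + b *\<^sub>R y) < a * norm x + b * norm y")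
    case True
    then show ?thesis by (rule less_imp_le[OF convex_density_mono[OF g norm_ge_zero]])
  qed simp
  also have "\<dots> \<le> a * g (norm x) + b * g (norm y)"
    by (rule convex_density_convex(1)[OF g _ _ ab]) auto
  finally show ?thesis .
qed

text \<open>Equality at the midpoint forces \<open>norm x = norm y\<close> by strict convexity of \<open>g\<close>, and equality in the triangle
inequality by strict monotonicity of \<open>g\<close>.\<close>

lemma convex_density_norm_midpoint_eq:
  fixes x y :: "'a::real_inner"
  assumes g: "convex_density g g'"
    and eq: "g (norm ((1/2) *\<^sub>R x + (1/2) *\<^sub>R y)) = 1/2 * g (norm x) + 1/2 * g (norm y)"
  shows "x = y"
proof -
  have tri: "norm ((1/2) *\<^sub>R x + (1/2) *\<^sub>R y) \<le> 1/2 * norm x + 1/2 * norm y"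
    using norm_triangle_ineq[of "(1/2) *\<^sub>R x" "(1/2) *\<^sub>R y"] by simp
  have mono: "g (norm ((1/2) *\<^sub>R x + (1/2) *\<^sub>R y)) < g (1/2 * norm x + 1/2 * norm y)"
    if "norm ((1/2) *\<^sub>R x + (1/2) *\<^sub>R y) < 1/2 * norm x + 1/2 * norm y"
    by (rule convex_density_mono[OF g norm_ge_zero that])
  have c1: "g (1/2 * norm x + 1/2 * norm y) \<le> 1/2 * g (norm x) + 1/2 * g (norm y)"
    by (rule convex_density_convex(1)[OF g]) auto
  have c2: "g (1/2 * norm x + 1/2 * norm y) < 1/2 * g (norm x) + 1/2 * g (norm y)" if "norm x \<noteq> norm y"
    by (rule convex_density_convex(2)[OF g]) (use that in auto)
  have n: "norm ((1/2) *\<^sub>R x + (1/2) *\<^sub>R y) = 1/2 * norm x + 1/2 * norm y"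
    using tri mono c1 eq by linarith
  then have nxy: "norm x = norm y" using c2 eq by fastforce
  have "norm (x + y) = 2 * norm ((1/2) *\<^sub>R x + (1/2) *\<^sub>R y)"
    by (simp flip: scaleR_add_right)
  then have "norm (x + y) = norm x + norm y" using n by simp
  then have "norm x *\<^sub>R y = norm y *\<^sub>R x" by (simp only: norm_triangle_eq)
  then show ?thesis using nxy by (cases "norm x = 0") auto
qed

text \<open>Since \<open>g 0 = 0\<close>, extending the gradient by 0 outside the annulus extends its composition with the
density by 0; this gives measurability.\<close>

lemma density_absolutely_integrable:
  fixes G :: "real^2 \<Rightarrow> real^2"
  assumes g: "convex_density g g'" and growth: "\<And>t. 0 \<le> t \<Longrightarrow> g t \<le> A * t + B"
    and G: "G absolutely_integrable_on annulus \<rho>1 \<rho>2"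
  shows "(\<lambda>x. g (norm (G x))) absolutely_integrable_on annulus \<rho>1 \<rho>2"
proof -
  let ?A = "annulus \<rho>1 \<rho>2"
  have g0: "g 0 = 0" using g by (simp add: convex_density_def)
  have gpos: "0 \<le> g t" if "0 \<le> t" for t
    using convex_density_mono[OF g order_refl, of t] that g0 by (cases "t = 0") auto
  have "continuous_on {0..} g"
    using g by (auto simp: convex_density_def intro!: DERIV_continuous_on)
  then have "continuous_on UNIV (\<lambda>x :: real^2. g (norm x))"
    by (rule continuous_on_compose2) (auto intro!: continuous_intros)
  then have gm: "(\<lambda>x :: real^2. g (norm x)) \<in> borel_measurable borel" by (rule borel_measurable_continuous_onI)
  have Gi: "integrable lebesgue (\<lambda>x. indicator ?A x *\<^sub>R G x)" using G by (simp add: set_integrable_def)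
  have eq: "g (norm (indicator ?A x *\<^sub>R G x)) = indicator ?A x *\<^sub>R g (norm (G x))" for x
    using g0 by (simp add: indicator_def)
  have m: "(\<lambda>x. indicator ?A x *\<^sub>R g (norm (G x))) \<in> borel_measurable lebesgue"
    using measurable_compose[OF borel_measurable_integrable[OF Gi] gm] by (simp only: eq)
  have one: "(\<lambda>_. \<bar>B\<bar>) absolutely_integrable_on ?A"
    by (intro absolutely_integrable_on_const annulus_lmeasurable)
  have "(\<lambda>x. A * norm (G x) + \<bar>B\<bar>) absolutely_integrable_on ?A"
    using set_integrable_norm[OF G] by (intro set_integral_add(1) one) auto
  then have "integrable lebesgue (\<lambda>x. indicator ?A x *\<^sub>R (A * norm (G x) + \<bar>B\<bar>))" by (simp add: set_integrable_def)
  then show ?thesis unfolding set_integrable_def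
  proof (rule Bochner_Integration.integrable_bound[OF _ m])
    show "AE x in lebesgue. norm (indicator ?A x *\<^sub>R g (norm (G x))) \<le> norm (indicator ?A x *\<^sub>R (A * norm (G x) + \<bar>B\<bar>))"
    proof (rule AE_I2)
      fix x
      have "0 \<le> g (norm (G x))" "g (norm (G x)) \<le> A * norm (G x) + \<bar>B\<bar>"
        using gpos growth[of "norm (G x)"] by auto
      then show "norm (indicator ?A x *\<^sub>R g (norm (G x))) \<le> norm (indicator ?A x *\<^sub>R (A * norm (G x) + \<bar>B\<bar>))"
        by (auto simp: indicator_def)
    qed
  qed
qed

text \<open>\<open>g'\<close> is increasing, and linear growth bounds it: the tangent at \<open>t\<close> gives \<open>g' t * t \<le> g (2 * t)\<close>. So
the limit exists and exceeds \<open>g' 1\<close>, hence \<open>0\<close>.\<close>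

lemma slope_at_infinity_pos:
  assumes g: "convex_density g g'" and growth: "\<And>t. 0 \<le> t \<Longrightarrow> g t \<le> A * t + B"
  shows "0 < slope_at_infinity g'"
proof -
  have mono: "g' s < g' t" if "0 \<le> s" "s < t" for s t
    using g that by (auto simp: convex_density_def strict_mono_on_def)
  have g0: "g 0 = 0" "g' 0 = 0" using g by (auto simp: convex_density_def)
  have gpos: "0 \<le> g t" if "0 \<le> t" for t
    using convex_density_mono[OF g order_refl, of t] that g0 by (cases "t = 0") auto
  have bound: "g' t \<le> 2 * \<bar>A\<bar> + \<bar>B\<bar>" if "1 \<le> t" for t
  proof -
    \<comment> \<open>the tangent at \<open>t\<close>, evaluated at \<open>2 * t\<close>\<close>
    have "g t + g' t * (2 * t - t) < g (2 * t)" using that by (intro convex_density_tangent[OF g]) auto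
    then have "g' t * t \<le> A * (2 * t) + B" using growth[of "2 * t"] gpos[of t] that by simp
    also have "\<dots> \<le> \<bar>A\<bar> * (2 * t) + \<bar>B\<bar> * t"
    proof (rule add_mono)
      show "A * (2 * t) \<le> \<bar>A\<bar> * (2 * t)" using that by (intro mult_right_mono) auto
      have "\<bar>B\<bar> * 1 \<le> \<bar>B\<bar> * t" using that by (intro mult_left_mono) auto
      then show "B \<le> \<bar>B\<bar> * t" by simp
    qed
    finally have "g' t * t \<le> (2 * \<bar>A\<bar> + \<bar>B\<bar>) * t" by (simp add: algebra_simps)
    then show ?thesis by (rule mult_right_le_imp_le) (use that in simp)
  qed
  define S where "S = (SUP t\<in>{1..}. g' t)"
  have bdd: "bdd_above (g' ` {1..})" using bound by (intro bdd_aboveI2) auto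
  have le: "g' t \<le> S" if "1 \<le> t" for t unfolding S_def using bdd that by (intro cSUP_upper) auto
  have "(g' \<longlongrightarrow> S) at_top"
  proof (rule increasing_tendsto)
    show "eventually (\<lambda>t. g' t \<le> S) at_top" using eventually_ge_at_top[of 1] by eventually_elim (rule le)
    fix y assume "y < S"
    then obtain t where t: "1 \<le> t" "y < g' t"
      unfolding S_def using less_cSUP_iff[OF _ bdd, of y] by auto
    show "eventually (\<lambda>s. y < g' s) at_top"
      using eventually_gt_at_top[of t]
    proof eventually_elim
      case (elim s)
      have "g' t < g' s" by (rule mono) (use t elim in auto)
      then show ?case using t by simp
    qed
  qed
  then have "slope_at_infinity g' = S"
    unfolding slope_at_infinity_def by (rule tendsto_Lim[rotated]) simp
  moreover have "0 < g' 1" using mono[of 0 1] g0 by simp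
  ultimately show ?thesis using le[of 1] by simp
qed

text \<open>The difference quotients of the modulus at \<open>d\<close> are eventually constant at each point, and they are
dominated by \<open>\<bar>T\<bar>\<close>.\<close>

lemma abs_directional_derivative:
  fixes T :: "real^2 \<Rightarrow> real"
  assumes \<rho>: "0 < \<rho>" and T: "set_integrable hausdorff1 (circ \<rho>) T" and "d \<noteq> 0"
  shows "(\<lambda>n. LINT x:circ \<rho>|hausdorff1. real (Suc n) * (\<bar>d + T x / real (Suc n)\<bar> - \<bar>d\<bar>))
    \<longlonglongrightarrow> (LINT x:circ \<rho>|hausdorff1. sgn d * T x)"
  unfolding set_lebesgue_integral_def
proof (rule integral_dominated_convergence[where w="\<lambda>x. norm (indicator (circ \<rho>) x *\<^sub>R T x)"])
  have i: "integrable hausdorff1 (\<lambda>x. indicator (circ \<rho>) x *\<^sub>R T x)" using T by (simp add: set_integrable_def)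
  then show "integrable hausdorff1 (\<lambda>x. norm (indicator (circ \<rho>) x *\<^sub>R T x))" by (rule integrable_norm)
  have m: "(\<lambda>x. indicator (circ \<rho>) x *\<^sub>R T x) \<in> borel_measurable hausdorff1" using i by simp
  show "(\<lambda>x. indicator (circ \<rho>) x *\<^sub>R (sgn d * T x)) \<in> borel_measurable hausdorff1"
    using borel_measurable_times[OF borel_measurable_const[of "sgn d"] m] by (simp add: mult_ac)
  fix n
  have "(\<lambda>x. real (Suc n) * (\<bar>d + (indicator (circ \<rho>) x *\<^sub>R T x) / real (Suc n)\<bar> - \<bar>d\<bar>)) \<in> borel_measurable hausdorff1"
    using m by (intro borel_measurable_times borel_measurable_diff borel_measurable_abs borel_measurable_add borel_measurable_divide borel_measurable_const)
  also have "(\<lambda>x. real (Suc n) * (\<bar>d + (indicator (circ \<rho>) x *\<^sub>R T x) / real (Suc n)\<bar> - \<bar>d\<bar>))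
      = (\<lambda>x. indicator (circ \<rho>) x *\<^sub>R (real (Suc n) * (\<bar>d + T x / real (Suc n)\<bar> - \<bar>d\<bar>)))"
    by (auto simp: indicator_def fun_eq_iff)
  finally show "(\<lambda>x. indicator (circ \<rho>) x *\<^sub>R (real (Suc n) * (\<bar>d + T x / real (Suc n)\<bar> - \<bar>d\<bar>))) \<in> borel_measurable hausdorff1" .
  show "AE x in hausdorff1. norm (indicator (circ \<rho>) x *\<^sub>R (real (Suc n) * (\<bar>d + T x / real (Suc n)\<bar> - \<bar>d\<bar>)))
      \<le> norm (indicator (circ \<rho>) x *\<^sub>R T x)"
  proof (rule AE_I2)
    fix x
    have "\<bar>\<bar>d + T x / real (Suc n)\<bar> - \<bar>d\<bar>\<bar> \<le> \<bar>T x / real (Suc n)\<bar>"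
      by (metis abs_triangle_ineq3 add_diff_cancel_left')
    then have "real (Suc n) * \<bar>\<bar>d + T x / real (Suc n)\<bar> - \<bar>d\<bar>\<bar> \<le> real (Suc n) * \<bar>T x / real (Suc n)\<bar>"
      by (rule mult_left_mono) simp
    also have "\<dots> = \<bar>T x\<bar>" by simp
    finally have "\<bar>real (Suc n) * (\<bar>d + T x / real (Suc n)\<bar> - \<bar>d\<bar>)\<bar> \<le> \<bar>T x\<bar>"
      by (simp only: abs_mult abs_of_nat)
    then show "norm (indicator (circ \<rho>) x *\<^sub>R (real (Suc n) * (\<bar>d + T x / real (Suc n)\<bar> - \<bar>d\<bar>)))
      \<le> norm (indicator (circ \<rho>) x *\<^sub>R T x)"
      by (cases "x \<in> circ \<rho>") simp_all
  qed
next
  show "AE x in hausdorff1. (\<lambda>n. indicator (circ \<rho>) x *\<^sub>R (real (Suc n) * (\<bar>d + T x / real (Suc n)\<bar> - \<bar>d\<bar>)))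
      \<longlonglongrightarrow> indicator (circ \<rho>) x *\<^sub>R (sgn d * T x)"
  proof (rule AE_I2)
    fix x
    obtain N :: nat where N: "\<bar>T x\<bar> / \<bar>d\<bar> < real N" using reals_Archimedean2 by blast
    have "real (Suc n) * (\<bar>d + T x / real (Suc n)\<bar> - \<bar>d\<bar>) = sgn d * T x" if "N \<le> n" for n
    proof -
      have "\<bar>T x\<bar> / \<bar>d\<bar> < real (Suc n)" using N that by linarith
      then have "\<bar>T x\<bar> < real (Suc n) * \<bar>d\<bar>" using \<open>d \<noteq> 0\<close> by (simp add: divide_less_eq)
      then have "\<bar>T x / real (Suc n)\<bar> < \<bar>d\<bar>" by (simp add: divide_less_eq mult.commute)
      moreover have "\<bar>d + q\<bar> - \<bar>d\<bar> = sgn d * q" if q: "\<bar>q\<bar> < \<bar>d\<bar>" for q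
      proof (cases "0 < d")
        case True
        then have "0 < d + q" using q by linarith
        then show ?thesis using True by simp
      next
        case False
        then have "d < 0" "d + q < 0" using q by linarith+
        then show ?thesis by simp
      qed
      ultimately have "\<bar>d + T x / real (Suc n)\<bar> - \<bar>d\<bar> = sgn d * (T x / real (Suc n))" by blast
      then show ?thesis by simp
    qed
    then have "eventually (\<lambda>n. indicator (circ \<rho>) x *\<^sub>R (real (Suc n) * (\<bar>d + T x / real (Suc n)\<bar> - \<bar>d\<bar>))
        = indicator (circ \<rho>) x *\<^sub>R (sgn d * T x)) sequentially"
      unfolding eventually_sequentially by auto
    then show "(\<lambda>n. indicator (circ \<rho>) x *\<^sub>R (real (Suc n) * (\<bar>d + T x / real (Suc n)\<bar> - \<bar>d\<bar>)))
      \<longlonglongrightarrow> indicator (circ \<rho>) x *\<^sub>R (sgn d * T x)" by (rule tendsto_eventually)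
  qed
qed

lemma convex_density_of_ellipticity:
  assumes "\<And>t. 0 \<le> t \<Longrightarrow> (g has_real_derivative g' t) (at t within {0..})"
    and "\<And>t. 0 \<le> t \<Longrightarrow> (g' has_real_derivative g'' t) (at t within {0..})"
    and "g 0 = 0" "g' 0 = 0" "0 < \<nu>"
    and ell: "\<And>t. 0 \<le> t \<Longrightarrow> \<nu> * (1 + t) powr (- \<mu>) \<le> g'' t"
  shows "convex_density g g'"
proof -
  have "0 < g'' t" if "0 < t" for t
  proof -
    have "0 < \<nu> * (1 + t) powr (- \<mu>)" using that assms by simp
    also have "\<dots> \<le> g'' t" using ell that by simp
    finally show ?thesis .
  qed
  then have "strict_mono_on {0..} g'" using assms(2) by (intro strict_mono_on_of_pos_deriv)
  then show ?thesis using assms by (simp add: convex_density_def)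
qed

section \<open>Minimizers\<close>

lemma energy_circ:
  "energy g ginf \<rho>1 \<rho>2 \<zeta> G T =
     (LINT x:annulus \<rho>1 \<rho>2|lebesgue. g (norm (G x))) + ginf * (LINT x:circ \<rho>1|hausdorff1. \<bar>T x - \<zeta>\<bar>)"
  by (simp add: energy_def circ_def)

lemma competitor_boundary_integrable:
  assumes "0 < \<rho>1" "\<rho>1 < \<rho>2" "competitor \<rho>1 \<rho>2 m2 w G T" "\<rho> \<in> {\<rho>1, \<rho>2}"
  shows "set_integrable hausdorff1 (circ \<rho>) T"
  using assms by (intro set_integrable_circ) (auto simp: competitor_def has_trace_def)

lemma competitor_gradient_integrable:
  "competitor \<rho>1 \<rho>2 m2 w G T \<Longrightarrow> G absolutely_integrable_on annulus \<rho>1 \<rho>2"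
  by (simp add: competitor_def W11_gradient_def)

lemma set_integral_circ_cong:
  assumes "\<And>x. x \<in> circ \<rho> \<Longrightarrow> f x = h x"
  shows "(LINT x:circ \<rho>|hausdorff1. f x) = (LINT x:circ \<rho>|hausdorff1. (h x :: real))"
  unfolding set_lebesgue_integral_def
  by (rule Bochner_Integration.integral_cong) (use assms in \<open>auto simp: indicator_def\<close>)

text \<open>The minimization property comes with some trace \<open>T\<close> of \<open>u\<close>. On each boundary circle the mean of \<open>T\<close>
is the constant boundary value of \<open>u\<close>, by \<open>trace_circle_integral\<close>. On the outer circle \<open>T\<close> equals \<open>m2\<close>,
so \<open>u\<close> equals \<open>m2\<close> there and its own boundary values make it a competitor. On the inner circle Jensen's
inequality for the modulus shows that this choice does not increase the energy.\<close>

lemma continuous_radial_minimizer: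
  assumes \<rho>: "0 < \<rho>1" "\<rho>1 < \<rho>2" and ginf: "0 \<le> ginf"
    and min: "is_minimizer g ginf \<rho>1 \<rho>2 m2 \<zeta> u"
    and cont: "continuous_on (closure (annulus \<rho>1 \<rho>2)) u"
    and radial: "\<And>x. x \<in> closure (annulus \<rho>1 \<rho>2) \<Longrightarrow> u x = uhat (norm x)"
  shows "\<exists>G. competitor \<rho>1 \<rho>2 m2 u G u \<and>
    (\<forall>w Gw Tw. competitor \<rho>1 \<rho>2 m2 w Gw Tw \<longrightarrow> energy g ginf \<rho>1 \<rho>2 \<zeta> G u \<le> energy g ginf \<rho>1 \<rho>2 \<zeta> Gw Tw)"
proof -
  obtain G T where comp: "competitor \<rho>1 \<rho>2 m2 u G T"
    and le: "\<And>w Gw Tw. competitor \<rho>1 \<rho>2 m2 w Gw Tw \<Longrightarrow> energy g ginf \<rho>1 \<rho>2 \<zeta> G T \<le> energy g ginf \<rho>1 \<rho>2 \<zeta> Gw Tw"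
    using min unfolding is_minimizer_def by blast
  have W: "W11_gradient (annulus \<rho>1 \<rho>2) u G" and tr: "has_trace (annulus \<rho>1 \<rho>2) u T"
    and ae: "AE x in hausdorff1. norm x = \<rho>2 \<longrightarrow> T x = m2"
    using comp by (auto simp: competitor_def)
  have val: "u x = uhat \<rho>" if "\<rho> \<in> {\<rho>1, \<rho>2}" "x \<in> circ \<rho>" for x \<rho>
  proof -
    have n: "norm x = \<rho>" using that by (simp add: circ_def)
    then have "x \<in> closure (annulus \<rho>1 \<rho>2)" using that \<rho> by (auto simp: closure_annulus[OF \<rho>])
    then show ?thesis using radial n by simp
  qed
  have mean: "(LINT x:circ \<rho>|hausdorff1. T x) = circ_length \<rho> * uhat \<rho>" if r: "\<rho> \<in> {\<rho>1, \<rho>2}" for \<rho>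
  proof -
    have "(LINT x:circ \<rho>|hausdorff1. T x) = (LINT x:circ \<rho>|hausdorff1. u x)"
      by (rule trace_circle_integral[OF \<rho> r cont tr])
    also have "\<dots> = (LINT x:circ \<rho>|hausdorff1. uhat \<rho>)" by (rule set_integral_circ_cong) (rule val[OF r])
    also have "\<dots> = circ_length \<rho> * uhat \<rho>" using r \<rho> by (intro set_integral_circ_const) auto
    finally show ?thesis .
  qed
  have Ti: "set_integrable hausdorff1 (circ \<rho>) T" if "\<rho> \<in> {\<rho>1, \<rho>2}" for \<rho>
    by (rule competitor_boundary_integrable[OF \<rho> comp that])
  have "(LINT x:circ \<rho>2|hausdorff1. T x) = (LINT x:circ \<rho>2|hausdorff1. m2)"
    unfolding set_lebesgue_integral_def
  proof (rule integral_cong_AE)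
    show "(\<lambda>x. indicator (circ \<rho>2) x *\<^sub>R T x) \<in> borel_measurable hausdorff1"
      using Ti[of \<rho>2] unfolding set_integrable_def by (intro borel_measurable_integrable) simp
    show "(\<lambda>x. indicator (circ \<rho>2) x *\<^sub>R m2) \<in> borel_measurable (hausdorff1 :: (real^2) measure)"
      using set_integrable_circ_const[of \<rho>2 m2] \<rho> unfolding set_integrable_def by (intro borel_measurable_integrable) simp
    show "AE x in hausdorff1. indicator (circ \<rho>2) x *\<^sub>R T x = indicator (circ \<rho>2) x *\<^sub>R m2"
      using ae by eventually_elim (auto simp: circ_def indicator_def)
  qed
  then have "circ_length \<rho>2 * uhat \<rho>2 = circ_length \<rho>2 * m2"
    using mean[of \<rho>2] set_integral_circ_const[of \<rho>2 m2] \<rho> by simp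
  then have outer: "uhat \<rho>2 = m2" using circ_length_pos[of \<rho>2] \<rho> by simp
  have comp': "competitor \<rho>1 \<rho>2 m2 u G u"
    unfolding competitor_def
  proof (intro conjI W has_trace_continuous[OF \<rho> cont W] AE_I2 impI)
    fix x :: "real^2" assume "norm x = \<rho>2"
    then show "u x = m2" using val[of \<rho>2 x] outer by (simp add: circ_def)
  qed
  have "energy g ginf \<rho>1 \<rho>2 \<zeta> G u \<le> energy g ginf \<rho>1 \<rho>2 \<zeta> G T"
  proof -
    have "(LINT x:circ \<rho>1|hausdorff1. \<bar>u x - \<zeta>\<bar>) = (LINT x:circ \<rho>1|hausdorff1. \<bar>uhat \<rho>1 - \<zeta>\<bar>)"
      by (rule set_integral_circ_cong) (use val[of \<rho>1] in simp)
    also have "\<dots> = circ_length \<rho>1 * \<bar>uhat \<rho>1 - \<zeta>\<bar>" by (rule set_integral_circ_const[OF \<rho>(1)])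
    also have "\<dots> = \<bar>(LINT x:circ \<rho>1|hausdorff1. T x) - (LINT x:circ \<rho>1|hausdorff1. \<zeta>)\<bar>"
      using circ_length_pos[OF \<rho>(1)] mean[of \<rho>1] set_integral_circ_const[OF \<rho>(1), of \<zeta>]
      by (simp add: right_diff_distrib[symmetric] abs_mult)
    also have "\<dots> = norm (LINT x:circ \<rho>1|hausdorff1. T x - \<zeta>)"
      using set_integral_diff(2)[OF Ti[of \<rho>1] set_integrable_circ_const[OF \<rho>(1), of \<zeta>]] by simp
    also have "\<dots> \<le> (LINT x:circ \<rho>1|hausdorff1. norm (T x - \<zeta>))"
      by (intro set_integral_norm_bound set_integral_diff(1) Ti set_integrable_circ_const \<rho>) simp
    finally have "(LINT x:circ \<rho>1|hausdorff1. \<bar>u x - \<zeta>\<bar>) \<le> (LINT x:circ \<rho>1|hausdorff1. \<bar>T x - \<zeta>\<bar>)" by simp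
    then show ?thesis using ginf by (simp add: energy_circ mult_left_mono)
  qed
  then show ?thesis using comp' le order_trans by blast
qed

lemma density_integral_convex:
  fixes G H :: "real^2 \<Rightarrow> real^2"
  assumes g: "convex_density g g'" and growth: "\<And>t. 0 \<le> t \<Longrightarrow> g t \<le> A * t + B"
    and G: "G absolutely_integrable_on annulus \<rho>1 \<rho>2" "H absolutely_integrable_on annulus \<rho>1 \<rho>2"
    and ab: "0 \<le> a" "0 \<le> b" "a + b = 1"
  shows "(LINT x:annulus \<rho>1 \<rho>2|lebesgue. g (norm (a *\<^sub>R G x + b *\<^sub>R H x)))
    \<le> a * (LINT x:annulus \<rho>1 \<rho>2|lebesgue. g (norm (G x))) + b * (LINT x:annulus \<rho>1 \<rho>2|lebesgue. g (norm (H x)))"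
proof -
  let ?A = "annulus \<rho>1 \<rho>2"
  have i: "(\<lambda>x. g (norm (F x))) absolutely_integrable_on ?A" if "F absolutely_integrable_on ?A" for F :: "real^2 \<Rightarrow> real^2"
    by (rule density_absolutely_integrable[OF g growth that])
  have ai: "(\<lambda>x. a * g (norm (G x))) absolutely_integrable_on ?A" "(\<lambda>x. b * g (norm (H x))) absolutely_integrable_on ?A"
    using i[OF G(1)] i[OF G(2)] by auto
  have "(\<lambda>x. a *\<^sub>R G x + b *\<^sub>R H x) absolutely_integrable_on ?A"
    using G by (intro set_integral_add(1)) auto
  then have "(LINT x:?A|lebesgue. g (norm (a *\<^sub>R G x + b *\<^sub>R H x)))
      \<le> (LINT x:?A|lebesgue. a * g (norm (G x)) + b * g (norm (H x)))"
    by (rule set_integral_mono[OF i set_integral_add(1)[OF ai] convex_density_norm[OF g ab]])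
  also have "\<dots> = (LINT x:?A|lebesgue. a * g (norm (G x))) + (LINT x:?A|lebesgue. b * g (norm (H x)))"
    by (rule set_integral_add(2)[OF ai])
  finally show ?thesis by simp
qed

text \<open>The comparison functions are \<open>(1 - e) u + e w\<close> with \<open>e = 1 / (n + 1)\<close>. Convexity bounds the volume term of
their energy, and on the inner circle their trace is \<open>c + e (Tw - c)\<close>.\<close>

lemma minimizer_first_variation:
  assumes \<rho>: "0 < \<rho>1" "\<rho>1 < \<rho>2"
    and g: "convex_density g g'" and growth: "\<And>t. 0 \<le> t \<Longrightarrow> g t \<le> A * t + B"
    and comp: "competitor \<rho>1 \<rho>2 m2 u G u"
    and min: "\<And>w Gw Tw. competitor \<rho>1 \<rho>2 m2 w Gw Tw \<Longrightarrow> energy g ginf \<rho>1 \<rho>2 m G u \<le> energy g ginf \<rho>1 \<rho>2 m Gw Tw"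
    and c: "\<And>x. x \<in> circ \<rho>1 \<Longrightarrow> u x = c" "c \<noteq> m"
    and w: "competitor \<rho>1 \<rho>2 m2 w Gw Tw"
  shows "0 \<le> (LINT x:annulus \<rho>1 \<rho>2|lebesgue. g (norm (Gw x))) - (LINT x:annulus \<rho>1 \<rho>2|lebesgue. g (norm (G x)))
      + ginf * (LINT x:circ \<rho>1|hausdorff1. sgn (c - m) * (Tw x - c))"
proof -
  let ?A = "annulus \<rho>1 \<rho>2"
  define F where "F = (LINT x:?A|lebesgue. g (norm (G x)))"
  define Fw where "Fw = (LINT x:?A|lebesgue. g (norm (Gw x)))"
  define q where "q n = (LINT x:circ \<rho>1|hausdorff1. real (Suc n) * (\<bar>(c - m) + (Tw x - c) / real (Suc n)\<bar> - \<bar>c - m\<bar>))" for n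
  have Tw: "set_integrable hausdorff1 (circ \<rho>1) Tw" by (rule competitor_boundary_integrable[OF \<rho> w]) simp
  have Twc: "set_integrable hausdorff1 (circ \<rho>1) (\<lambda>x. Tw x - c)"
    by (intro set_integral_diff(1) Tw set_integrable_circ_const \<rho>)
  have pos: "0 \<le> Fw - F + ginf * q n" for n
  proof -
    define e where "e = 1 / real (Suc n)"
    have e: "0 \<le> 1 - e" "0 \<le> e" "(1 - e) + e = 1" "0 < e" by (auto simp: e_def field_simps)
    have ci: "set_integrable hausdorff1 (circ \<rho>1) (\<lambda>x. \<bar>(c - m) + (Tw x - c) / real (Suc n)\<bar>)"
      using Twc by (intro set_integrable_abs set_integral_add(1) set_integrable_circ_const \<rho> set_integrable_divide) auto
    have "F + ginf * (LINT x:circ \<rho>1|hausdorff1. \<bar>u x - m\<bar>)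
        \<le> (LINT x:?A|lebesgue. g (norm ((1 - e) *\<^sub>R G x + e *\<^sub>R Gw x)))
          + ginf * (LINT x:circ \<rho>1|hausdorff1. \<bar>((1 - e) * u x + e * Tw x) - m\<bar>)"
      using min[OF competitor_lincomb[OF \<rho> comp w e(3)]] unfolding energy_circ F_def .
    also have "(LINT x:?A|lebesgue. g (norm ((1 - e) *\<^sub>R G x + e *\<^sub>R Gw x))) \<le> (1 - e) * F + e * Fw"
      unfolding F_def Fw_def
      by (rule density_integral_convex[OF g growth competitor_gradient_integrable[OF comp] competitor_gradient_integrable[OF w] e(1-3)])
    also have "(LINT x:circ \<rho>1|hausdorff1. \<bar>((1 - e) * u x + e * Tw x) - m\<bar>)
        = (LINT x:circ \<rho>1|hausdorff1. \<bar>(c - m) + (Tw x - c) / real (Suc n)\<bar>)"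
    proof (rule set_integral_circ_cong)
      fix x assume "x \<in> circ \<rho>1"
      then have "((1 - e) * u x + e * Tw x) - m = (c - m) + e * (Tw x - c)"
        by (simp add: c(1) algebra_simps)
      then show "\<bar>((1 - e) * u x + e * Tw x) - m\<bar> = \<bar>(c - m) + (Tw x - c) / real (Suc n)\<bar>"
        by (simp add: e_def)
    qed
    also have "(LINT x:circ \<rho>1|hausdorff1. \<bar>u x - m\<bar>) = (LINT x:circ \<rho>1|hausdorff1. \<bar>c - m\<bar>)"
      by (rule set_integral_circ_cong) (simp add: c(1))
    finally have "0 \<le> e * (Fw - F) + ginf * ((LINT x:circ \<rho>1|hausdorff1. \<bar>(c - m) + (Tw x - c) / real (Suc n)\<bar>) - (LINT x:circ \<rho>1|hausdorff1. \<bar>c - m\<bar>))"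
      by (simp add: algebra_simps)
    also have "(LINT x:circ \<rho>1|hausdorff1. \<bar>(c - m) + (Tw x - c) / real (Suc n)\<bar>) - (LINT x:circ \<rho>1|hausdorff1. \<bar>c - m\<bar>)
        = (LINT x:circ \<rho>1|hausdorff1. \<bar>(c - m) + (Tw x - c) / real (Suc n)\<bar> - \<bar>c - m\<bar>)"
      by (rule set_integral_diff(2)[symmetric, OF ci set_integrable_circ_const[OF \<rho>(1)]])
    also have "\<dots> = e * q n" unfolding q_def by (simp add: e_def)
    finally have "0 \<le> e * (Fw - F + ginf * q n)" by (simp add: algebra_simps)
    then show ?thesis using e(4) by (simp add: zero_le_mult_iff)
  qed
  have "q \<longlonglongrightarrow> (LINT x:circ \<rho>1|hausdorff1. sgn (c - m) * (Tw x - c))"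
    unfolding q_def using abs_directional_derivative[OF \<rho>(1) Twc, of "c - m"] c(2) by simp
  then have "(\<lambda>n. Fw - F + ginf * q n) \<longlonglongrightarrow> Fw - F + ginf * (LINT x:circ \<rho>1|hausdorff1. sgn (c - m) * (Tw x - c))"
    by (intro tendsto_intros)
  then have "0 \<le> Fw - F + ginf * (LINT x:circ \<rho>1|hausdorff1. sgn (c - m) * (Tw x - c))"
    by (rule LIMSEQ_le_const) (use pos in blast)
  then show ?thesis by (simp add: F_def Fw_def)
qed

text \<open>The midpoint of two minimizers has no smaller energy than either, so the density takes the value of
the mean almost everywhere and the gradients agree by \<open>convex_density_norm_midpoint_eq\<close>.\<close>

lemma minimizer_unique:
  assumes \<rho>: "0 < \<rho>1" "\<rho>1 < \<rho>2" and ginf: "0 \<le> ginf"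
    and g: "convex_density g g'" and growth: "\<And>t. 0 \<le> t \<Longrightarrow> g t \<le> A * t + B"
    and comp: "competitor \<rho>1 \<rho>2 m2 u G T"
    and min: "\<And>w Gw Tw. competitor \<rho>1 \<rho>2 m2 w Gw Tw \<Longrightarrow> energy g ginf \<rho>1 \<rho>2 \<zeta> G T \<le> energy g ginf \<rho>1 \<rho>2 \<zeta> Gw Tw"
    and v: "is_minimizer g ginf \<rho>1 \<rho>2 m2 \<zeta> v"
  shows "AE x in lebesgue. x \<in> annulus \<rho>1 \<rho>2 \<longrightarrow> v x = u x"
proof -
  let ?A = "annulus \<rho>1 \<rho>2"
  obtain Gv Tv where vc: "competitor \<rho>1 \<rho>2 m2 v Gv Tv"
    and vle: "energy g ginf \<rho>1 \<rho>2 \<zeta> Gv Tv \<le> energy g ginf \<rho>1 \<rho>2 \<zeta> G T"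
    using v comp unfolding is_minimizer_def by blast
  define F where "F = (\<lambda>H :: real^2 \<Rightarrow> real^2. LINT x:?A|lebesgue. g (norm (H x)))"
  define J where "J = (\<lambda>S. LINT x:circ \<rho>1|hausdorff1. \<bar>S x - \<zeta>\<bar>)"
  define M where "M x = (1/2) *\<^sub>R G x + (1/2) *\<^sub>R Gv x" for x
  have E: "energy g ginf \<rho>1 \<rho>2 \<zeta> H S = F H + ginf * J S" for H S
    by (simp add: energy_circ F_def J_def)
  have Gi: "G absolutely_integrable_on ?A" "Gv absolutely_integrable_on ?A"
    using comp vc by (auto intro: competitor_gradient_integrable)
  then have Mi: "M absolutely_integrable_on ?A"
    unfolding M_def[abs_def] by (intro set_integral_add(1)) auto
  have i: "(\<lambda>x. g (norm (H x))) absolutely_integrable_on ?A" if "H absolutely_integrable_on ?A" for H :: "real^2 \<Rightarrow> real^2"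
    by (rule density_absolutely_integrable[OF g growth that])
  have Ti: "set_integrable hausdorff1 (circ \<rho>1) T" "set_integrable hausdorff1 (circ \<rho>1) Tv"
    using competitor_boundary_integrable[OF \<rho> comp] competitor_boundary_integrable[OF \<rho> vc] by auto
  have ti: "set_integrable hausdorff1 (circ \<rho>1) (\<lambda>x. 1/2 * \<bar>S x - \<zeta>\<bar>)" if "set_integrable hausdorff1 (circ \<rho>1) S" for S
    using set_integrable_abs[OF set_integral_diff(1)[OF that set_integrable_circ_const[OF \<rho>(1), of \<zeta>]]] by simp
  have "J (\<lambda>x. 1/2 * T x + 1/2 * Tv x) \<le> (LINT x:circ \<rho>1|hausdorff1. 1/2 * \<bar>T x - \<zeta>\<bar> + 1/2 * \<bar>Tv x - \<zeta>\<bar>)"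
    unfolding J_def
  proof (rule set_integral_mono)
    have "set_integrable hausdorff1 (circ \<rho>1) (\<lambda>x. 1/2 * T x + 1/2 * Tv x)"
      using Ti by (intro set_integral_add(1)) auto
    then show "set_integrable hausdorff1 (circ \<rho>1) (\<lambda>x. \<bar>1/2 * T x + 1/2 * Tv x - \<zeta>\<bar>)"
      by (intro set_integrable_abs set_integral_diff(1) set_integrable_circ_const \<rho>)
    show "set_integrable hausdorff1 (circ \<rho>1) (\<lambda>x. 1/2 * \<bar>T x - \<zeta>\<bar> + 1/2 * \<bar>Tv x - \<zeta>\<bar>)"
      by (rule set_integral_add(1)[OF ti[OF Ti(1)] ti[OF Ti(2)]])
    fix x
    have "1/2 * T x + 1/2 * Tv x - \<zeta> = 1/2 * (T x - \<zeta>) + 1/2 * (Tv x - \<zeta>)"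
      by (simp add: field_simps)
    also have "\<bar>\<dots>\<bar> \<le> \<bar>1/2 * (T x - \<zeta>)\<bar> + \<bar>1/2 * (Tv x - \<zeta>)\<bar>" by (rule abs_triangle_ineq)
    finally show "\<bar>1/2 * T x + 1/2 * Tv x - \<zeta>\<bar> \<le> 1/2 * \<bar>T x - \<zeta>\<bar> + 1/2 * \<bar>Tv x - \<zeta>\<bar>"
      by (simp add: abs_mult)
  qed
  also have "\<dots> = 1/2 * J T + 1/2 * J Tv"
    unfolding set_integral_add(2)[OF ti[OF Ti(1)] ti[OF Ti(2)]] J_def by simp
  finally have Jmid: "J (\<lambda>x. 1/2 * T x + 1/2 * Tv x) \<le> 1/2 * J T + 1/2 * J Tv" .
  have "energy g ginf \<rho>1 \<rho>2 \<zeta> G T \<le> F M + ginf * J (\<lambda>x. 1/2 * T x + 1/2 * Tv x)"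
    using min[OF competitor_lincomb[OF \<rho> comp vc, of "1/2" "1/2"]] by (simp add: E M_def[abs_def])
  also have "\<dots> \<le> F M + ginf * (1/2 * J T + 1/2 * J Tv)"
    using mult_left_mono[OF Jmid ginf] by simp
  finally have "F G + ginf * J T \<le> F M + 1/2 * (ginf * J T) + 1/2 * (ginf * J Tv)"
    by (simp add: E algebra_simps)
  moreover have "F Gv + ginf * J Tv \<le> F G + ginf * J T" using vle by (simp add: E)
  ultimately have Fle: "1/2 * F G + 1/2 * F Gv - F M \<le> 0" by linarith
  \<comment> \<open>the convexity gap is nonnegative with integral at most 0\<close>
  define h where "h x = 1/2 * g (norm (G x)) + 1/2 * g (norm (Gv x)) - g (norm (M x))" for x
  have h0: "0 \<le> h x" for x
    using convex_density_norm[OF g, of "1/2" "1/2" "G x" "Gv x"] by (simp add: h_def M_def)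
  have half: "(\<lambda>x. 1/2 * g (norm (G x))) absolutely_integrable_on ?A" "(\<lambda>x. 1/2 * g (norm (Gv x))) absolutely_integrable_on ?A"
    using i[OF Gi(1)] i[OF Gi(2)] by auto
  have sum: "(\<lambda>x. 1/2 * g (norm (G x)) + 1/2 * g (norm (Gv x))) absolutely_integrable_on ?A"
    by (rule set_integral_add(1)[OF half])
  have hi: "h absolutely_integrable_on ?A"
    unfolding h_def[abs_def] by (rule set_integral_diff(1)[OF sum i[OF Mi]])
  have "(LINT x:?A|lebesgue. h x) = 1/2 * F G + 1/2 * F Gv - F M"
    unfolding h_def set_integral_diff(2)[OF sum i[OF Mi]] set_integral_add(2)[OF half] F_def by simp
  then have "(LINT x:?A|lebesgue. h x) \<le> 0" using Fle by simp
  moreover have "0 \<le> (LINT x:?A|lebesgue. h x)"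
    unfolding set_lebesgue_integral_def by (intro integral_nonneg_AE AE_I2) (simp add: h0)
  ultimately have "(\<integral>x. indicator ?A x *\<^sub>R h x \<partial>lebesgue) = 0"
    by (simp add: set_lebesgue_integral_def)
  moreover have "integrable lebesgue (\<lambda>x. indicator ?A x *\<^sub>R h x)" using hi by (simp add: set_integrable_def)
  ultimately have "AE x in lebesgue. indicator ?A x *\<^sub>R h x = 0"
    using integral_nonneg_eq_0_iff_AE[of lebesgue "\<lambda>x. indicator ?A x *\<^sub>R h x"] h0 by simp
  then have eqG: "AE x in lebesgue. indicator ?A x *\<^sub>R norm (Gv x - G x) = 0"
  proof eventually_elim
    case (elim x)
    show ?case
    proof (cases "x \<in> ?A")
      case True
      then have "g (norm ((1/2) *\<^sub>R G x + (1/2) *\<^sub>R Gv x)) = 1/2 * g (norm (G x)) + 1/2 * g (norm (Gv x))"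
        using elim by (simp add: h_def M_def)
      then have "G x = Gv x" by (rule convex_density_norm_midpoint_eq[OF g])
      then show ?thesis by simp
    qed simp
  qed
  then have G0: "(LINT x:?A|lebesgue. norm (Gv x - G x)) = 0"
    unfolding set_lebesgue_integral_def by (rule integral_eq_zero_AE)
  have W: "W11_gradient ?A (\<lambda>x. v x - u x) (\<lambda>x. Gv x - G x)"
    using comp vc by (intro W11_gradient_diff open_annulus) (auto simp: competitor_def)
  have tr: "has_trace ?A (\<lambda>x. v x - u x) (\<lambda>x. Tv x - T x)"
    using has_trace_linear[OF \<rho>, of v Tv u T 1 "-1"] comp vc by (simp add: competitor_def)
  have "AE x in hausdorff1. norm x = \<rho>2 \<longrightarrow> Tv x = m2" "AE x in hausdorff1. norm x = \<rho>2 \<longrightarrow> T x = m2"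
    using comp vc by (auto simp: competitor_def)
  then have ae: "AE x in hausdorff1. norm x = \<rho>2 \<longrightarrow> Tv x - T x = 0" by eventually_elim simp
  show ?thesis
    using zero_gradient_zero_trace_imp_AE_zero[OF \<rho> W G0 tr ae] by eventually_elim simp
qed

theorem corollary1p1:
  fixes \<rho>1 \<rho>2 m2 \<mu> \<mu>' \<nu>1 \<nu>2 a A b B m :: real
    and g g' g'' :: "real \<Rightarrow> real"
    and u :: "real^2 \<Rightarrow> real" and uhat :: "real \<Rightarrow> real"
  assumes radii: "0 < \<rho>1" "\<rho>1 < \<rho>2"
    and mu: "1 < \<mu>"
    and g_nonneg: "\<And>t. 0 \<le> t \<Longrightarrow> 0 \<le> g t"
    and g_C2: "\<And>t. 0 \<le> t \<Longrightarrow> (g has_real_derivative g' t) (at t within {0..})"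
      "\<And>t. 0 \<le> t \<Longrightarrow> (g' has_real_derivative g'' t) (at t within {0..})"
      "continuous_on {0..} g''"
    and linear_growth: "0 < a" "0 < A"
      "\<And>t. 0 \<le> t \<Longrightarrow> a * t - b \<le> g t \<and> g t \<le> A * t + B"
    and g_zero: "g 0 = 0" "g' 0 = 0"
    and ellipticity: "0 < \<nu>1" "0 < \<nu>2" "1 \<le> \<mu>'" "\<mu>' \<le> \<mu>"
      "\<And>t. 0 \<le> t \<Longrightarrow> \<nu>1 * (1 + t) powr (- \<mu>) \<le> g'' t \<and> g'' t \<le> \<nu>2 * (1 + t) powr (- \<mu>')"
    and mu_gap: "\<mu> - \<mu>' < 2"
    and m: "m < m2"
    and u_min: "is_minimizer g (slope_at_infinity g') \<rho>1 \<rho>2 m2 m u"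
    and u_cont: "continuous_on (closure (annulus \<rho>1 \<rho>2)) u"
    and u_radial: "\<And>x. x \<in> closure (annulus \<rho>1 \<rho>2) \<Longrightarrow> u x = uhat (norm x)"
    and not_attained: "uhat \<rho>1 \<noteq> m"
  shows "\<forall>\<zeta>\<le>m. is_unique_minimizer g (slope_at_infinity g') \<rho>1 \<rho>2 m2 \<zeta> u"
proof (intro allI impI)
  fix \<zeta> assume \<zeta>: "\<zeta> \<le> m"
  let ?A = "annulus \<rho>1 \<rho>2"
  have g: "convex_density g g'"
    by (rule convex_density_of_ellipticity[of g g' g'' \<nu>1 \<mu>]) (use g_C2 g_zero ellipticity in auto)
  have growth: "g t \<le> A * t + B" if "0 \<le> t" for t using linear_growth(3)[OF that] by simp
  define ginf where "ginf = slope_at_infinity g'"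
  have ginf: "0 < ginf" unfolding ginf_def by (rule slope_at_infinity_pos[OF g growth])
  define c where "c = uhat \<rho>1"
  have c: "u x = c" if "x \<in> circ \<rho>1" for x
  proof -
    have "norm x = \<rho>1" using that by (simp add: circ_def)
    moreover have "x \<in> closure ?A"
      unfolding closure_annulus[OF radii] using calculation radii by simp
    ultimately show ?thesis using u_radial by (simp add: c_def)
  qed
  obtain G where comp: "competitor \<rho>1 \<rho>2 m2 u G u"
    and min: "\<And>w Gw Tw. competitor \<rho>1 \<rho>2 m2 w Gw Tw \<Longrightarrow> energy g ginf \<rho>1 \<rho>2 m G u \<le> energy g ginf \<rho>1 \<rho>2 m Gw Tw"
    using continuous_radial_minimizer[OF radii less_imp_le[OF ginf] u_min[folded ginf_def] u_cont u_radial] by blast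
  define F where "F = (\<lambda>H :: real^2 \<Rightarrow> real^2. LINT x:?A|lebesgue. g (norm (H x)))"
  have variation: "0 \<le> F Gw - F G + ginf * (LINT x:circ \<rho>1|hausdorff1. sgn (c - m) * (Tw x - c))"
    if "competitor \<rho>1 \<rho>2 m2 w Gw Tw" for w Gw Tw
    unfolding F_def
    by (rule minimizer_first_variation[OF radii g growth comp min c _ that]) (use not_attained in \<open>auto simp: c_def\<close>)
  have "m < c"
  proof (rule ccontr)
    assume "\<not> m < c"
    then have "c < m" using not_attained by (simp add: c_def)
    have "F (\<lambda>_. 0) = 0" by (simp add: F_def g_zero)
    moreover have "(LINT x:circ \<rho>1|hausdorff1. sgn (c - m) * (m2 - c)) = circ_length \<rho>1 * (sgn (c - m) * (m2 - c))"
      by (rule set_integral_circ_const[OF radii(1)])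
    ultimately have "0 \<le> 0 - F G + ginf * (circ_length \<rho>1 * (sgn (c - m) * (m2 - c)))"
      using variation[OF competitor_const[OF radii, of m2]] by (simp only:)
    also have "ginf * (circ_length \<rho>1 * (sgn (c - m) * (m2 - c))) = - (ginf * (circ_length \<rho>1 * (m2 - c)))"
      using \<open>c < m\<close> by (simp add: algebra_simps)
    finally have "F G \<le> - (ginf * (circ_length \<rho>1 * (m2 - c)))" by simp
    moreover have "0 \<le> F G"
      unfolding F_def set_lebesgue_integral_def by (intro integral_nonneg_AE AE_I2) (simp add: g_nonneg)
    moreover have "0 < ginf * (circ_length \<rho>1 * (m2 - c))"
      using ginf circ_length_pos[OF radii(1)] m \<open>c < m\<close> by simp
    ultimately show False by linarith
  qed
  have min\<zeta>: "energy g ginf \<rho>1 \<rho>2 \<zeta> G u \<le> energy g ginf \<rho>1 \<rho>2 \<zeta> Gw Tw"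
    if w: "competitor \<rho>1 \<rho>2 m2 w Gw Tw" for w Gw Tw
  proof -
    have Tw: "set_integrable hausdorff1 (circ \<rho>1) Tw" by (rule competitor_boundary_integrable[OF radii w]) simp
    have const: "set_integrable hausdorff1 (circ \<rho>1) (\<lambda>_. r :: real)" for r
      by (rule set_integrable_circ_const[OF radii(1)])
    have "(LINT x:circ \<rho>1|hausdorff1. \<bar>u x - \<zeta>\<bar>) = (LINT x:circ \<rho>1|hausdorff1. c - \<zeta>)"
      by (rule set_integral_circ_cong) (use c \<zeta> \<open>m < c\<close> in auto)
    moreover have "(LINT x:circ \<rho>1|hausdorff1. c - \<zeta>) + (LINT x:circ \<rho>1|hausdorff1. Tw x - c)
        = (LINT x:circ \<rho>1|hausdorff1. (c - \<zeta>) + (Tw x - c))"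
      by (intro set_integral_add(2)[symmetric] set_integral_diff(1) Tw const)
    moreover have "(LINT x:circ \<rho>1|hausdorff1. (c - \<zeta>) + (Tw x - c)) \<le> (LINT x:circ \<rho>1|hausdorff1. \<bar>Tw x - \<zeta>\<bar>)"
      by (intro set_integral_mono set_integral_add(1) set_integrable_abs set_integral_diff(1) Tw const) simp
    ultimately have "ginf * ((LINT x:circ \<rho>1|hausdorff1. \<bar>u x - \<zeta>\<bar>) + (LINT x:circ \<rho>1|hausdorff1. Tw x - c))
        \<le> ginf * (LINT x:circ \<rho>1|hausdorff1. \<bar>Tw x - \<zeta>\<bar>)"
      using ginf by (intro mult_left_mono) auto
    moreover have "0 \<le> F Gw - F G + ginf * (LINT x:circ \<rho>1|hausdorff1. Tw x - c)"
      using variation[OF w] \<open>m < c\<close> by simp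
    ultimately show ?thesis unfolding energy_circ F_def by (simp add: distrib_left)
  qed
  have "is_minimizer g ginf \<rho>1 \<rho>2 m2 \<zeta> u"
    unfolding is_minimizer_def using comp min\<zeta> by blast
  moreover have "AE x in lebesgue. x \<in> ?A \<longrightarrow> v x = u x" if "is_minimizer g ginf \<rho>1 \<rho>2 m2 \<zeta> v" for v
    by (rule minimizer_unique[OF radii less_imp_le[OF ginf] g growth comp min\<zeta> that])
  ultimately show "is_unique_minimizer g (slope_at_infinity g') \<rho>1 \<rho>2 m2 \<zeta> u"
    by (simp add: is_unique_minimizer_def ginf_def)
qed

end
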